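(* For formal variables $T$, $q$ and $u$, $$\sum_{\lambda\in\mathcal{SC}} (-1)^{d_\lambda}T^{|\lambda|/2}\prod_{s\in\lambda}\frac{1-u^{-2\varepsilon_s}q^{2h_s}}{1-q^{2h_s}}\prod_{s\in\Delta}\frac{1-uq^{h_s}}{1-u^{-1}q^{h_s}}=\prod_{m\ge 1}\frac{1}{1+T^{m/2}}\prod_{m,r\ge 1}\frac{1-u^{-1}q^{2r-1}T^{m/2}}{1-uq^{2r-1}T^{m/2}}\cdot\frac{\left(1-u^{-2}q^{2(r+1)}T^m\right)^{\lceil r/2 \rceil}\left(1-u^2q^{2r}T^m\right)^{\lceil r/2 \rceil}}{\left(1-q^{2r}T^m\right)^{\lceil r/2 \rceil}\left(1-q^{2(r+1)}T^m\right)^{\lceil r/2 \rceil}},$$ where the sum runs over all self-conjugate partitions $\lambda$.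
   Context: Both sides are understood as formal power series in $T^{1/2}$ and $q$ with coefficients in $\mathbb{Z}[u,u^{-1}]$. For a partition $\lambda$, $h_s$ is the hook length of a box $s$, $\Delta$ is the set of boxes on the main diagonal of the Ferrers diagram (English convention), $d_\lambda=\max\{s:\lambda_s\ge s\}$ is the Durfee square size, and $\varepsilon_s=-1$ if $s$ is strictly below the main diagonal, $\varepsilon_s=1$ otherwise. $\mathcal{SC}$ is the set of self-conjugate partitions (including the empty partition). *)

theory Defs
  imports
    "HOL-Library.Poly_Mapping"
    "HOL-Computational_Algebra.Formal_Power_Series"
begin

section \<open>Self-conjugate partitions\<close>

text \<open>A partition is the weakly decreasing list of its positive parts.  Parts and boxes are
  indexed from 1: the box \<open>(i, j)\<close> lies in row \<open>i\<close> (rows numbered downwards) and column \<open>j\<close>.\<close>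

definition is_partition :: "nat list \<Rightarrow> bool" where
  "is_partition p \<longleftrightarrow> sorted_wrt (\<ge>) p \<and> 0 \<notin> set p"

definition part :: "nat list \<Rightarrow> nat \<Rightarrow> nat" where
  "part p s = (if 1 \<le> s \<and> s \<le> length p then p ! (s - 1) else 0)"

definition conjugate :: "nat list \<Rightarrow> nat list" where
  "conjugate p = map (\<lambda>j. card {i. 1 \<le> i \<and> j \<le> part p i}) [1..<Suc (part p 1)]"

definition SC :: "nat list set" where
  "SC = {p. is_partition p \<and> conjugate p = p}"

definition boxes :: "nat list \<Rightarrow> (nat \<times> nat) set" where
  "boxes p = {(i, j). 1 \<le> i \<and> 1 \<le> j \<and> j \<le> part p i}"

definition diag :: "nat list \<Rightarrow> (nat \<times> nat) set" where
  "diag p = {(i, j) \<in> boxes p. i = j}"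

definition hook :: "nat list \<Rightarrow> nat \<times> nat \<Rightarrow> nat" where
  "hook p = (\<lambda>(i, j). card {(i', j') \<in> boxes p. i' = i \<and> j \<le> j' \<or> j' = j \<and> i \<le> i'})"

definition eps :: "nat \<times> nat \<Rightarrow> int" where
  "eps = (\<lambda>(i, j). if j < i then -1 else 1)"

text \<open>The inserted \<open>0\<close> only matters for the empty partition, whose Durfee square has size 0.\<close>

definition durfee :: "nat list \<Rightarrow> nat" where
  "durfee p = Max (insert 0 {s. 1 \<le> s \<and> s \<le> part p s})"


section \<open>Formal power series in the square root of T and in q over the Laurent polynomials in u\<close>

text \<open>Finitely supported functions \<open>int \<Rightarrow> int\<close> with the convolution product are the Laurent
  polynomials over the integers; the single exponent \<open>k\<close> stands for the \<open>k\<close>-th power of \<open>u\<close>.\<close>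

type_synonym laurent = "int \<Rightarrow>\<^sub>0 int"

text \<open>The inner series variable is \<open>q\<close>, the outer one is \<open>t\<close>, the square root of \<open>T\<close>; so
  \<open>T\<close> is \<open>t^2\<close>, and the power \<open>n/2\<close> of \<open>T\<close> is \<open>t^n\<close>.\<close>

type_synonym series = "laurent fps fps"

definition u_pow :: "int \<Rightarrow> series" where
  "u_pow k = fps_const (fps_const (Poly_Mapping.single k 1))"

definition q :: series where
  "q = fps_const fps_X"

definition t :: series where
  "t = fps_X"

text \<open>Quotient by a series whose coefficient at \<open>t^0 q^0\<close> is 1.\<close>

definition series_divide :: "series \<Rightarrow> series \<Rightarrow> series" (infixl \<open>\<oslash>\<close> 70) where
  "f \<oslash> g = f * fps_right_inverse g (fps_right_inverse (fps_nth g 0) 1)"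

lemma series_divide_mult_cancel:
  assumes "fps_nth (fps_nth g 0) 0 = 1"
  shows "(f \<oslash> g) * g = f"
proof -
  have "fps_nth g 0 * fps_right_inverse (fps_nth g 0) 1 = 1"
    using assms by (intro fps_right_inverse) simp
  then have "g * fps_right_inverse g (fps_right_inverse (fps_nth g 0) 1) = 1"
    by (rule fps_right_inverse)
  then show ?thesis
    by (simp add: series_divide_def mult.assoc mult.commute[of _ g])
qed

text \<open>Unconditional convergence in the \<open>(t, q)\<close>-adic sense: every coefficient of the finite
  partial sums or products is eventually constant.  The metric of the library on
  \<^typ>\<open>laurent fps fps\<close> is only \<open>t\<close>-adic, and a product over infinitely many powers of \<open>q\<close>
  with a fixed power of \<open>t\<close> need not converge in it.\<close>

definition has_formal_sum :: "('i \<Rightarrow> series) \<Rightarrow> 'i set \<Rightarrow> series \<Rightarrow> bool" where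
  "has_formal_sum f A F \<longleftrightarrow>
     (\<forall>n k. \<forall>\<^sub>F S in finite_subsets_at_top A.
        fps_nth (fps_nth (\<Sum>i\<in>S. f i) n) k = fps_nth (fps_nth F n) k)"

definition has_formal_prod :: "('i \<Rightarrow> series) \<Rightarrow> 'i set \<Rightarrow> series \<Rightarrow> bool" where
  "has_formal_prod f A F \<longleftrightarrow>
     (\<forall>n k. \<forall>\<^sub>F S in finite_subsets_at_top A.
        fps_nth (fps_nth (\<Prod>i\<in>S. f i) n) k = fps_nth (fps_nth F n) k)"

lemma eventually_const_unique:
  assumes "\<forall>\<^sub>F S in finite_subsets_at_top A. c S = a"
    and "\<forall>\<^sub>F S in finite_subsets_at_top A. c S = b"
  shows "a = b"
proof -
  have "\<forall>\<^sub>F S in finite_subsets_at_top A. a = b"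
    using assms by eventually_elim simp
  then show ?thesis by simp
qed

lemma has_formal_sum_unique:
  "has_formal_sum f A F \<Longrightarrow> has_formal_sum f A G \<Longrightarrow> F = G"
  unfolding has_formal_sum_def
  by (intro fps_ext, rule eventually_const_unique) (drule spec, drule spec, assumption)+

lemma has_formal_prod_unique:
  "has_formal_prod f A F \<Longrightarrow> has_formal_prod f A G \<Longrightarrow> F = G"
  unfolding has_formal_prod_def
  by (intro fps_ext, rule eventually_const_unique) (drule spec, drule spec, assumption)+

end

theory Submission
  imports
    Defs
    "HOL-Library.Function_Algebras"
    "HOL-Library.Product_Plus"
    "HOL-Combinatorics.Permutations"
    "HOL-Computational_Algebra.Formal_Laurent_Series"
begin

text \<open>Divide the left-hand side by the right-hand side; the quotient is a series in \<open>t\<close> whose coefficients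
  are Laurent polynomials in \<open>u\<close> over the power series in \<open>q\<close>, so it is determined by its values at
  \<open>u = - q^(2g)\<close>, \<open>g = 1, 2, \<dots>\<close>.  There the weight of a self-conjugate partition vanishes unless the
  partition is a \<open>2g\<close>-core.  These cores are indexed by the lattice of integer vectors of length \<open>g\<close>,
  and their weights are quotients of Weyl denominators, so the left-hand side is the lattice side of a
  Macdonald identity at the principal specialisation, while the right-hand side telescopes to its
  product side.  The lattice symmetries determine the Macdonald identity only up to a series in \<open>t\<close>
  alone, which is enough: the quotient of the two sides is free of \<open>u\<close> and \<open>q\<close>, and setting
  \<open>q = 0\<close> reduces its computation to Euler's theorem on odd and distinct parts.\<close>

section \<open>Symmetries of an affine theta product\<close>

text \<open>The value u = - q^(2g) comes from pairs of boxes mirrored in the diagonal: with common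
  hook length h their weight has the numerator (1 - u^2 q^(2h)) (1 - u^(-2) q^(2h)), which vanishes
  at h = 2g. The minus sign turns the short factors of the theta product into 1 + x_i, so that
  translations and reflections act without signs. The substitution sends u^(-1) to a Laurent series
  of negative order, so it is meaningful only where, at each power of t, the exponents of u are
  bounded uniformly in the power of q. The denominators 1 - u^(-1) q^h would break this bound, but
  the diagonal box also carries 1 - u^(-2) q^(2h), which cancels them; on the product side the power
  of u never exceeds that of t. Weyl denominators arise because at x_i = q^(2i+1) the exponents are
  bilinear in the point and the lattice vector, up to terms whose sum is independent of the
  permutation, so that the two can exchange roles. The affine root system is a twisted one with
  finite part of type B: short roots occur at all powers of t, long roots at even powers.\<close>

abbreviation lookup where "lookup \<equiv> Poly_Mapping.lookup"
abbreviation keys where "keys \<equiv> Poly_Mapping.keys"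

text \<open>Exponent vectors are indexed by all naturals so that one type serves every rank g; by
  \<open>macdonald_zero_outside\<close> only the first g coordinates occur.\<close>

type_synonym mpoly_series = "((nat \<Rightarrow> int) \<Rightarrow>\<^sub>0 int) fps"

text \<open>Extended by zero to negative exponents of the series variable, so that lattice translations act.\<close>

definition cf :: "mpoly_series \<Rightarrow> int \<times> (nat \<Rightarrow> int) \<Rightarrow> int" where
  "cf f z = (if fst z < 0 then 0 else lookup (fps_nth f (nat (fst z))) (snd z))"

section \<open>Coefficients as functions on a lattice, and their behaviour under affine maps\<close>

lemma lookup_mult_group:
  fixes a b :: "'a::ab_group_add \<Rightarrow>\<^sub>0 'b::semiring_0"
  shows "lookup (a * b) v = (\<Sum>w\<in>keys a. lookup a w * lookup b (v - w))"
proof -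
  have "(\<Sum>q. lookup b q when v = l + q) = lookup b (v - l)" for l
  proof -
    have "(lookup b q when v = l + q) = (lookup b q when v - l = q)" for q
      by (simp add: when_def algebra_simps)
    then show ?thesis by simp
  qed
  then have "lookup (a * b) v = (\<Sum>l. lookup a l * lookup b (v - l))"
    by (simp add: lookup_mult)
  also have "\<dots> = (\<Sum>w\<in>keys a. lookup a w * lookup b (v - w))"
    by (rule Sum_any.expand_superset) (auto simp: in_keys_iff)
  finally show ?thesis .
qed

text \<open>Convolution over the whole group of exponents, without bounds on the exponent of the
  series variable, so that a linear bijection of the exponents can be substituted into the
  sum.\<close>

lemma cf_mult:
  "finite {y. cf f y * cf g (z - y) \<noteq> 0}"
  "cf (f * g) z = (\<Sum>y | cf f y * cf g (z - y) \<noteq> 0. cf f y * cf g (z - y))"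
proof -
  obtain N v where z: "z = (N, v)" by (cases z)
  define X where "X = (SIGMA i:{0..N}. keys (fps_nth f (nat i)))"
  have fin: "finite X" unfolding X_def by auto
  have sub: "{y. cf f y * cf g (z - y) \<noteq> 0} \<subseteq> X"
    by (auto simp: cf_def X_def z in_keys_iff split: if_splits)
  show "finite {y. cf f y * cf g (z - y) \<noteq> 0}"
    using fin sub by (rule finite_subset[rotated])
  have "cf (f * g) z = (\<Sum>y\<in>X. cf f y * cf g (z - y))"
  proof (cases "N < 0")
    case True
    then show ?thesis by (simp add: cf_def X_def z)
  next
    case False
    have "cf (f * g) z = (\<Sum>i=0..nat N. lookup (fps_nth f i * fps_nth g (nat N - i)) v)"
      using False by (simp add: cf_def z fps_mult_nth lookup_sum)
    also have "\<dots> = (\<Sum>i=0..nat N. \<Sum>w\<in>keys (fps_nth f i). lookup (fps_nth f i) w * lookup (fps_nth g (nat N - i)) (v - w))"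
      by (simp add: lookup_mult_group)
    also have "\<dots> = (\<Sum>i=0..N. \<Sum>w\<in>keys (fps_nth f (nat i)). lookup (fps_nth f (nat i)) w * lookup (fps_nth g (nat N - nat i)) (v - w))"
      by (rule sum.reindex_bij_witness[of _ nat int]) (use False in auto)
    also have "\<dots> = (\<Sum>i=0..N. \<Sum>w\<in>keys (fps_nth f (nat i)). cf f (i, w) * cf g (z - (i, w)))"
      by (intro sum.cong refl) (auto simp: cf_def z nat_diff_distrib)
    also have "\<dots> = (\<Sum>y\<in>X. cf f y * cf g (z - y))"
      unfolding X_def by (subst sum.Sigma) (auto simp: case_prod_beta)
    finally show ?thesis .
  qed
  also have "\<dots> = (\<Sum>y | cf f y * cf g (z - y) \<noteq> 0. cf f y * cf g (z - y))"
    by (rule sum.mono_neutral_right[OF fin sub]) auto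
  finally show "cf (f * g) z = (\<Sum>y | cf f y * cf g (z - y) \<noteq> 0. cf f y * cf g (z - y))" .
qed

lemma cf_one: "cf 1 z = (if z = 0 then 1 else 0)"
  by (cases z) (auto simp: cf_def lookup_one when_def zero_prod_def nat_eq_iff)

text \<open>Quasi-invariance: \<open>L\<close> is the linear part, \<open>w\<close> the translation
  and \<open>s\<close> the scalar. Two series are allowed because a permutation of the variables
  carries one factor to another.\<close>

definition transforms ::
  "(int \<times> (nat \<Rightarrow> int) \<Rightarrow> int \<times> (nat \<Rightarrow> int)) \<Rightarrow> int \<times> (nat \<Rightarrow> int) \<Rightarrow> int \<Rightarrow> mpoly_series \<Rightarrow> mpoly_series \<Rightarrow> bool"
  where "transforms L w s f f' \<longleftrightarrow> s \<noteq> 0 \<and> (\<forall>z. cf f (L z + w) = s * cf f' z)"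

locale exponent_map =
  fixes L :: "int \<times> (nat \<Rightarrow> int) \<Rightarrow> int \<times> (nat \<Rightarrow> int)"
  assumes add: "L (y + z) = L y + L z" and bij: "bij L"
begin

lemma diff: "L (y - z) = L y - L z"
  using add[of "y - z" z] by (simp add: algebra_simps)

lemma zero: "L 0 = 0"
  using add[of 0 0] by simp

lemma transforms_one: "transforms L 0 1 1 1"
proof -
  have "L z = 0 \<longleftrightarrow> z = 0" for z
    using bij zero by (metis bij_pointE)
  then show ?thesis by (simp add: transforms_def cf_one)
qed

text \<open>Substituting y \<mapsto> L y + w in the convolution turns L z + (w + w') - (L y + w)
  into L (z - y) + w'; hence translations add up and scalars multiply.\<close>

lemma transforms_mult:
  assumes f: "transforms L w s f f'" and g: "transforms L w' s' g g'"
  shows "transforms L (w + w') (s * s') (f * g) (f' * g')"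
proof -
  have ss: "s \<noteq> 0" "s' \<noteq> 0" using f g by (auto simp: transforms_def)
  have f1: "cf f (L z + w) = s * cf f' z" and g1: "cf g (L z + w') = s' * cf g' z" for z
    using f g unfolding transforms_def by blast+
  have "cf (f * g) (L z + (w + w')) = s * s' * cf (f' * g') z" for z
  proof -
    have term_eq: "cf f (L y + w) * cf g (L z + (w + w') - (L y + w)) = s * s' * (cf f' y * cf g' (z - y))" for y
    proof -
      have "L z + (w + w') - (L y + w) = L (z - y) + w'"
        by (simp add: diff algebra_simps)
      then show ?thesis by (simp only: f1 g1 mult_ac)
    qed
    have inv: "L (inv L x) = x" "inv L (L x) = x" for x
      using bij by (simp_all add: bij_is_surj surj_f_inv_f bij_is_inj)
    have "cf (f * g) (L z + (w + w')) =
       (\<Sum>y | cf f y * cf g (L z + (w + w') - y) \<noteq> 0. cf f y * cf g (L z + (w + w') - y))"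
      by (rule cf_mult)
    also have "\<dots> = (\<Sum>y | cf f' y * cf g' (z - y) \<noteq> 0. s * s' * (cf f' y * cf g' (z - y)))"
    proof (rule sum.reindex_bij_witness[of _ "\<lambda>y. L y + w" "\<lambda>y. inv L (y - w)"], goal_cases)
      case (1 a) then show ?case by (simp add: inv)
    next
      case (2 a)
      have "cf f a * cf g (L z + (w + w') - a) = s * s' * (cf f' (inv L (a - w)) * cf g' (z - inv L (a - w)))"
        using term_eq[of "inv L (a - w)"] by (simp add: inv)
      then show ?case using 2 by auto
    next
      case (3 b) then show ?case by (simp add: inv)
    next
      case (4 b) then show ?case using term_eq[of b] ss by auto
    next
      case (5 a)
      show ?case using term_eq[of "inv L (a - w)"] by (simp add: inv)
    qed
    also have "\<dots> = s * s' * cf (f' * g') z"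
      by (simp add: cf_mult(2) sum_distrib_left)
    finally show ?thesis .
  qed
  then show ?thesis using ss by (simp add: transforms_def)
qed

lemma transforms_prod:
  assumes "finite I" "\<And>i. i \<in> I \<Longrightarrow> transforms L (w i) (s i) (f i) (f' i)"
  shows "transforms L (\<Sum>i\<in>I. w i) (\<Prod>i\<in>I. s i) (\<Prod>i\<in>I. f i) (\<Prod>i\<in>I. f' i)"
  using assms by (induction I rule: finite_induct) (auto simp: transforms_one transforms_mult)

end

section \<open>The theta factors and their coefficients\<close>

definition unit_vec :: "nat \<Rightarrow> int \<Rightarrow> nat \<Rightarrow> int" where
  "unit_vec i k = (\<lambda>j. if j = i then k else 0)"

text \<open>Up to the monomial \<open>x\<^sub>i\<close>, the long factor is the product of the theta functions at \<open>- x\<^sub>i x\<^sub>j\<close> and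
  \<open>- x\<^sub>i / x\<^sub>j\<close>; summed over \<open>r\<^sup>2 + s\<^sup>2\<close> its symmetries are visible.\<close>

definition short_factor :: "nat \<Rightarrow> mpoly_series" where
  "short_factor i = Abs_fps (\<lambda>n. \<Sum>k | k * (k - 1) = 2 * int n. Poly_Mapping.single (unit_vec i k) 1)"

definition long_factor :: "nat \<Rightarrow> nat \<Rightarrow> mpoly_series" where
  "long_factor i j = Abs_fps (\<lambda>n. \<Sum>(r, s) | r\<^sup>2 + s\<^sup>2 = 2 * int n + 1.
     Poly_Mapping.single (unit_vec i r + unit_vec j s) ((-1) ^ nat (r\<^sup>2 + 1)))"

lemma finite_triangular: "finite {k::int. k * (k - 1) = 2 * int n}"
proof (rule finite_subset)
  show "{k::int. k * (k - 1) = 2 * int n} \<subseteq> {- 2 * int n - 1..2 * int n + 1}"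
  proof safe
    fix k :: int assume a: "k * (k - 1) = 2 * int n"
    have "\<bar>k\<bar> \<le> 2 * int n + 1"
    proof (rule ccontr)
      assume "\<not> ?thesis"
      then have c: "k \<ge> 2 * int n + 2 \<or> k \<le> - (2 * int n + 2)" by linarith
      then have "k * (k - 1) \<ge> 2 * int n + 1"
      proof
        assume "k \<ge> 2 * int n + 2"
        then have "k * (k - 1) \<ge> 1 * (2 * int n + 1)" by (intro mult_mono) auto
        then show ?thesis by simp
      next
        assume "k \<le> - (2 * int n + 2)"
        then have "(- k) * (- (k - 1)) \<ge> 1 * (2 * int n + 1)" by (intro mult_mono) auto
        then show ?thesis by (simp add: algebra_simps)
      qed
      then show False using a by simp
    qed
    then show "k \<in> {- 2 * int n - 1..2 * int n + 1}" by auto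
  qed
qed simp

lemma finite_two_squares: "finite {(r, s::int). r\<^sup>2 + s\<^sup>2 = 2 * int n + 1}"
proof (rule finite_subset)
  have b: "\<bar>r\<bar> \<le> m" if "r\<^sup>2 \<le> m" for r m :: int
  proof (cases "r = 0")
    case False
    then have "1 \<le> \<bar>r\<bar>" by simp
    then have "\<bar>r\<bar> * 1 \<le> \<bar>r\<bar> * \<bar>r\<bar>" by (intro mult_left_mono) auto
    then show ?thesis using that by (simp add: power2_eq_square)
  qed (use that in auto)
  show "{(r, s::int). r\<^sup>2 + s\<^sup>2 = 2 * int n + 1} \<subseteq>
    {- 2 * int n - 1..2 * int n + 1} \<times> {- 2 * int n - 1..2 * int n + 1}"
  proof safe
    fix r s :: int assume "r\<^sup>2 + s\<^sup>2 = 2 * int n + 1"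
    then have "r\<^sup>2 \<le> 2 * int n + 1" "s\<^sup>2 \<le> 2 * int n + 1"
      using zero_le_power2[of r] zero_le_power2[of s] by linarith+
    then have "\<bar>r\<bar> \<le> 2 * int n + 1" "\<bar>s\<bar> \<le> 2 * int n + 1" using b by blast+
    then show "r \<in> {- 2 * int n - 1..2 * int n + 1}" "s \<in> {- 2 * int n - 1..2 * int n + 1}" by auto
  qed
qed simp

lemma unit_vec_eq_iff: "v = unit_vec i k \<longleftrightarrow> v = unit_vec i (v i) \<and> k = v i"
  by (auto simp: unit_vec_def)

lemma cf_short_factor:
  "cf (short_factor i) (n, v) = (if v = unit_vec i (v i) \<and> v i * (v i - 1) = 2 * n then 1 else 0)"
proof (cases "n < 0")
  case True
  have "v i * (v i - 1) \<ge> 0" by (cases "v i \<ge> 1") (auto intro: mult_nonpos_nonpos)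
  then show ?thesis using True by (auto simp: cf_def)
next
  case False
  have "cf (short_factor i) (n, v) = (\<Sum>k | k * (k - 1) = 2 * n. if v = unit_vec i k then 1 else 0)"
    using False by (simp add: cf_def short_factor_def lookup_sum lookup_single when_def)
  also have "\<dots> = (\<Sum>k | k * (k - 1) = 2 * n. if k = v i then (if v = unit_vec i (v i) then 1 else 0) else 0)"
    by (intro sum.cong refl) (subst unit_vec_eq_iff, auto)
  also have "\<dots> = (if v i * (v i - 1) = 2 * n then (if v = unit_vec i (v i) then 1 else 0) else 0)"
    using False finite_triangular[of "nat n"] by (subst sum.delta) auto
  finally show ?thesis by auto
qed

lemma neg_one_power_square: "(-1::int) ^ nat (r\<^sup>2 + 1) = (if even r then -1 else 1)"
proof -
  have "even (nat (r\<^sup>2 + 1)) \<longleftrightarrow> even (r\<^sup>2 + 1)" by (subst even_nat_iff) auto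
  then show ?thesis by (cases "even (nat (r\<^sup>2 + 1))") auto
qed

lemma cf_long_factor:
  assumes "i \<noteq> j"
  shows "cf (long_factor i j) (n, v) =
    (if v = unit_vec i (v i) + unit_vec j (v j) \<and> (v i)\<^sup>2 + (v j)\<^sup>2 = 2 * n + 1
     then (if even (v i) then -1 else 1) else 0)"
proof (cases "n < 0")
  case True
  have "(v i)\<^sup>2 + (v j)\<^sup>2 \<ge> 0" by simp
  then have "(v i)\<^sup>2 + (v j)\<^sup>2 \<noteq> 2 * n + 1" using True by linarith
  then show ?thesis using True by (simp add: cf_def)
next
  case False
  let ?S = "{(r, s). r\<^sup>2 + s\<^sup>2 = 2 * n + 1}"
  have eq: "unit_vec i r + unit_vec j s = v \<longleftrightarrow> (r, s) = (v i, v j) \<and> v = unit_vec i (v i) + unit_vec j (v j)" for r s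
    using assms by (auto simp: unit_vec_def fun_eq_iff)
  have "cf (long_factor i j) (n, v) = (\<Sum>(r, s)\<in>?S. if unit_vec i r + unit_vec j s = v then (if even r then -1 else 1) else 0)"
    using False by (simp add: cf_def long_factor_def lookup_sum lookup_single when_def case_prod_beta neg_one_power_square)
  also have "\<dots> = (\<Sum>p\<in>?S. if p = (v i, v j) then
     (if v = unit_vec i (v i) + unit_vec j (v j) then (if even (v i) then -1 else 1) else 0) else 0)"
    by (intro sum.cong refl) (simp only: case_prod_beta eq prod.collapse, auto)
  also have "\<dots> = (if (v i, v j) \<in> ?S then (if v = unit_vec i (v i) + unit_vec j (v j) then (if even (v i) then -1 else 1) else 0) else 0)"
    using False finite_two_squares[of "nat n"] by (subst sum.delta) auto
  finally show ?thesis by auto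
qed

definition pairs :: "nat \<Rightarrow> (nat \<times> nat) set" where
  "pairs g = {(i, j). i < j \<and> j < g}"

lemma finite_pairs [simp]: "finite (pairs g)"
  by (rule finite_subset[of _ "{..<g} \<times> {..<g}"]) (auto simp: pairs_def)

lemma pairs_neq: "p \<in> pairs g \<Longrightarrow> fst p \<noteq> snd p"
  by (auto simp: pairs_def)

text \<open>Up to a series in the series variable alone, the denominator of the twisted affine root
  system \<open>D_(g+1)^(2)\<close> with x_i replaced by - x_i; \<open>macdonald_product\<close>
  gives the product form.\<close>

definition macdonald :: "nat \<Rightarrow> mpoly_series" where
  "macdonald g = (\<Prod>i<g. short_factor i) * (\<Prod>(i, j)\<in>pairs g. long_factor i j)"

section \<open>Translations, reflections and permutations acting on the theta product\<close>

lemma sum_fun_apply: "(\<Sum>a\<in>A. f a) x = (\<Sum>a\<in>A. f a x)"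
  by (induction A rule: infinite_finite_induct) auto

lemma sum_pairs_through:
  assumes "l < g"
  shows "(\<Sum>p\<in>pairs g. if fst p = l \<or> snd p = l then h p else 0) =
         (\<Sum>i\<in>{..<g} - {l}. h (min i l, max i l))"
proof -
  have "(\<Sum>p\<in>pairs g. if fst p = l \<or> snd p = l then h p else 0) =
        sum h {p \<in> pairs g. fst p = l \<or> snd p = l}"
    by (subst sum.inter_filter) auto
  also have "\<dots> = (\<Sum>i\<in>{..<g} - {l}. h (min i l, max i l))"
    by (rule sum.reindex_bij_witness[of _ "\<lambda>i. (min i l, max i l)" "\<lambda>(i, j). if i = l then j else i"])
       (use assms in \<open>auto simp: pairs_def min_def max_def split: if_splits\<close>)
  finally show ?thesis .
qed

text \<open>Only the linear parts of the symmetries are recorded here and below; the translation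
  vectors differ from factor to factor and enter as the \<open>w\<close> of
  \<open>transforms\<close>.\<close>

definition shift_map :: "nat \<Rightarrow> int \<times> (nat \<Rightarrow> int) \<Rightarrow> int \<times> (nat \<Rightarrow> int)" where
  "shift_map l z = (fst z + 2 * snd z l, snd z)"

definition reflect_map :: "nat \<Rightarrow> int \<times> (nat \<Rightarrow> int) \<Rightarrow> int \<times> (nat \<Rightarrow> int)" where
  "reflect_map l z = (fst z, (snd z)(l := - snd z l))"

definition swap_map :: "nat \<Rightarrow> nat \<Rightarrow> int \<times> (nat \<Rightarrow> int) \<Rightarrow> int \<times> (nat \<Rightarrow> int)" where
  "swap_map a b z = (fst z, snd z \<circ> transpose a b)"

interpretation shift: exponent_map "shift_map l" for l
proof
  show "bij (shift_map l)"
    by (rule bij_betw_byWitness[of _ "\<lambda>z. (fst z - 2 * snd z l, snd z)"]) (auto simp: shift_map_def)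
qed (auto simp: shift_map_def)

interpretation reflect: exponent_map "reflect_map l" for l
proof
  show "bij (reflect_map l)"
    by (rule bij_betw_byWitness[of _ "reflect_map l"]) (auto simp: reflect_map_def)
qed (auto simp: reflect_map_def fun_eq_iff)

interpretation swap: exponent_map "swap_map a b" for a b
proof
  show "bij (swap_map a b)"
    by (rule bij_betw_byWitness[of _ "swap_map a b"]) (auto simp: swap_map_def comp_assoc)
qed (auto simp: swap_map_def fun_eq_iff)

lemma transforms_if_zero:
  assumes "\<And>n v. cf f (L (n, v)) = cf f (n, v)"
  shows "transforms L 0 1 f f"
  using assms by (simp add: transforms_def)

text \<open>Quasi-periodicity of the theta series: from v to v + 2 the exponent v (v - 1) / 2 grows
  by 2 v + 1. The 2 v is the linear map, the 1 goes into the translation vector. The step is 2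
  because the sign in the long factors depends on the parity of v.\<close>

lemma shift_short:
  "transforms (shift_map l) (if i = l then (1, unit_vec l 2) else 0) 1 (short_factor i) (short_factor i)"
proof (cases "i = l")
  case True
  have "v + unit_vec l 2 = unit_vec l ((v + unit_vec l 2) l) \<longleftrightarrow> v = unit_vec l (v l)" for v
    by (auto simp: fun_eq_iff unit_vec_def)
  moreover have "(v + unit_vec l 2) l = v l + 2" for v by (simp add: unit_vec_def)
  moreover have "(v l + 2) * (v l + 2 - 1) = 2 * (n + 2 * v l + 1) \<longleftrightarrow> v l * (v l - 1) = 2 * n" for v and n :: int
    by (simp add: algebra_simps)
  ultimately have "cf (short_factor l) (n + 2 * v l + 1, v + unit_vec l 2) = cf (short_factor l) (n, v)" for n v
    unfolding cf_short_factor by simp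
  then show ?thesis using True by (simp add: transforms_def shift_map_def)
next
  case False
  have "cf (short_factor i) (n + 2 * v l, v) = cf (short_factor i) (n, v)" for n v
  proof (cases "v = unit_vec i (v i)")
    case True
    then have "v l = 0" using False by (metis unit_vec_def)
    then show ?thesis by simp
  next
    case False
    then show ?thesis unfolding cf_short_factor by (simp only: simp_thms if_False)
  qed
  then show ?thesis using False by (simp add: transforms_def shift_map_def)
qed

text \<open>The same step changes v^2 / 2 by 2 v + 2: the linear map is shared with the short
  factors, and only the constant differs.\<close>

lemma shift_long:
  assumes "i \<noteq> j"
  shows "transforms (shift_map l) (if i = l \<or> j = l then (2, unit_vec l 2) else 0) 1 (long_factor i j) (long_factor i j)"
proof (cases "i = l \<or> j = l")
  case True
  have sq: "(x + 2)\<^sup>2 = x\<^sup>2 + 4 * x + 4" for x :: int by (simp add: power2_eq_square algebra_simps)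
  have lin: "(a + 4 * x + 4 + b = 2 * (n + 2 * x + 2) + 1) = (a + b = 2 * n + 1)"
    "(b + (a + 4 * x + 4) = 2 * (n + 2 * x + 2) + 1) = (b + a = 2 * n + 1)" for a b x n :: int
    by presburger+
  show ?thesis using True
  proof
    assume l: "i = l"
    have "v + unit_vec i 2 = unit_vec i ((v + unit_vec i 2) i) + unit_vec j ((v + unit_vec i 2) j) \<longleftrightarrow>
      v = unit_vec i (v i) + unit_vec j (v j)" for v
      using assms by (auto simp: fun_eq_iff unit_vec_def)
    moreover have "(v + unit_vec i 2) i = v i + 2" "(v + unit_vec i 2) j = v j" for v
      using assms by (auto simp: unit_vec_def)
    moreover have "(v i + 2)\<^sup>2 + (v j)\<^sup>2 = 2 * (n + 2 * v i + 2) + 1 \<longleftrightarrow> (v i)\<^sup>2 + (v j)\<^sup>2 = 2 * n + 1" for v and n :: int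
      unfolding sq by (rule lin)
    ultimately have "cf (long_factor i j) (n + 2 * v i + 2, v + unit_vec i 2) = cf (long_factor i j) (n, v)" for n v
      unfolding cf_long_factor[OF assms] by simp
    then show ?thesis using l by (simp add: transforms_def shift_map_def)
  next
    assume l: "j = l"
    have "v + unit_vec j 2 = unit_vec i ((v + unit_vec j 2) i) + unit_vec j ((v + unit_vec j 2) j) \<longleftrightarrow>
      v = unit_vec i (v i) + unit_vec j (v j)" for v
      using assms by (auto simp: fun_eq_iff unit_vec_def)
    moreover have "(v + unit_vec j 2) j = v j + 2" "(v + unit_vec j 2) i = v i" for v
      using assms by (auto simp: unit_vec_def)
    moreover have "(v i)\<^sup>2 + (v j + 2)\<^sup>2 = 2 * (n + 2 * v j + 2) + 1 \<longleftrightarrow> (v i)\<^sup>2 + (v j)\<^sup>2 = 2 * n + 1" for v and n :: int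
      unfolding sq by (rule lin)
    ultimately have "cf (long_factor i j) (n + 2 * v j + 2, v + unit_vec j 2) = cf (long_factor i j) (n, v)" for n v
      unfolding cf_long_factor[OF assms] by simp
    then show ?thesis using l by (simp add: transforms_def shift_map_def)
  qed
next
  case False
  have "v l = 0" if "v = unit_vec i (v i) + unit_vec j (v j)" for v
  proof -
    have "v l = (unit_vec i (v i) + unit_vec j (v j)) l" using that by simp
    then show ?thesis using False by (simp add: unit_vec_def)
  qed
  then show ?thesis using False
    by (auto simp: transforms_def shift_map_def cf_long_factor[OF assms])
qed

text \<open>The variable \<open>l\<close> occurs in one short and g - 1 long factors, so the
  translation vectors add up to 1 + 2 (g - 1) in the series exponent and to 2 + 2 (g - 1) = 2g in
  the coordinate.\<close>

lemma macdonald_shift: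
  assumes "l < g"
  shows "cf (macdonald g) (n + 2 * v l + 2 * int g - 1, v + unit_vec l (2 * int g)) = cf (macdonald g) (n, v)"
proof -
  let ?w1 = "\<lambda>i. if i = l then (1::int, unit_vec l 2) else 0"
  let ?w2 = "\<lambda>p. if fst p = l \<or> snd p = l then (2::int, unit_vec l 2) else 0"
  have "transforms (shift_map l) ((\<Sum>i<g. ?w1 i) + (\<Sum>p\<in>pairs g. ?w2 p)) ((\<Prod>i<g. 1) * (\<Prod>p\<in>pairs g. 1)) (macdonald g) (macdonald g)"
    unfolding macdonald_def case_prod_beta
    by (intro shift.transforms_mult shift.transforms_prod shift_short shift_long)
       (auto dest: pairs_neq)
  moreover have "(\<Sum>i<g. ?w1 i) + (\<Sum>p\<in>pairs g. ?w2 p) = (2 * int g - 1, unit_vec l (2 * int g))"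
  proof (rule prod_eqI)
    have g: "int (g - Suc 0) = int g - 1" using assms by auto
    have "(\<Sum>i<g. ?w1 i) = (1, unit_vec l 2)" using assms by simp
    moreover have "(\<Sum>p\<in>pairs g. ?w2 p) = (\<Sum>i\<in>{..<g} - {l}. (2::int, unit_vec l 2))"
      using sum_pairs_through[OF assms, of "\<lambda>p. (2::int, unit_vec l 2)"] by simp
    ultimately have eq: "(\<Sum>i<g. ?w1 i) + (\<Sum>p\<in>pairs g. ?w2 p) = (1, unit_vec l 2) + (\<Sum>i\<in>{..<g} - {l}. (2::int, unit_vec l 2))"
      by simp
    show "fst ((\<Sum>i<g. ?w1 i) + (\<Sum>p\<in>pairs g. ?w2 p)) = fst (2 * int g - 1, unit_vec l (2 * int g))"
      unfolding eq using assms g by (simp add: fst_sum)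
    show "snd ((\<Sum>i<g. ?w1 i) + (\<Sum>p\<in>pairs g. ?w2 p)) = snd (2 * int g - 1, unit_vec l (2 * int g))"
      unfolding eq using assms g by (auto simp: snd_sum fun_eq_iff sum_fun_apply unit_vec_def)
  qed
  ultimately have "cf (macdonald g) (shift_map l (n, v) + (2 * int g - 1, unit_vec l (2 * int g))) = cf (macdonald g) (n, v)"
    by (simp add: transforms_def)
  then show ?thesis by (simp add: shift_map_def algebra_simps)
qed

text \<open>The exponent k (k - 1) / 2 is symmetric about 1/2, which makes v \<mapsto> 1 - v the
  reflection; the long factors see only squares and need no translation.\<close>

lemma reflect_short:
  "transforms (reflect_map l) (if i = l then (0, unit_vec l 1) else 0) 1 (short_factor i) (short_factor i)"
proof (cases "i = l")
  case True
  have "v(l := - v l) + unit_vec l 1 = unit_vec l ((v(l := - v l) + unit_vec l 1) l) \<longleftrightarrow> v = unit_vec l (v l)" for v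
    by (auto simp: fun_eq_iff unit_vec_def)
  moreover have "(v(l := - v l) + unit_vec l 1) l = 1 - v l" for v by (simp add: unit_vec_def)
  moreover have "(1 - v l) * (1 - v l - 1) = v l * (v l - 1)" for v :: "nat \<Rightarrow> int"
    by (simp add: algebra_simps)
  ultimately have "cf (short_factor l) (n, v(l := - v l) + unit_vec l 1) = cf (short_factor l) (n, v)" for n v
    unfolding cf_short_factor by simp
  then show ?thesis using True by (simp add: transforms_def reflect_map_def)
next
  case False
  have "v(l := - v l) = unit_vec i (v i) \<longleftrightarrow> v = unit_vec i (v i)" for v
    using False by (auto simp: fun_eq_iff unit_vec_def)
  moreover have "(v(l := - v l)) i = v i" for v :: "nat \<Rightarrow> int" using False by (rule fun_upd_other)
  ultimately have "cf (short_factor i) (n, v(l := - v l)) = cf (short_factor i) (n, v)" for n v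
    unfolding cf_short_factor by (simp only:)
  then show ?thesis using False by (simp add: transforms_def reflect_map_def)
qed

lemma reflect_long:
  assumes "i \<noteq> j"
  shows "transforms (reflect_map l) 0 1 (long_factor i j) (long_factor i j)"
proof (rule transforms_if_zero)
  fix n v
  have "v(l := - v l) = unit_vec i ((v(l := - v l)) i) + unit_vec j ((v(l := - v l)) j) \<longleftrightarrow>
        v = unit_vec i (v i) + unit_vec j (v j)"
    using assms by (auto simp: fun_eq_iff unit_vec_def)
  then show "cf (long_factor i j) (reflect_map l (n, v)) = cf (long_factor i j) (n, v)"
    unfolding reflect_map_def fst_conv snd_conv cf_long_factor[OF assms] by auto
qed

lemma macdonald_reflect:
  assumes "l < g"
  shows "cf (macdonald g) (n, v(l := 1 - v l)) = cf (macdonald g) (n, v)"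
proof -
  let ?w1 = "\<lambda>i. if i = l then (0::int, unit_vec l 1) else 0"
  have "transforms (reflect_map l) ((\<Sum>i<g. ?w1 i) + (\<Sum>p\<in>pairs g. 0)) ((\<Prod>i<g. 1) * (\<Prod>p\<in>pairs g. 1)) (macdonald g) (macdonald g)"
    unfolding macdonald_def case_prod_beta
    by (intro reflect.transforms_mult reflect.transforms_prod reflect_short reflect_long)
       (auto dest: pairs_neq)
  then have "cf (macdonald g) (reflect_map l (n, v) + (0, unit_vec l 1)) = cf (macdonald g) (n, v)"
    using assms by (simp add: transforms_def)
  moreover have "v(l := - v l) + unit_vec l 1 = v(l := 1 - v l)"
    by (auto simp: fun_eq_iff unit_vec_def)
  ultimately show ?thesis by (simp add: reflect_map_def)
qed

lemma swap_short:
  "transforms (swap_map a b) 0 1 (short_factor (transpose a b i)) (short_factor i)"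
proof -
  have "v \<circ> transpose a b = unit_vec (transpose a b i) (v i) \<longleftrightarrow> v = unit_vec i (v i)" for v
    by (auto simp: fun_eq_iff unit_vec_def transpose_def split: if_splits)
  moreover have "(v \<circ> transpose a b) (transpose a b i) = v i" for v by simp
  ultimately have "cf (short_factor (transpose a b i)) (n, v \<circ> transpose a b) = cf (short_factor i) (n, v)" for n v
    unfolding cf_short_factor by simp
  then show ?thesis by (simp add: transforms_def swap_map_def)
qed

lemma swap_long:
  assumes "i \<noteq> j"
  shows "transforms (swap_map a b) 0 1 (long_factor (transpose a b i) (transpose a b j)) (long_factor i j)"
proof -
  have inj: "transpose a b x = transpose a b y \<longleftrightarrow> x = y" for x y by (metis transpose_involutory)
  have ne: "transpose a b i \<noteq> transpose a b j" using assms inj by blast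
  have "v \<circ> transpose a b = unit_vec (transpose a b i) (v i) + unit_vec (transpose a b j) (v j) \<longleftrightarrow>
        v = unit_vec i (v i) + unit_vec j (v j)" for v
  proof -
    have "v \<circ> transpose a b = unit_vec (transpose a b i) (v i) + unit_vec (transpose a b j) (v j) \<longleftrightarrow>
       (\<forall>x. v (transpose a b (transpose a b x)) = (unit_vec (transpose a b i) (v i) + unit_vec (transpose a b j) (v j)) (transpose a b x))"
      by (simp only: fun_eq_iff comp_apply) (metis transpose_involutory)
    also have "\<dots> \<longleftrightarrow> v = unit_vec i (v i) + unit_vec j (v j)"
      by (simp only: fun_eq_iff unit_vec_def plus_fun_apply transpose_involutory inj)
    finally show ?thesis .
  qed
  then show ?thesis
    by (auto simp: transforms_def swap_map_def cf_long_factor[OF ne] cf_long_factor[OF assms])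
qed

text \<open>The squares of the two exponents have an odd sum, so exactly one exponent is even;
  exchanging them moves the evenness and flips the sign.\<close>

lemma swap_long_flip:
  assumes "i \<noteq> j"
  shows "transforms (swap_map i j) 0 (-1) (long_factor i j) (long_factor i j)"
proof -
  have ne: "j \<noteq> i" using assms by simp
  have par: "even x \<longleftrightarrow> odd y" if "x\<^sup>2 + y\<^sup>2 = 2 * n + 1" for x y n :: int
  proof -
    have "odd (x\<^sup>2 + y\<^sup>2)" unfolding that by simp
    then show ?thesis by simp
  qed
  have "cf (long_factor j i) (n, v) = - cf (long_factor i j) (n, v)" for n v
    using par[of "v i" "v j" n]
    by (simp add: cf_long_factor[OF assms] cf_long_factor[OF ne] add.commute[of "unit_vec j _"] add.commute[of "(v j)\<^sup>2"])
  then show ?thesis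
    using swap_long[OF ne, of i j] by (auto simp: transforms_def)
qed

text \<open>An adjacent transposition preserves the order inside every pair i < j other than (a, a +
  1). All other long factors are therefore merely permuted, and the exceptional one contributes the
  sign.\<close>

lemma macdonald_swap_adjacent:
  assumes "Suc a < g"
  shows "cf (macdonald g) (n, v \<circ> transpose a (Suc a)) = - cf (macdonald g) (n, v)"
proof -
  let ?t = "transpose a (Suc a)"
  let ?T = "\<lambda>p. if p = (a, Suc a) then p else (?t (fst p), ?t (snd p))"
  let ?s = "\<lambda>p. if p = (a, Suc a) then -1 else 1 :: int"
  let ?f = "\<lambda>p. long_factor (fst p) (snd p)"
  have inv: "?T (?T p) = p" if "p \<in> pairs g" for p
    using that by (cases p) (auto simp: pairs_def transpose_def)
  have mem: "?T p \<in> pairs g" if "p \<in> pairs g" for p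
    using that assms by (cases p) (auto simp: pairs_def transpose_def)
  have re1: "(\<Prod>i<g. short_factor (?t i)) = (\<Prod>i<g. short_factor i)"
    by (rule prod.reindex_bij_witness[of _ ?t ?t]) (use assms in \<open>auto simp: transpose_def\<close>)
  have re2: "(\<Prod>p\<in>pairs g. ?f (?T p)) = (\<Prod>p\<in>pairs g. ?f p)"
    by (rule prod.reindex_bij_witness[of _ ?T ?T]) (use inv mem in \<open>blast | simp\<close>)+
  have "transforms (swap_map a (Suc a)) 0 (?s p) (?f (?T p)) (?f p)" if "p \<in> pairs g" for p
    using that swap_long_flip[of a "Suc a"] swap_long[of "fst p" "snd p" a "Suc a"]
    by (auto simp: pairs_def)
  then have "transforms (swap_map a (Suc a)) ((\<Sum>i<g. 0) + (\<Sum>p\<in>pairs g. 0)) ((\<Prod>i<g. 1) * (\<Prod>p\<in>pairs g. ?s p))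
    ((\<Prod>i<g. short_factor (?t i)) * (\<Prod>p\<in>pairs g. ?f (?T p))) ((\<Prod>i<g. short_factor i) * (\<Prod>p\<in>pairs g. ?f p))"
    by (intro swap.transforms_mult swap.transforms_prod swap_short) auto
  moreover have "(\<Prod>p\<in>pairs g. ?s p) = -1"
    using assms by (subst prod.delta) (simp_all, simp add: pairs_def)
  ultimately have "transforms (swap_map a (Suc a)) 0 (-1) (macdonald g) (macdonald g)"
    unfolding re1 re2 macdonald_def case_prod_beta by simp
  then show ?thesis by (auto simp: transforms_def swap_map_def)
qed

lemma macdonald_swap:
  assumes "a < b" "b < g"
  shows "cf (macdonald g) (n, v \<circ> transpose a b) = - cf (macdonald g) (n, v)"
  using assms
proof (induction "b - a" arbitrary: b v)
  case 0
  then show ?case by simp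
next
  case (Suc k)
  show ?case
  proof (cases "b = Suc a")
    case True
    then show ?thesis using Suc.prems macdonald_swap_adjacent by simp
  next
    case False
    then obtain c where c: "b = Suc c" "a < c" using Suc.prems by (cases b) auto
    \<comment> \<open>The transposition is conjugated by an adjacent one: two adjacent signs and one
      from the induction hypothesis multiply to - 1.\<close>
    have "transpose a b = transpose c b \<circ> transpose a c \<circ> transpose c b"
      using c by (auto simp: fun_eq_iff transpose_def)
    then have "cf (macdonald g) (n, v \<circ> transpose a b) =
       cf (macdonald g) (n, ((v \<circ> transpose c b) \<circ> transpose a c) \<circ> transpose c b)"
      by (simp add: comp_assoc)
    also have "\<dots> = - cf (macdonald g) (n, (v \<circ> transpose c b) \<circ> transpose a c)"
      using macdonald_swap_adjacent[of c g] c Suc.prems by simp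
    also have "\<dots> = cf (macdonald g) (n, v \<circ> transpose c b)"
      using Suc.hyps(1)[of c] Suc.hyps(2) Suc.prems c by simp
    also have "\<dots> = - cf (macdonald g) (n, v)"
      using macdonald_swap_adjacent[of c g] c Suc.prems by simp
    finally show ?thesis .
  qed
qed

lemma cf_zero_outside_mult:
  assumes "\<And>n v. cf f (n, v) \<noteq> 0 \<Longrightarrow> v i = 0" "\<And>n v. cf h (n, v) \<noteq> 0 \<Longrightarrow> v i = 0"
    and "cf (f * h) (n, v) \<noteq> 0"
  shows "v i = 0"
proof -
  obtain y where "cf f y * cf h ((n, v) - y) \<noteq> 0"
    using assms(3) unfolding cf_mult(2)[of f h] by (metis (no_types, lifting) mem_Collect_eq sum.not_neutral_contains_not_neutral)
  then have "snd y i = 0" "(v - snd y) i = 0"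
    using assms(1)[of "fst y" "snd y"] assms(2)[of "n - fst y" "v - snd y"] by (auto simp: minus_prod_def)
  then show ?thesis by simp
qed

lemma cf_zero_outside_prod:
  assumes "finite I" "\<And>x n v. x \<in> I \<Longrightarrow> cf (f x) (n, v) \<noteq> 0 \<Longrightarrow> v i = 0"
  shows "cf (\<Prod>x\<in>I. f x) (n, v) \<noteq> 0 \<Longrightarrow> v i = 0"
  using assms
proof (induction I arbitrary: n v rule: finite_induct)
  case empty
  then show ?case by (auto simp: cf_one zero_prod_def split: if_splits)
next
  case (insert x F)
  have "cf (f x * prod f F) (n, v) \<noteq> 0" using insert by simp
  then show ?case
    by (rule cf_zero_outside_mult[rotated 2]) (use insert in \<open>blast\<close>)+
qed

lemma macdonald_zero_outside:
  assumes "cf (macdonald g) (n, v) \<noteq> 0" "g \<le> i"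
  shows "v i = 0"
  using assms(1) unfolding macdonald_def
proof (rule cf_zero_outside_mult[rotated 2])
  fix n v assume "cf (\<Prod>i<g. short_factor i) (n, v) \<noteq> 0"
  then show "v i = 0"
  proof (rule cf_zero_outside_prod[rotated 2])
    fix x n v assume "x \<in> {..<g}" "cf (short_factor x) (n, v) \<noteq> 0"
    then have "v = unit_vec x (v x)" "x \<noteq> i" using assms(2) by (auto simp: cf_short_factor split: if_splits)
    then show "v i = 0" by (metis unit_vec_def)
  qed simp
next
  fix n v assume "cf (\<Prod>(i, j)\<in>pairs g. long_factor i j) (n, v) \<noteq> 0"
  then show "v i = 0"
  proof (rule cf_zero_outside_prod[rotated 2])
    fix p n v assume p: "p \<in> pairs g" "cf (case p of (i, j) \<Rightarrow> long_factor i j) (n, v) \<noteq> 0"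
    then have ne: "fst p \<noteq> snd p" "fst p \<noteq> i" "snd p \<noteq> i" using assms(2) by (auto simp: pairs_def)
    have "v = unit_vec (fst p) (v (fst p)) + unit_vec (snd p) (v (snd p))"
      using p(2) by (auto simp: case_prod_beta cf_long_factor[OF ne(1)] split: if_splits)
    then have "v i = (unit_vec (fst p) (v (fst p)) + unit_vec (snd p) (v (snd p))) i" by metis
    then show "v i = 0" using ne by (simp add: unit_vec_def)
  qed simp
qed

section \<open>Orbits of exponents and the expansion of the theta product\<close>

text \<open>The numbers \<open>2gk + j + 1\<close> and \<open>- 2gk - j\<close> form the orbit of \<open>j + 1\<close> under the symmetries
  \<open>v \<mapsto> v + 2g\<close> and \<open>v \<mapsto> 1 - v\<close> of the exponents; the energy is the accompanying change of the
  exponent of the series variable.\<close>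

definition coord :: "nat \<Rightarrow> nat \<Rightarrow> int \<Rightarrow> bool \<Rightarrow> int" where
  "coord g j k e = (if e then 2 * int g * k + int j + 1 else - 2 * int g * k - int j)"

definition energy :: "nat \<Rightarrow> nat \<Rightarrow> int \<Rightarrow> int" where
  "energy g j k = 2 * int g * k\<^sup>2 + k * (2 * int j + 1)"

definition total_energy :: "nat \<Rightarrow> (nat \<Rightarrow> int) \<Rightarrow> int" where
  "total_energy g m = (\<Sum>j<g. energy g j (m j))"

definition restricted :: "nat \<Rightarrow> (nat \<Rightarrow> int) set" where
  "restricted g = {m. \<forall>i\<ge>g. m i = 0}"

text \<open>The exponent vector (1, ..., g) represents the orbits on which the coefficients can be
  nonzero, so these integers are the only unknowns left by the symmetries.\<close>

definition rho_coeff :: "nat \<Rightarrow> int \<Rightarrow> int" where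
  "rho_coeff g n = cf (macdonald g) (n, \<lambda>l. if l < g then int l + 1 else 0)"

lemma energy_step: "energy g j (k + 1) = energy g j k + 2 * (2 * int g * k + int j + 1) + 2 * int g - 1"
  by (simp add: energy_def power2_eq_square algebra_simps)

text \<open>Translations lead from j + 1 to the first branch for every k, by induction in both
  directions from k = 0; the reflection then reaches the second branch at no cost in energy.\<close>

lemma macdonald_coord:
  assumes "l < g"
  shows "cf (macdonald g) (n + energy g j k, v(l := coord g j k e)) = cf (macdonald g) (n, v(l := int j + 1))"
proof -
  have step: "cf (macdonald g) (n + energy g j (k + 1), v(l := coord g j (k + 1) True)) =
      cf (macdonald g) (n + energy g j k, v(l := coord g j k True))" for k
  proof -
    have "v(l := coord g j k True) + unit_vec l (2 * int g) = v(l := coord g j (k + 1) True)"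
      by (auto simp: fun_eq_iff unit_vec_def coord_def algebra_simps)
    moreover have "n + energy g j (k + 1) = n + energy g j k + 2 * (v(l := coord g j k True)) l + 2 * int g - 1"
      by (simp add: energy_step coord_def)
    ultimately show ?thesis
      using macdonald_shift[OF assms, of "n + energy g j k" "v(l := coord g j k True)"] by (simp only:)
  qed
  have "cf (macdonald g) (n + energy g j k, v(l := coord g j k True)) = cf (macdonald g) (n, v(l := int j + 1))"
  proof (induction k rule: int_induct[where k = 0])
    case base
    then show ?case by (simp add: energy_def coord_def)
  next
    case (step1 i)
    then show ?case by (simp only: step)
  next
    case (step2 i)
    then show ?case using step[of "i - 1", unfolded diff_add_cancel] by (simp only:)
  qed
  moreover have "cf (macdonald g) (n + energy g j k, v(l := coord g j k False)) =
     cf (macdonald g) (n + energy g j k, v(l := coord g j k True))"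
  proof -
    have "1 - coord g j k True = coord g j k False" by (simp add: coord_def)
    then show ?thesis
      using macdonald_reflect[OF assms, of "n + energy g j k" "v(l := coord g j k True)"] by simp
  qed
  ultimately show ?thesis by (cases e) simp_all
qed

text \<open>The coordinates are moved one at a time by induction on \<open>h\<close>; those from
  \<open>h\<close> on are still at their representatives.\<close>

lemma macdonald_coords:
  assumes "h \<le> g"
  shows "cf (macdonald g) (n + (\<Sum>l<h. energy g (j l) (k l)),
      \<lambda>l. if l < h then coord g (j l) (k l) (e l) else if l < g then int (j l) + 1 else 0) =
    cf (macdonald g) (n, \<lambda>l. if l < g then int (j l) + 1 else 0)"
  using assms
proof (induction h)
  case 0
  then show ?case by simp
next
  case (Suc h)
  let ?v = "\<lambda>l. if l < h then coord g (j l) (k l) (e l) else if l < g then int (j l) + 1 else 0"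
  have 1: "(\<lambda>l. if l < Suc h then coord g (j l) (k l) (e l) else if l < g then int (j l) + 1 else 0) =
      ?v(h := coord g (j h) (k h) (e h))" by (auto simp: fun_eq_iff)
  have 2: "?v(h := int (j h) + 1) = ?v" using Suc.prems by (auto simp: fun_eq_iff)
  show ?case
    unfolding 1 using macdonald_coord[of h g "n + (\<Sum>l<h. energy g (j l) (k l))" "j h" "k h" ?v "e h"]
      Suc 2 by (simp add: add.assoc)
qed

lemma macdonald_swap':
  assumes "a < g" "b < g" "a \<noteq> b"
  shows "cf (macdonald g) (n, v \<circ> transpose a b) = - cf (macdonald g) (n, v)"
  using macdonald_swap[of a b g] macdonald_swap[of b a g] assms
  by (cases "a < b") (simp_all add: transpose_commute)

lemma macdonald_permute:
  assumes "p permutes {..<g}"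
  shows "cf (macdonald g) (n, \<lambda>l. if l < g then int (p l) + 1 else 0) = sign p * rho_coeff g n"
  using finite_lessThan assms
proof (induction rule: permutes_rev_induct)
  case id
  have "(\<lambda>l. if l < g then int (id l) + 1 else 0) = (\<lambda>l. if l < g then int l + 1 else 0)"
    by (simp add: fun_eq_iff)
  then show ?case unfolding rho_coeff_def sign_id by (simp only: mult_1)
next
  case (swap a b p)
  have tr: "transpose a b x < g \<longleftrightarrow> x < g" for x using swap by (auto simp: transpose_def)
  have "(\<lambda>l. if l < g then int ((p \<circ> transpose a b) l) + 1 else 0) = (\<lambda>l. if l < g then int (p l) + 1 else 0) \<circ> transpose a b"
    by (simp add: fun_eq_iff tr)
  moreover have "sign (p \<circ> transpose a b) = - sign p"
    using swap by (subst sign_compose) (auto simp: sign_swap_id permutation_swap_id intro: permutes_imp_permutation)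
  moreover have "cf (macdonald g) (n, (\<lambda>l. if l < g then int (p l) + 1 else 0) \<circ> transpose a b) = - (sign p * rho_coeff g n)"
  proof -
    have "cf (macdonald g) (n, (\<lambda>l. if l < g then int (p l) + 1 else 0) \<circ> transpose a b) =
        - cf (macdonald g) (n, \<lambda>l. if l < g then int (p l) + 1 else 0)"
      by (rule macdonald_swap') (use swap in auto)
    then show ?thesis by (simp only: swap.IH)
  qed
  ultimately show ?case by (simp only: mult_minus_left)
qed

text \<open>A vector fixed by a transposition has a coefficient equal to its own negative.\<close>

lemma macdonald_repeated:
  assumes "a < g" "b < g" "a \<noteq> b" "j a = j b"
  shows "cf (macdonald g) (n, \<lambda>l. if l < g then int (j l) + 1 else 0) = 0"
proof -
  have "(\<lambda>l. if l < g then int (j l) + 1 else 0) \<circ> transpose a b = (\<lambda>l. if l < g then int (j l) + 1 else 0)"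
    using assms by (auto simp: fun_eq_iff transpose_def)
  then show ?thesis using macdonald_swap'[OF assms(1-3), of n "\<lambda>l. if l < g then int (j l) + 1 else 0"] by simp
qed

text \<open>The classes of j + 1 and - j with j < g exhaust the residues modulo 2g: either z - 1 or
  - z has its residue in the lower half.\<close>

lemma coord_exists:
  assumes "0 < g"
  shows "\<exists>j k e. j < g \<and> z = coord g j k e"
proof (cases "(z - 1) mod (2 * int g) < int g")
  case True
  define j where "j = nat ((z - 1) mod (2 * int g))"
  have "z = coord g j ((z - 1) div (2 * int g)) True"
    using assms div_mult_mod_eq[of "z - 1" "2 * int g"] by (simp add: coord_def j_def mult.commute)
  moreover have "j < g" using True assms by (simp add: j_def nat_less_iff)
  ultimately show ?thesis by blast
next
  case False
  define j where "j = nat ((- z) mod (2 * int g))"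
  have "(- z) mod (2 * int g) = 2 * int g - 1 - (z - 1) mod (2 * int g)"
  proof (rule int_mod_pos_eq)
    show "- z = 2 * int g * (- ((z - 1) div (2 * int g)) - 1) + (2 * int g - 1 - (z - 1) mod (2 * int g))"
      using div_mult_mod_eq[of "z - 1" "2 * int g"] by (simp add: algebra_simps)
  qed (use assms pos_mod_bound[of "2 * int g" "z - 1"] pos_mod_sign[of "2 * int g" "z - 1"] in linarith)+
  then have "j < g" using False assms by (simp add: j_def nat_less_iff)
  moreover have "z = coord g j ((- z) div (2 * int g)) False"
  proof -
    have "- z = 2 * int g * ((- z) div (2 * int g)) + (- z) mod (2 * int g)" by (rule mult_div_mod_eq[symmetric])
    moreover have "int j = (- z) mod (2 * int g)" using assms by (simp add: j_def)
    ultimately show ?thesis unfolding coord_def by (simp only: if_False)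
  qed
  ultimately show ?thesis by blast
qed

lemma coord_inject:
  assumes "j < g" "j' < g" "coord g j k e = coord g j' k' e'"
  shows "j = j' \<and> k = k' \<and> e = e'"
proof -
  have uniq: "a = a' \<and> b = b'" if "2 * int g * b + a = 2 * int g * b' + a'" "0 \<le> a" "a < 2 * int g" "0 \<le> a'" "a' < 2 * int g" for a b a' b'
  proof -
    have "(2 * int g * b + a) mod (2 * int g) = a" using that(2,3) by simp
    moreover have "(2 * int g * b' + a') mod (2 * int g) = a'" using that(4,5) by simp
    ultimately have "a = a'" using that(1) by metis
    then show ?thesis using that by simp
  qed
  consider "e" "e'" | "\<not> e" "\<not> e'" | "e" "\<not> e'" | "\<not> e" "e'" by blast
  then show ?thesis
  proof cases
    case 1
    then show ?thesis using uniq[of k "int j" k' "int j'"] assms by (auto simp: coord_def)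
  next
    case 2
    then show ?thesis using uniq[of k "int j" k' "int j'"] assms by (auto simp: coord_def)
  next
    \<comment> \<open>Equality across the two branches would make j + j' + 1 a multiple of 2g,
      although it lies strictly between 0 and 2g.\<close>
    case 3
    then show ?thesis using uniq[of "k + k'" "int j + int j' + 1" 0 0] assms by (auto simp: coord_def algebra_simps)
  next
    case 4
    then show ?thesis using uniq[of "k + k'" "int j + int j' + 1" 0 0] assms by (auto simp: coord_def algebra_simps)
  qed
qed

text \<open>Since j < g, the quadratic term 2g k^2 outweighs the linear one by at least
  \<bar>k\<bar>. This makes the lattice vectors of bounded energy finite in number and 0 the only
  one of energy at most 0.\<close>

lemma energy_ge: assumes "j < g" shows "energy g j k \<ge> \<bar>k\<bar>"
proof -
  have "\<bar>k\<bar> * (2 * int g * \<bar>k\<bar> - 2 * int j - 1) \<ge> \<bar>k\<bar> * 1" if "k \<noteq> 0"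
  proof (rule mult_left_mono)
    have "2 * int g * \<bar>k\<bar> \<ge> 2 * int g * 1" using that by (intro mult_left_mono) auto
    then show "1 \<le> 2 * int g * \<bar>k\<bar> - 2 * int j - 1" using assms by linarith
  qed simp
  moreover have "energy g j k \<ge> \<bar>k\<bar> * (2 * int g * \<bar>k\<bar> - 2 * int j - 1)"
  proof -
    have "k * (2 * int j + 1) \<ge> - (\<bar>k\<bar> * (2 * int j + 1))"
      by (metis abs_ge_minus_self abs_mult abs_of_nonneg minus_le_iff of_nat_0_le_iff zero_le_mult_iff zero_le_numeral add_nonneg_nonneg zero_le_one)
    then show ?thesis by (simp add: energy_def power2_eq_square algebra_simps)
  qed
  ultimately show ?thesis by (cases "k = 0") (simp add: energy_def, linarith)
qed

lemma energy_nonneg: "j < g \<Longrightarrow> 0 \<le> energy g j k"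
  using energy_ge[of j g k] by linarith

lemma total_energy_nonneg: "0 \<le> total_energy g m"
  unfolding total_energy_def using energy_nonneg by (intro sum_nonneg) auto

lemma total_energy_ge: "i < g \<Longrightarrow> \<bar>m i\<bar> \<le> total_energy g m"
proof -
  assume i: "i < g"
  have "\<bar>m i\<bar> \<le> energy g i (m i)" using energy_ge[OF i] .
  also have "\<dots> \<le> total_energy g m"
    unfolding total_energy_def using energy_nonneg i by (intro member_le_sum) auto
  finally show ?thesis .
qed

lemma finite_total_energy_le: "finite {m \<in> restricted g. total_energy g m \<le> n}"
proof (rule finite_subset)
  show "{m \<in> restricted g. total_energy g m \<le> n} \<subseteq>
     {m. \<forall>i. (i \<in> {..<g} \<longrightarrow> m i \<in> {-n..n}) \<and> (i \<notin> {..<g} \<longrightarrow> m i = 0)}"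
  proof
    fix m assume m: "m \<in> {m \<in> restricted g. total_energy g m \<le> n}"
    have "m i \<in> {-n..n}" if "i < g" for i using total_energy_ge[OF that, of m] m by auto
    then show "m \<in> {m. \<forall>i. (i \<in> {..<g} \<longrightarrow> m i \<in> {-n..n}) \<and> (i \<notin> {..<g} \<longrightarrow> m i = 0)}"
      using m by (auto simp: restricted_def)
  qed
qed (intro finite_set_of_finite_funs, auto)

lemma total_energy_zero_iff:
  assumes "m \<in> restricted g"
  shows "total_energy g m \<le> 0 \<longleftrightarrow> m = 0"
proof
  assume "total_energy g m \<le> 0"
  then have "m i = 0" for i using total_energy_ge[of i g m] assms by (cases "i < g") (auto simp: restricted_def)
  then show "m = 0" by (simp add: fun_eq_iff)
qed (simp add: total_energy_def energy_def)

definition eval_at :: "nat \<Rightarrow> (nat \<Rightarrow> 'a::field) \<Rightarrow> ((nat \<Rightarrow> int) \<Rightarrow>\<^sub>0 int) \<Rightarrow> 'a" where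
  "eval_at g x f = (\<Sum>v\<in>keys f. of_int (lookup f v) * (\<Prod>i<g. x i powi v i))"

text \<open>The determinant of the entries x_l^c + x_l^(1 - c), written out: the two values of
  \<open>coord\<close> for the same j and k add up to 1.\<close>

definition orbit_sum :: "nat \<Rightarrow> (nat \<Rightarrow> 'a::field) \<Rightarrow> (nat \<Rightarrow> int) \<Rightarrow> 'a" where
  "orbit_sum g x m = (\<Sum>p | p permutes {..<g}. of_int (sign p) *
     (\<Prod>l<g. x l powi coord g (p l) (m (p l)) True + x l powi coord g (p l) (m (p l)) False))"

text \<open>An exponent vector with nonzero coefficient is encoded in exactly one way by a lattice
  vector \<open>m\<close>, a permutation \<open>p\<close> and a choice \<open>e\<close> of branches;
  its coefficient is sign p times \<open>rho_coeff\<close> at the remaining energy. Summing over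
  \<open>e\<close> first produces the factors of \<open>orbit_sum\<close>.\<close>

lemma macdonald_expansion:
  assumes "0 < g"
  shows "eval_at g x (fps_nth (macdonald g) n) =
    (\<Sum>m | m \<in> restricted g \<and> total_energy g m \<le> int n. of_int (rho_coeff g (int n - total_energy g m)) * orbit_sum g x m)"
proof -
  let ?W = "fps_nth (macdonald g) n"
  define M where "M = {m \<in> restricted g. total_energy g m \<le> int n}"
  define E where "E = (PiE {..<g} (\<lambda>_. UNIV :: bool set))"
  define S where "S = {p. p permutes {..<g}}"
  define T where "T = M \<times> S \<times> E"
  define \<Phi> where "\<Phi> = (\<lambda>(m, p, e) l. if l < g then coord g (p l) (m (p l)) (e l) else 0)"
  have fin: "finite M" "finite S" "finite E" "finite T"
    unfolding M_def E_def S_def T_def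
    by (auto simp: finite_total_energy_le finite_permutations intro!: finite_PiE finite_cartesian_product)
  have "inj_on \<Phi> T"
  proof (rule inj_onI)
    fix z z' assume zT: "z \<in> T" "z' \<in> T" "\<Phi> z = \<Phi> z'"
    obtain m p e m' p' e' where z: "z = (m, p, e)" "z' = (m', p', e')" by (metis prod_cases3)
    have T: "(m, p, e) \<in> T" "(m', p', e') \<in> T" and eq: "\<Phi> (m, p, e) = \<Phi> (m', p', e')"
      using zT by (auto simp: z)
    have pp: "p permutes {..<g}" "p' permutes {..<g}" using T by (auto simp: T_def S_def)
    have c: "p l = p' l \<and> m (p l) = m' (p' l) \<and> e l = e' l" if "l < g" for l
    proof (rule coord_inject)
      show "p l < g" "p' l < g" using pp that by (meson lessThan_iff permutes_in_image)+
      show "coord g (p l) (m (p l)) (e l) = coord g (p' l) (m' (p' l)) (e' l)"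
        using fun_cong[OF eq, of l] that by (simp add: \<Phi>_def)
    qed
    have "p = p'" using c pp by (metis ext lessThan_iff permutes_not_in)
    moreover have "e = e'" using c T by (auto simp: T_def E_def intro!: PiE_ext[of e "{..<g}" _ e'])
    moreover have "m i = m' i" for i
    proof (cases "i < g")
      case True
      then obtain l where "l < g" "i = p l" using pp(1) by (metis lessThan_iff permutes_def permutes_in_image)
      then show ?thesis using c[of l] \<open>p = p'\<close> by simp
    next
      case False
      then show ?thesis using T by (auto simp: T_def M_def restricted_def)
    qed
    ultimately show "z = z'" by (auto simp: z)
  qed
  have val: "lookup ?W (\<Phi> (m, p, e)) = sign p * rho_coeff g (int n - total_energy g m)" if "p \<in> S" for m p e
  proof -
    have p: "p permutes {..<g}" using that by (simp add: S_def)
    have "total_energy g m = (\<Sum>l<g. energy g (p l) (m (p l)))"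
      unfolding total_energy_def by (rule sum.permute[OF p, unfolded comp_def])
    moreover have "(\<lambda>l. if l < g then coord g (p l) (m (p l)) (e l) else if l < g then int (p l) + 1 else 0) = \<Phi> (m, p, e)"
      by (auto simp: \<Phi>_def)
    ultimately have "cf (macdonald g) (int n, \<Phi> (m, p, e)) =
       cf (macdonald g) (int n - total_energy g m, \<lambda>l. if l < g then int (p l) + 1 else 0)"
      using macdonald_coords[of g g "int n - total_energy g m" p "\<lambda>l. m (p l)" e] by simp
    moreover have "cf (macdonald g) (int n, \<Phi> (m, p, e)) = lookup ?W (\<Phi> (m, p, e))" by (simp add: cf_def)
    ultimately show ?thesis using macdonald_permute[OF p] by simp
  qed
  have keys: "keys ?W \<subseteq> \<Phi> ` T"
  proof
    fix v assume "v \<in> keys ?W"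
    then have nz: "cf (macdonald g) (int n, v) \<noteq> 0" by (simp add: cf_def in_keys_iff)
    have "\<forall>l. \<exists>j k e. j < g \<and> v l = coord g j k e" using coord_exists[OF assms] by blast
    then obtain j k e where jke: "\<And>l. j l < g" "\<And>l. v l = coord g (j l) (k l) (e l)" by metis
    have v: "v = (\<lambda>l. if l < g then coord g (j l) (k l) (e l) else if l < g then int (j l) + 1 else 0)"
    proof
      fix l show "v l = (if l < g then coord g (j l) (k l) (e l) else if l < g then int (j l) + 1 else 0)"
        using macdonald_zero_outside[OF nz, of l] jke(2)[of l] by (cases "l < g") auto
    qed
    have nz': "cf (macdonald g) (int n - (\<Sum>l<g. energy g (j l) (k l)), \<lambda>l. if l < g then int (j l) + 1 else 0) \<noteq> 0"
      using nz macdonald_coords[of g g "int n - (\<Sum>l<g. energy g (j l) (k l))" j k e] v by simp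
    \<comment> \<open>Two equal representatives would make the coefficient vanish by antisymmetry;
      hence the \<open>j l\<close> form a permutation.\<close>
    have inj: "inj_on j {..<g}"
      using nz' macdonald_repeated[of _ g _ j] by (intro inj_onI) (metis lessThan_iff)
    define p where "p = (\<lambda>l. if l < g then j l else l)"
    have "bij_betw j {..<g} {..<g}"
      using inj jke(1) by (intro bij_betw_imageI endo_inj_surj) auto
    then have p: "p permutes {..<g}"
      using bij_betw_cong[of "{..<g}" p j "{..<g}"] by (intro bij_imp_permutes) (simp_all add: p_def)
    define m where "m = (\<lambda>i. if i < g then k (inv p i) else 0)"
    have pl: "p l = j l" "m (j l) = k l" if "l < g" for l
    proof -
      show "p l = j l" using that by (simp add: p_def)
      then show "m (j l) = k l" using jke(1)[of l] permutes_inverses(2)[OF p, of l] by (simp add: m_def)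
    qed
    have "total_energy g m = (\<Sum>l<g. energy g (p l) (m (p l)))"
      unfolding total_energy_def by (rule sum.permute[OF p, unfolded comp_def])
    also have "\<dots> = (\<Sum>l<g. energy g (j l) (k l))" by (simp add: pl)
    \<comment> \<open>\<open>cf\<close> is 0 at negative series exponents, so nonvanishing bounds
      the energy by n.\<close>
    finally have "total_energy g m \<le> int n" using nz' by (auto simp: cf_def split: if_splits)
    then have "m \<in> M" by (simp add: M_def restricted_def m_def)
    moreover have "restrict e {..<g} \<in> E" by (auto simp: E_def)
    moreover have "v = \<Phi> (m, p, restrict e {..<g})"
      by (subst v) (auto simp: \<Phi>_def pl fun_eq_iff)
    ultimately show "v \<in> \<Phi> ` T" using p by (auto simp: T_def S_def)
  qed
  have "eval_at g x ?W = (\<Sum>v\<in>\<Phi> ` T. of_int (lookup ?W v) * (\<Prod>i<g. x i powi v i))"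
    unfolding eval_at_def using keys fin(4)
    by (intro sum.mono_neutral_left) (auto simp: in_keys_iff)
  also have "\<dots> = (\<Sum>z\<in>T. of_int (lookup ?W (\<Phi> z)) * (\<Prod>i<g. x i powi \<Phi> z i))"
    by (rule sum.reindex[OF \<open>inj_on \<Phi> T\<close>, unfolded comp_def])
  also have "\<dots> = (\<Sum>m\<in>M. \<Sum>p\<in>S. \<Sum>e\<in>E. of_int (lookup ?W (\<Phi> (m, p, e))) * (\<Prod>i<g. x i powi \<Phi> (m, p, e) i))"
    unfolding T_def sum.cartesian_product by (simp add: case_prod_beta)
  also have "\<dots> = (\<Sum>m\<in>M. \<Sum>p\<in>S. of_int (sign p * rho_coeff g (int n - total_energy g m)) *
      (\<Sum>e\<in>E. \<Prod>l<g. x l powi coord g (p l) (m (p l)) (e l)))"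
  proof (intro sum.cong refl)
    fix m p assume p: "p \<in> S"
    have "(\<Prod>i<g. x i powi \<Phi> (m, p, e) i) = (\<Prod>l<g. x l powi coord g (p l) (m (p l)) (e l))" for e
      by (rule prod.cong) (auto simp: \<Phi>_def)
    then show "(\<Sum>e\<in>E. of_int (lookup ?W (\<Phi> (m, p, e))) * (\<Prod>i<g. x i powi \<Phi> (m, p, e) i)) =
      of_int (sign p * rho_coeff g (int n - total_energy g m)) * (\<Sum>e\<in>E. \<Prod>l<g. x l powi coord g (p l) (m (p l)) (e l))"
      unfolding val[OF p] sum_distrib_left by (simp only:)
  qed
  also have "\<dots> = (\<Sum>m\<in>M. \<Sum>p\<in>S. of_int (sign p * rho_coeff g (int n - total_energy g m)) *
      (\<Prod>l<g. x l powi coord g (p l) (m (p l)) True + x l powi coord g (p l) (m (p l)) False))"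
  proof -
    have "(\<Sum>e\<in>E. \<Prod>l<g. x l powi coord g (p l) (m (p l)) (e l)) =
        (\<Prod>l<g. x l powi coord g (p l) (m (p l)) True + x l powi coord g (p l) (m (p l)) False)" for m p
      unfolding E_def
      by (subst prod_sum_PiE[of "{..<g}" "\<lambda>_. UNIV :: bool set" "\<lambda>l e. x l powi coord g (p l) (m (p l)) e", symmetric])
         (simp_all add: UNIV_bool add.commute)
    then show ?thesis by (simp only:)
  qed
  also have "\<dots> = (\<Sum>m\<in>M. of_int (rho_coeff g (int n - total_energy g m)) * orbit_sum g x m)"
    by (simp add: orbit_sum_def S_def sum_distrib_left mult_ac)
  finally show ?thesis by (simp add: M_def)
qed

section \<open>Infinite products and the Jacobi triple product\<close>

definition agree :: "nat \<Rightarrow> 'a::zero fps \<Rightarrow> 'a fps \<Rightarrow> bool" where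
  "agree N f g \<longleftrightarrow> (\<forall>n\<le>N. fps_nth f n = fps_nth g n)"

lemma agree_refl [simp]: "agree N f f" by (simp add: agree_def)
lemma agree_sym: "agree N f g \<Longrightarrow> agree N g f" by (simp add: agree_def)
lemma agree_trans [trans]: "agree N f g \<Longrightarrow> agree N g h \<Longrightarrow> agree N f h" by (simp add: agree_def)
lemma agree_mono: "agree N f g \<Longrightarrow> M \<le> N \<Longrightarrow> agree M f g" by (simp add: agree_def)

lemma agree_mult: "agree N f g \<Longrightarrow> agree N f' g' \<Longrightarrow> agree N (f * f') (g * g' :: 'a::comm_ring_1 fps)"
  by (auto simp: agree_def fps_mult_nth intro!: sum.cong)

lemma agree_sum: "(\<And>i. i \<in> I \<Longrightarrow> agree N (f i) (g i)) \<Longrightarrow> agree N (\<Sum>i\<in>I. f i) (\<Sum>i\<in>I. g i :: 'a::comm_ring_1 fps)"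
  by (simp add: agree_def fps_sum_nth)

lemma agree_prod: "(\<And>i. i \<in> I \<Longrightarrow> agree N (f i) (g i)) \<Longrightarrow> agree N (\<Prod>i\<in>I. f i) (\<Prod>i\<in>I. g i :: 'a::comm_ring_1 fps)"
  by (induction I rule: infinite_finite_induct) (auto intro: agree_mult)

lemma agree_prod_one: "(\<And>i. i \<in> I \<Longrightarrow> agree N (f i) 1) \<Longrightarrow> agree N (\<Prod>i\<in>I. f i :: 'a::comm_ring_1 fps) 1"
  using agree_prod[of I N f "\<lambda>_. 1"] by simp

lemma agree_prod_subset:
  assumes "finite J" "I \<subseteq> J" "\<And>i. i \<in> J - I \<Longrightarrow> agree N (f i) 1"
  shows "agree N (\<Prod>i\<in>J. f i) (\<Prod>i\<in>I. f i :: 'a::comm_ring_1 fps)"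
proof -
  have "(\<Prod>i\<in>J. f i) = (\<Prod>i\<in>J - I. f i) * (\<Prod>i\<in>I. f i)"
    using assms by (intro prod.subset_diff) auto
  then show ?thesis
    using agree_mult[OF agree_prod_one[of "J - I" N f] agree_refl[of N "\<Prod>i\<in>I. f i"]] assms(3) by simp
qed

definition near_one :: "(nat \<Rightarrow> 'a::comm_ring_1 fps) \<Rightarrow> bool" where
  "near_one f \<longleftrightarrow> (\<forall>m\<ge>1. agree (m - 1) (f m) 1)"

text \<open>Coefficient n is read off from the first n factors, which gives the infinite product
  when factor m agrees with 1 below order m, as \<open>near_one\<close> demands.\<close>

definition tprod :: "(nat \<Rightarrow> 'a::comm_ring_1 fps) \<Rightarrow> 'a fps" where
  "tprod f = Abs_fps (\<lambda>n. fps_nth (\<Prod>m=1..n. f m) n)"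

lemma agree_tprod:
  assumes "near_one f" "N \<le> M"
  shows "agree N (tprod f) (\<Prod>m=1..M. f m)"
proof -
  have "agree n (\<Prod>m=1..M. f m) (\<Prod>m=1..n. f m)" if "n \<le> M" for n
  proof (rule agree_prod_subset)
    fix i assume i: "i \<in> {1..M} - {1..n}"
    then have "agree (i - 1) (f i) 1" using assms(1) by (simp add: near_one_def)
    then show "agree n (f i) 1" by (rule agree_mono) (use i in auto)
  qed (use that in auto)
  then have "fps_nth (\<Prod>m=1..M. f m) n = fps_nth (\<Prod>m=1..n. f m) n" if "n \<le> M" for n
    using that unfolding agree_def by blast
  then show ?thesis using assms(2) by (simp add: agree_def tprod_def)
qed

lemma agree_eqI: "(\<And>N. agree N f g) \<Longrightarrow> f = g"
  by (auto simp: fps_eq_iff agree_def)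

lemma near_one_mult: "near_one f \<Longrightarrow> near_one g \<Longrightarrow> near_one (\<lambda>m. f m * g m)"
  using agree_mult[of _ _ 1 _ 1] by (fastforce simp: near_one_def)

lemma near_one_prod: "(\<And>i. i \<in> I \<Longrightarrow> near_one (f i)) \<Longrightarrow> near_one (\<lambda>m. \<Prod>i\<in>I. f i m)"
  by (auto simp: near_one_def intro!: agree_prod_one)

lemma near_one_power: "near_one f \<Longrightarrow> near_one (\<lambda>m. f m ^ k)"
  using near_one_prod[of "{..<k}" "\<lambda>_. f"] by simp

text \<open>It is enough to compare along a cofinal sequence of partial products; Euler's theorem
  below uses this with an even number of factors.\<close>

lemma tprod_unique:
  assumes "near_one f" "\<And>N. \<exists>M\<ge>N. agree N g (\<Prod>m=1..M. f m)"
  shows "tprod f = g"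
proof (rule agree_eqI)
  fix N
  obtain M where "M \<ge> N" "agree N g (\<Prod>m=1..M. f m)" using assms(2) by blast
  then show "agree N (tprod f) g" using agree_tprod[OF assms(1)] agree_sym agree_trans by blast
qed

lemma tprod_mult:
  assumes "near_one f" "near_one g"
  shows "tprod (\<lambda>m. f m * g m) = tprod f * tprod g"
proof (rule tprod_unique)
  fix N
  show "\<exists>M\<ge>N. agree N (tprod f * tprod g) (\<Prod>m=1..M. f m * g m)"
    using agree_mult[OF agree_tprod[OF assms(1), of N N] agree_tprod[OF assms(2), of N N]]
    by (intro exI[of _ N]) (simp add: prod.distrib)
qed (intro near_one_mult assms)

lemma tprod_one: "tprod (\<lambda>m. 1) = 1"
  by (rule tprod_unique) (auto simp: near_one_def)

lemma tprod_prod: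
  assumes "finite I" "\<And>i. i \<in> I \<Longrightarrow> near_one (f i)"
  shows "tprod (\<lambda>m. \<Prod>i\<in>I. f i m) = (\<Prod>i\<in>I. tprod (f i))"
  using assms by (induction I rule: finite_induct) (simp_all add: tprod_one tprod_mult near_one_prod)

lemma tprod_nth_0 [simp]: "fps_nth (tprod f) 0 = 1"
  by (simp add: tprod_def)

lemma near_one_linear:
  assumes "1 \<le> e"
  shows "near_one (\<lambda>m. 1 + fps_const c * fps_X ^ (e * m))"
  unfolding near_one_def agree_def
proof (intro allI impI)
  fix m n :: nat assume "1 \<le> m" "n \<le> m - 1"
  moreover have "m \<le> e * m" using assms by simp
  ultimately have "n < e * m" by linarith
  then show "fps_nth (1 + fps_const c * fps_X ^ (e * m)) n = fps_nth 1 n"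
    by (simp add: fps_X_power_nth)
qed

lemma near_one_linear_minus:
  assumes "1 \<le> e"
  shows "near_one (\<lambda>m. 1 - fps_const c * fps_X ^ (e * m))"
  using near_one_linear[OF assms, of "- c"] by (simp flip: fps_const_neg)

lemma near_one_minus: "1 \<le> e \<Longrightarrow> near_one (\<lambda>m. 1 - fps_X ^ (e * m) :: 'a::comm_ring_1 fps)"
  using near_one_linear_minus[of e 1] by simp

section \<open>Gaussian binomials and the finite form of the triple product\<close>

fun gauss_binomial :: "'a::comm_ring_1 \<Rightarrow> nat \<Rightarrow> nat \<Rightarrow> 'a" where
  "gauss_binomial p n 0 = 1"
| "gauss_binomial p 0 (Suc j) = 0"
| "gauss_binomial p (Suc n) (Suc j) = gauss_binomial p n j + p ^ Suc j * gauss_binomial p n (Suc j)"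

lemma gauss_binomial_gt: "n < j \<Longrightarrow> gauss_binomial p n j = 0"
  by (induction p n j rule: gauss_binomial.induct) auto

lemma gauss_binomial_self: "gauss_binomial p n n = 1"
  by (induction n) (auto simp: gauss_binomial_gt)

definition q_fact :: "'a::comm_ring_1 \<Rightarrow> nat \<Rightarrow> 'a" where
  "q_fact p n = (\<Prod>i=1..n. 1 - p ^ i)"

lemma q_fact_Suc: "q_fact p (Suc n) = q_fact p n * (1 - p ^ Suc n)"
  by (simp add: q_fact_def)

lemma gauss_binomial_q_fact:
  "j \<le> n \<Longrightarrow> gauss_binomial p n j * q_fact p j * q_fact p (n - j) = q_fact p n"
proof (induction p n j rule: gauss_binomial.induct)
  case (3 p n j)
  show ?case
  proof (cases "j = n")
    case True
    then show ?thesis by (simp add: gauss_binomial_gt gauss_binomial_self q_fact_def)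
  next
    case False
    then have j: "Suc j \<le> n" "j \<le> n" "n - j = Suc (n - Suc j)" using 3 by auto
    define a where "a = gauss_binomial p n j"
    define b where "b = gauss_binomial p n (Suc j)"
    have 1: "a * q_fact p j * q_fact p (n - j) = q_fact p n"
      unfolding a_def using 3 j by blast
    have 2: "b * (q_fact p j * (1 - p ^ Suc j)) * q_fact p (n - Suc j) = q_fact p n"
      unfolding b_def q_fact_Suc[symmetric] using 3 j by blast
    have e: "q_fact p (n - j) = q_fact p (n - Suc j) * (1 - p ^ (n - j))"
      using q_fact_Suc[of p "n - Suc j"] j(3) by simp
    have pw: "p ^ Suc j * p ^ (n - j) = p ^ Suc n"
      using \<open>j \<le> n\<close> by (simp only: power_add[symmetric]) simp
    have "gauss_binomial p (Suc n) (Suc j) * q_fact p (Suc j) * q_fact p (Suc n - Suc j) =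
      (a + p ^ Suc j * b) * (q_fact p j * (1 - p ^ Suc j)) * q_fact p (n - j)"
      by (simp only: a_def b_def gauss_binomial.simps q_fact_Suc diff_Suc_Suc)
    also have "\<dots> = (a * q_fact p j * q_fact p (n - j)) * (1 - p ^ Suc j) +
       p ^ Suc j * (b * (q_fact p j * (1 - p ^ Suc j)) * q_fact p (n - Suc j)) * (1 - p ^ (n - j))"
      unfolding e by (simp only: algebra_simps)
    also have "\<dots> = q_fact p n * (1 - p ^ Suc j * p ^ (n - j))"
      unfolding 1 2 by (simp only: algebra_simps mult_1_left)
    finally show ?thesis unfolding pw q_fact_Suc .
  qed
qed (auto simp: q_fact_def)

text \<open>Splitting off the factor with i = 0 replaces z by z p in the rest, and the two sums that
  arise combine by the recursion of \<open>gauss_binomial\<close>.\<close>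

lemma gauss_binomial_theorem:
  "(\<Prod>i<n. 1 + z * p ^ i) = (\<Sum>j\<le>n. p ^ (j * (j - 1) div 2) * gauss_binomial p n j * z ^ j)"
proof (induction n arbitrary: z)
  case 0
  then show ?case by simp
next
  case (Suc n)
  have tri: "Suc j * (Suc j - 1) div 2 = j + j * (j - 1) div 2" for j :: nat
    by (cases j) (auto simp: algebra_simps)
  have "(\<Prod>i<Suc n. 1 + z * p ^ i) = (1 + z) * (\<Prod>i<n. 1 + (z * p) * p ^ i)"
    by (subst prod.lessThan_Suc_shift) (simp add: mult_ac)
  also have "\<dots> = (1 + z) * (\<Sum>j\<le>n. p ^ (j * (j - 1) div 2) * gauss_binomial p n j * (z * p) ^ j)"
    by (simp only: Suc.IH)
  also have "\<dots> = (\<Sum>j\<le>n. p ^ (j * (j - 1) div 2) * gauss_binomial p n j * (z * p) ^ j) +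
      (\<Sum>j\<le>n. p ^ (j * (j - 1) div 2) * gauss_binomial p n j * p ^ j * z ^ Suc j)"
    by (simp add: distrib_right sum_distrib_left sum.distrib power_mult_distrib mult_ac)
  also have "(\<Sum>j\<le>n. p ^ (j * (j - 1) div 2) * gauss_binomial p n j * (z * p) ^ j) =
      (\<Sum>j\<le>Suc n. p ^ (j * (j - 1) div 2) * gauss_binomial p n j * (z * p) ^ j)"
    by (simp add: gauss_binomial_gt)
  also have "\<dots> = 1 + (\<Sum>j\<le>n. p ^ (Suc j * (Suc j - 1) div 2) * gauss_binomial p n (Suc j) * (z * p) ^ Suc j)"
    by (subst sum.atMost_Suc_shift) simp
  also have "\<dots> + (\<Sum>j\<le>n. p ^ (j * (j - 1) div 2) * gauss_binomial p n j * p ^ j * z ^ Suc j) =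
     1 + (\<Sum>j\<le>n. p ^ (Suc j * (Suc j - 1) div 2) * gauss_binomial p (Suc n) (Suc j) * z ^ Suc j)"
    unfolding add.assoc sum.distrib[symmetric] tri
    by (simp add: power_add power_mult_distrib algebra_simps)
  also have "\<dots> = (\<Sum>j\<le>Suc n. p ^ (j * (j - 1) div 2) * gauss_binomial p (Suc n) j * z ^ j)"
    by (subst sum.atMost_Suc_shift) simp
  finally show ?case .
qed

definition triangle :: "int \<Rightarrow> nat" where "triangle k = nat (k * (k - 1) div 2)"

lemma even_triangle: "even (k * (k - 1))" for k :: int by simp

lemma triangle_nonneg: "0 \<le> k * (k - 1)" for k :: int
  by (cases "k \<ge> 1") (simp_all add: mult_nonneg_nonneg mult_nonpos_nonpos)

lemma triangle: "2 * int (triangle k) = k * (k - 1)"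
  unfolding triangle_def using even_triangle[of k] triangle_nonneg[of k] by (simp add: dvd_div_mult_self)

lemma triangle_ge: "\<bar>k\<bar> \<le> int (triangle k) + 1"
proof -
  have "(\<bar>k\<bar> - 1) * (\<bar>k\<bar> - 2) \<ge> 0"
    using triangle_nonneg[of "\<bar>k\<bar> - 1"] by (simp add: algebra_simps)
  moreover have "k * (k - 1) \<ge> \<bar>k\<bar> * (\<bar>k\<bar> - 1)" by (cases "k \<ge> 0") (auto simp: algebra_simps)
  ultimately show ?thesis using triangle[of k] by (simp add: algebra_simps)
qed

text \<open>For b = 0 this is the q-binomial theorem; each further factor in 1 / Y shifts k by one,
  and the sum with the shifted copy is again the Pascal recursion.\<close>

lemma jacobi_finite:
  fixes Y :: "'a::field" and p :: "'a fps"
  assumes "Y \<noteq> 0"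
  shows "(\<Prod>i<a. 1 + fps_const Y * p ^ i) * (\<Prod>i<b. 1 + fps_const (inverse Y) * p ^ Suc i) =
    (\<Sum>k=- int b..int a. p ^ triangle k * gauss_binomial p (a + b) (nat (int b + k)) * fps_const (Y powi k))"
proof (induction b)
  case 0
  have "(\<Sum>k=0..int a. p ^ triangle k * gauss_binomial p a (nat k) * fps_const (Y powi k)) =
      (\<Sum>j\<le>a. p ^ (j * (j - 1) div 2) * gauss_binomial p a j * fps_const Y ^ j)"
  proof (rule sum.reindex_bij_witness[of _ int nat], goal_cases)
    case (5 k)
    have "triangle (int j) = j * (j - 1) div 2" for j
    proof -
      have "int (2 * triangle (int j)) = int (j * (j - 1))"
        using triangle[of "int j"] by (cases j) (simp_all add: algebra_simps)
      then show ?thesis by linarith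
    qed
    from this[of "nat k"] show ?case using 5
      by (simp add: power_int_def fps_const_power)
  qed auto
  then show ?case by (simp add: gauss_binomial_theorem)
next
  case (Suc b)
  let ?G = "gauss_binomial p (a + b)"
  have "(\<Prod>i<a. 1 + fps_const Y * p ^ i) * (\<Prod>i<Suc b. 1 + fps_const (inverse Y) * p ^ Suc i) =
    (\<Sum>k=- int b..int a. p ^ triangle k * ?G (nat (int b + k)) * fps_const (Y powi k)) * (1 + fps_const (inverse Y) * p ^ Suc b)"
    unfolding Suc.IH[symmetric] by (simp add: mult_ac)
  also have "\<dots> = (\<Sum>k=- int b..int a. p ^ triangle k * ?G (nat (int b + k)) * fps_const (Y powi k)) +
     (\<Sum>k=- int b..int a. p ^ Suc b * p ^ triangle k * ?G (nat (int b + k)) * fps_const (Y powi (k - 1)))"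
  proof -
    have c: "fps_const (Y powi (k - 1)) = fps_const (Y powi k) * fps_const (inverse Y)" for k
      using assms by (simp add: power_int_diff divide_inverse)
    show ?thesis unfolding c distrib_left mult_1_right sum_distrib_right
      by (simp only: mult_ac)
  qed
  also have "(\<Sum>k=- int b..int a. p ^ Suc b * p ^ triangle k * ?G (nat (int b + k)) * fps_const (Y powi (k - 1))) =
     (\<Sum>k=- int (Suc b)..int a - 1. p ^ triangle k * p ^ nat (int b + k + 1) * ?G (nat (int b + k + 1)) * fps_const (Y powi k))"
  proof (rule sum.reindex_bij_witness[of _ "\<lambda>k. k + 1" "\<lambda>k. k - 1"], goal_cases)
    case (5 k)
    have "int (triangle (k - 1)) + int (nat (int b + (k - 1) + 1)) = int (Suc b) + int (triangle k)"
      using triangle[of "k - 1"] triangle[of k] 5 by (simp add: algebra_simps)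
    then have "triangle (k - 1) + nat (int b + (k - 1) + 1) = Suc b + triangle k" by linarith
    then have "p ^ triangle (k - 1) * p ^ nat (int b + (k - 1) + 1) = p ^ Suc b * p ^ triangle k"
      by (metis power_add)
    then show ?case by (simp only: diff_add_cancel) (simp add: add.commute add.left_commute)
  qed auto
  also have "\<dots> = (\<Sum>k=- int (Suc b)..int a. p ^ triangle k * p ^ nat (int b + k + 1) * ?G (nat (int b + k + 1)) * fps_const (Y powi k))"
    by (rule sum.mono_neutral_left) (auto simp: gauss_binomial_gt)
  \<comment> \<open>At the new lower end the truncation in \<open>nat (int b + k)\<close> yields 0,
    where the Gaussian binomial is 1; the term is therefore set to 0 explicitly.\<close>
  also have "(\<Sum>k=- int b..int a. p ^ triangle k * ?G (nat (int b + k)) * fps_const (Y powi k)) =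
      (\<Sum>k=- int (Suc b)..int a. if k = - int (Suc b) then 0 else p ^ triangle k * ?G (nat (int b + k)) * fps_const (Y powi k))"
    by (rule sum.mono_neutral_cong_left) auto
  also have "\<dots> + (\<Sum>k=- int (Suc b)..int a. p ^ triangle k * p ^ nat (int b + k + 1) * ?G (nat (int b + k + 1)) * fps_const (Y powi k)) =
     (\<Sum>k=- int (Suc b)..int a. p ^ triangle k * gauss_binomial p (a + Suc b) (nat (int (Suc b) + k)) * fps_const (Y powi k))"
    unfolding sum.distrib[symmetric]
  proof (rule sum.cong[OF refl], goal_cases)
    case (1 k)
    show ?case
    proof (cases "k = - int (Suc b)")
      case True
      then show ?thesis by simp
    next
      case False
      then have s: "nat (int (Suc b) + k) = Suc (nat (int b + k))" "nat (int b + k + 1) = Suc (nat (int b + k))"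
        using 1 by auto
      show ?thesis using False unfolding s by (simp add: algebra_simps)
    qed
  qed
  finally show ?case .
qed

text \<open>The theta series with terms Y^k X^(e k (k - 1) / 2).\<close>

definition theta :: "nat \<Rightarrow> 'a::field \<Rightarrow> 'a fps" where
  "theta e Y = Abs_fps (\<lambda>n. \<Sum>k | int e * (k * (k - 1)) = 2 * int n. Y powi k)"

lemma theta_index: "int e * (k * (k - 1)) = 2 * int n \<longleftrightarrow> e * triangle k = n"
proof -
  have "int e * (k * (k - 1)) = 2 * int (e * triangle k)" using triangle[of k] by simp
  then show ?thesis by linarith
qed

lemma agree_q_fact:
  assumes "1 \<le> e" "N \<le> M"
  shows "agree N (tprod (\<lambda>m. 1 - fps_X ^ (e * m))) (q_fact (fps_X ^ e :: 'a::field fps) M)"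
  using agree_tprod[OF near_one_minus[OF assms(1)] assms(2)] by (simp add: q_fact_def power_mult)

text \<open>The binomial is the quotient of q-factorials of n by those of j and n - j; all three
  indices are at least N, so each factorial agrees with the infinite product up to order N and one
  such factor remains in the denominator.\<close>

lemma agree_gauss_binomial:
  assumes e: "1 \<le> e" and jN: "N \<le> j" "N + j \<le> n"
  shows "agree N (tprod (\<lambda>m. 1 - fps_X ^ (e * m)) * gauss_binomial (fps_X ^ e :: 'a::field fps) n j) 1"
proof -
  let ?T = "tprod (\<lambda>m. 1 - fps_X ^ (e * m)) :: 'a fps"
  let ?B = "gauss_binomial (fps_X ^ e :: 'a fps) n j"
  let ?q = "q_fact (fps_X ^ e :: 'a fps)"
  have "agree N (?B * ?T * ?T) (?B * ?q j * ?q (n - j))"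
    by (intro agree_mult agree_refl agree_q_fact e) (use jN in auto)
  also have "?B * ?q j * ?q (n - j) = ?q n" using jN by (intro gauss_binomial_q_fact) auto
  also have "agree N (?q n) ?T" by (intro agree_sym[OF agree_q_fact] e) (use jN in auto)
  finally have "agree N (?B * ?T * ?T * inverse ?T) (?T * inverse ?T)"
    by (rule agree_mult) simp
  moreover have "?T * inverse ?T = 1" by (rule inverse_mult_eq_1') simp
  ultimately show ?thesis by (simp add: mult_ac)
qed

theorem jacobi_triple_product:
  fixes Y :: "'a::field"
  assumes e: "1 \<le> e" and Y: "Y \<noteq> 0"
  shows "theta e Y = tprod (\<lambda>m. 1 - fps_X ^ (e * m)) * (1 + fps_const Y) *
    tprod (\<lambda>m. (1 + fps_const Y * fps_X ^ (e * m)) * (1 + fps_const (inverse Y) * fps_X ^ (e * m)))"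
proof (rule agree_eqI)
  fix N :: nat
  let ?p = "fps_X ^ e :: 'a fps"
  let ?T = "tprod (\<lambda>m. 1 - fps_X ^ (e * m)) :: 'a fps"
  \<comment> \<open>Only terms with \<bar>k\<bar> \<le> N + 1 reach order N. For them the index M +
    k and its complement M - k in the top 2M are both at least N.\<close>
  define M where "M = 2 * N + 2"
  have M1: "M = Suc (M - 1)" "N \<le> M - 1" "N \<le> M" by (auto simp: M_def)
  have eq1: "(\<Prod>i<M. 1 + fps_const Y * ?p ^ i) = (1 + fps_const Y) * (\<Prod>m=1..M - 1. 1 + fps_const Y * fps_X ^ (e * m))"
  proof -
    have "(\<Prod>i<M. 1 + fps_const Y * ?p ^ i) = (1 + fps_const Y) * (\<Prod>i<M - 1. 1 + fps_const Y * ?p ^ Suc i)"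
      by (subst M1(1), subst prod.lessThan_Suc_shift) simp
    also have "(\<Prod>i<M - 1. 1 + fps_const Y * ?p ^ Suc i) = (\<Prod>m=1..M - 1. 1 + fps_const Y * ?p ^ m)"
      by (rule prod.reindex_bij_witness[of _ "\<lambda>m. m - 1" Suc]) auto
    finally show ?thesis by (simp only: power_mult)
  qed
  have eq2: "(\<Prod>i<M. 1 + fps_const (inverse Y) * ?p ^ Suc i) = (\<Prod>m=1..M. 1 + fps_const (inverse Y) * fps_X ^ (e * m))"
    unfolding power_mult by (rule prod.reindex_bij_witness[of _ "\<lambda>m. m - 1" Suc]) (simp_all only: diff_Suc_1, auto)
  have "agree N (?T * (1 + fps_const Y) * tprod (\<lambda>m. (1 + fps_const Y * fps_X ^ (e * m)) * (1 + fps_const (inverse Y) * fps_X ^ (e * m))))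
     (?T * (1 + fps_const Y) * ((\<Prod>m=1..M - 1. 1 + fps_const Y * fps_X ^ (e * m)) * (\<Prod>m=1..M. 1 + fps_const (inverse Y) * fps_X ^ (e * m))))"
    unfolding tprod_mult[OF near_one_linear[OF e] near_one_linear[OF e]]
    by (intro agree_mult agree_refl agree_tprod near_one_linear e M1)
  also have "\<dots> = ?T * ((\<Prod>i<M. 1 + fps_const Y * ?p ^ i) * (\<Prod>i<M. 1 + fps_const (inverse Y) * ?p ^ Suc i))"
    unfolding eq1 eq2 by (simp only: mult_ac)
  also have "\<dots> = (\<Sum>k=- int M..int M. ?p ^ triangle k * (?T * gauss_binomial ?p (M + M) (nat (int M + k))) * fps_const (Y powi k))"
    unfolding jacobi_finite[OF Y] sum_distrib_left by (simp only: mult_ac)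
  also have "agree N \<dots> (\<Sum>k=- int M..int M. ?p ^ triangle k * fps_const (Y powi k))"
  proof (rule agree_sum)
    fix k assume "k \<in> {- int M..int M}"
    show "agree N (?p ^ triangle k * (?T * gauss_binomial ?p (M + M) (nat (int M + k))) * fps_const (Y powi k)) (?p ^ triangle k * fps_const (Y powi k))"
    proof (cases "triangle k \<le> N")
      case True
      then have "\<bar>k\<bar> \<le> int N + 1" using triangle_ge[of k] by simp
      then have "agree N (?T * gauss_binomial ?p (M + M) (nat (int M + k))) 1"
        by (intro agree_gauss_binomial e) (auto simp: M_def)
      then have "agree N (?p ^ triangle k * (?T * gauss_binomial ?p (M + M) (nat (int M + k))) * fps_const (Y powi k)) (?p ^ triangle k * 1 * fps_const (Y powi k))"
        by (intro agree_mult agree_refl)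
      then show ?thesis by simp
    next
      case False
      have "n < e * triangle k" if "n \<le> N" for n
        using False that mult_le_mono1[OF e, of "triangle k"] by linarith
      then have zero: "agree N (?p ^ triangle k * h) 0" for h :: "'a fps"
        by (simp add: agree_def fps_X_power_mult_nth flip: power_mult)
      show ?thesis unfolding mult.assoc by (rule agree_trans[OF zero agree_sym[OF zero]])
    qed
  qed
  also have "agree N \<dots> (theta e Y)"
    unfolding agree_def
  proof (intro allI impI)
    fix n assume n: "n \<le> N"
    have "fps_nth (\<Sum>k=- int M..int M. ?p ^ triangle k * fps_const (Y powi k)) n =
      (\<Sum>k=- int M..int M. if e * triangle k = n then Y powi k else 0)"
    proof -
      have "fps_nth (?p ^ triangle k * fps_const c) n = (if e * triangle k = n then c else 0)" for k c
        by (auto simp: fps_X_power_nth simp flip: power_mult)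
      then show ?thesis by (simp only: fps_sum_nth)
    qed
    also have "\<dots> = (\<Sum>k | e * triangle k = n. Y powi k)"
    proof -
      have "k \<in> {- int M..int M}" if "e * triangle k = n" for k
      proof -
        have "triangle k \<le> e * triangle k" using e by simp
        then have "triangle k \<le> N" using that n by simp
        then show ?thesis using triangle_ge[of k] by (auto simp: M_def)
      qed
      then have "{k \<in> {- int M..int M}. e * triangle k = n} = {k. e * triangle k = n}" by blast
      then show ?thesis by (subst sum.inter_filter[symmetric]) auto
    qed
    finally show "fps_nth (\<Sum>k=- int M..int M. ?p ^ triangle k * fps_const (Y powi k)) n = fps_nth (theta e Y) n"
      by (simp add: theta_def theta_index)
  qed
  finally show "agree N (theta e Y) (?T * (1 + fps_const Y) *
    tprod (\<lambda>m. (1 + fps_const Y * fps_X ^ (e * m)) * (1 + fps_const (inverse Y) * fps_X ^ (e * m))))"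
    by (rule agree_sym)
qed

section \<open>The principal specialisation of the theta product\<close>

lemma eval_at_superset:
  assumes "finite K" "keys f \<subseteq> K"
  shows "eval_at g x f = (\<Sum>v\<in>K. of_int (lookup f v) * (\<Prod>i<g. x i powi v i))"
  unfolding eval_at_def using assms by (intro sum.mono_neutral_left) (auto simp: in_keys_iff)

lemma eval_at_add: "eval_at g x (f + h) = eval_at g x f + eval_at g x h"
proof -
  have "keys (f + h) \<subseteq> keys f \<union> keys h" by (rule keys_add)
  then show ?thesis
    by (simp add: eval_at_superset[of "keys f \<union> keys h"] lookup_add distrib_right sum.distrib)
qed

lemma eval_at_sum: "eval_at g x (\<Sum>i\<in>I. f i) = (\<Sum>i\<in>I. eval_at g x (f i))"
  by (induction I rule: infinite_finite_induct) (simp_all add: eval_at_add, simp_all add: eval_at_def)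

lemma eval_at_single: "eval_at g x (Poly_Mapping.single v c) = of_int c * (\<Prod>i<g. x i powi v i)"
  by (subst eval_at_superset[of "{v}"]) (auto simp: keys_single)

lemma sum_of_monomials: "f = (\<Sum>v\<in>keys f. Poly_Mapping.single v (lookup f v))"
  by (rule poly_mapping_eqI) (auto simp: lookup_sum lookup_single when_def in_keys_iff sum.delta')

lemma eval_at_mult:
  assumes "\<And>i. i < g \<Longrightarrow> x i \<noteq> 0"
  shows "eval_at g x (f * h) = eval_at g x f * eval_at g x h"
proof -
  have mono: "(\<Prod>i<g. x i powi (v + w) i) = (\<Prod>i<g. x i powi v i) * (\<Prod>i<g. x i powi w i)" for v w
    using assms by (simp add: power_int_add flip: prod.distrib)
  have "f * h = (\<Sum>v\<in>keys f. Poly_Mapping.single v (lookup f v)) * (\<Sum>w\<in>keys h. Poly_Mapping.single w (lookup h w))"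
    by (simp flip: sum_of_monomials)
  also have "\<dots> = (\<Sum>v\<in>keys f. \<Sum>w\<in>keys h. Poly_Mapping.single (v + w) (lookup f v * lookup h w))"
    by (simp add: sum_product mult_single)
  finally have "eval_at g x (f * h) = (\<Sum>v\<in>keys f. \<Sum>w\<in>keys h. of_int (lookup f v * lookup h w) * (\<Prod>i<g. x i powi (v + w) i))"
    by (simp only: eval_at_sum eval_at_single)
  also have "\<dots> = eval_at g x f * eval_at g x h"
    unfolding eval_at_def sum_product mono by (simp add: mult_ac)
  finally show ?thesis .
qed

definition fps_eval :: "nat \<Rightarrow> (nat \<Rightarrow> 'a::field) \<Rightarrow> mpoly_series \<Rightarrow> 'a fps" where
  "fps_eval g x F = Abs_fps (\<lambda>n. eval_at g x (fps_nth F n))"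

lemma fps_eval_mult:
  assumes "\<And>i. i < g \<Longrightarrow> x i \<noteq> 0"
  shows "fps_eval g x (F * H) = fps_eval g x F * fps_eval g x H"
  by (auto simp: fps_eq_iff fps_eval_def fps_mult_nth eval_at_sum eval_at_mult assms)

lemma fps_eval_one: "fps_eval g x 1 = 1"
proof -
  have "eval_at g x (1 :: (nat \<Rightarrow> int) \<Rightarrow>\<^sub>0 int) = 1"
    using eval_at_single[of g x 0 1] by simp
  moreover have "eval_at g x 0 = 0" by (simp add: eval_at_def)
  ultimately show ?thesis by (simp add: fps_eq_iff fps_eval_def)
qed

lemma fps_eval_prod:
  assumes "\<And>i. i < g \<Longrightarrow> x i \<noteq> 0"
  shows "fps_eval g x (\<Prod>i\<in>I. F i) = (\<Prod>i\<in>I. fps_eval g x (F i))"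
  by (induction I rule: infinite_finite_induct) (simp_all add: fps_eval_one fps_eval_mult assms)

lemma prod_powi_unit_vec: "i < g \<Longrightarrow> (\<Prod>l<g. x l powi unit_vec i k l) = (x i powi k :: 'a::field)"
proof -
  assume i: "i < g"
  have "(\<Prod>l<g. x l powi unit_vec i k l) = (\<Prod>l<g. if l = i then x i powi k else 1)"
    by (rule prod.cong) (auto simp: unit_vec_def)
  then show ?thesis using i by simp
qed

lemma fps_eval_short:
  assumes "i < g"
  shows "fps_eval g x (short_factor i) = theta 1 (x i)"
  using assms by (simp add: fps_eq_iff fps_eval_def short_factor_def theta_def eval_at_sum eval_at_single prod_powi_unit_vec)

text \<open>The substitution r = k + l - 1, s = k - l turns 2 (k (k - 1) + l (l - 1)) + 1 into r^2 +
  s^2. It reaches every pair in the sum, since an odd r^2 + s^2 forces r + s to be odd.\<close>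

lemma theta_2_mult:
  "fps_nth (theta 2 A * theta 2 B) n =
   (\<Sum>(r, s) | r\<^sup>2 + s\<^sup>2 = 2 * int n + 1. A powi ((r + s + 1) div 2) * B powi ((r - s + 1) div 2))"
proof -
  let ?S = "\<lambda>n. {k. int 2 * (k * (k - 1)) = 2 * int n}"
  have S: "k \<in> ?S n \<longleftrightarrow> 2 * triangle k = n" for k n using theta_index[of 2 k n] by simp
  have fin: "finite (?S n)" for n
  proof (rule finite_subset)
    show "?S n \<subseteq> {- int n - 1..int n + 1}"
    proof
      fix k assume "k \<in> ?S n"
      then show "k \<in> {- int n - 1..int n + 1}" using S[of k n] triangle_ge[of k] by auto
    qed
  qed simp
  have "fps_nth (theta 2 A * theta 2 B) n = (\<Sum>i=0..n. \<Sum>k\<in>?S i. \<Sum>l\<in>?S (n - i). A powi k * B powi l)"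
    by (simp only: fps_mult_nth theta_def fps_nth_Abs_fps sum_product)
  also have "\<dots> = (\<Sum>(i, k, l)\<in>(SIGMA i:{0..n}. ?S i \<times> ?S (n - i)). A powi k * B powi l)"
  proof -
    have "\<forall>i\<in>{0..n}. finite (?S i \<times> ?S (n - i))" using fin by blast
    then show ?thesis
      by (simp only: sum.cartesian_product case_prod_unfold sum.Sigma finite_atLeastAtMost)
  qed
  also have "\<dots> = (\<Sum>(r, s) | r\<^sup>2 + s\<^sup>2 = 2 * int n + 1. A powi ((r + s + 1) div 2) * B powi ((r - s + 1) div 2))"
  proof (rule sum.reindex_bij_witness[of _
      "\<lambda>(r, s). (2 * triangle ((r + s + 1) div 2), (r + s + 1) div 2, (r - s + 1) div 2)"
      "\<lambda>(i, k, l). (k + l - 1, k - l)"], goal_cases)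
    case (1 a)
    obtain i k l where a: "a = (i, k, l)" by (metis prod_cases3)
    have "i = 2 * triangle k" using 1 S[of k i] by (simp add: a)
    moreover have "(k + l - 1 + (k - l) + 1) div 2 = k" "(k + l - 1 - (k - l) + 1) div 2 = l" by simp_all
    ultimately show ?case by (simp only: a case_prod_conv)
  next
    case (2 a)
    obtain i k l where a: "a = (i, k, l)" by (metis prod_cases3)
    have "2 * triangle k = i" "2 * triangle l = n - i" "i \<le> n"
      using 2 S[of k i] S[of l "n - i"] by (auto simp: a)
    then have "int n = k * (k - 1) + l * (l - 1)" using triangle[of k] triangle[of l] by simp
    then show ?case by (simp add: a power2_eq_square algebra_simps)
  next
    case (3 b)
    obtain r s where b: "b = (r, s)" by (cases b)
    have eq: "r\<^sup>2 + s\<^sup>2 = 2 * int n + 1" using 3 by (simp add: b)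
    have "odd (r\<^sup>2 + s\<^sup>2)" unfolding eq by simp
    then have "odd (r + s)" by simp
    then obtain k where "r + s = 2 * k + 1" by (rule oddE)
    then have e: "(r + s + 1) div 2 = k + 1" "(r - s + 1) div 2 = k + 1 - s" and r: "r = 2 * k + 1 - s" by presburger+
    show ?case unfolding b case_prod_conv e by (simp add: r)
  next
    case (4 b)
    obtain r s where b: "b = (r, s)" by (cases b)
    have eq: "r\<^sup>2 + s\<^sup>2 = 2 * int n + 1" using 4 by (simp add: b)
    have "odd (r\<^sup>2 + s\<^sup>2)" unfolding eq by simp
    then have "odd (r + s)" by simp
    then obtain k' where "r + s = 2 * k' + 1" by (rule oddE)
    then have r: "r = 2 * k' + 1 - s" by simp
    define k l where "k = (r + s + 1) div 2" and "l = (r - s + 1) div 2"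
    have kl: "r = k + l - 1" "s = k - l" by (simp_all add: k_def l_def r)
    have "k * (k - 1) + l * (l - 1) = int n" using eq unfolding kl by (simp add: power2_eq_square algebra_simps)
    then have "2 * triangle k + 2 * triangle l = n" using triangle[of k] triangle[of l] by linarith
    then have "2 * triangle k \<in> {0..n}" "k \<in> ?S (2 * triangle k)" "l \<in> ?S (n - 2 * triangle k)"
      unfolding S by auto
    then show ?case by (simp add: b flip: k_def l_def)
  next
    case (5 a)
    obtain i k l where a: "a = (i, k, l)" by (metis prod_cases3)
    have "(k + l - 1 + (k - l) + 1) div 2 = k" "(k + l - 1 - (k - l) + 1) div 2 = l" by simp_all
    then show ?case by (simp only: a case_prod_conv)
  qed
  finally show ?thesis .
qed

text \<open>The offset in r = k + l - 1 accounts for the monomial 1 / x_i, and the sign, read off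
  from the parity of r, becomes (-1)^(k + l) and is absorbed into the two arguments.\<close>

lemma fps_eval_long:
  assumes "i < g" "j < g" "i \<noteq> j" "\<And>i. i < g \<Longrightarrow> x i \<noteq> 0"
  shows "fps_eval g x (long_factor i j) =
    fps_const (inverse (x i)) * (theta 2 (- (x i * x j)) * theta 2 (- (x i / x j)))"
proof (rule fps_ext)
  fix n
  have nz: "x i \<noteq> 0" "x j \<noteq> 0" using assms by auto
  have mono: "(\<Prod>l<g. x l powi (unit_vec i r + unit_vec j s) l) = x i powi r * x j powi s" for r s
  proof -
    have "(\<Prod>l<g. x l powi (unit_vec i r + unit_vec j s) l) = (\<Prod>l<g. x l powi unit_vec i r l) * (\<Prod>l<g. x l powi unit_vec j s l)"
      using assms(4) by (simp add: power_int_add flip: prod.distrib)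
    then show ?thesis using assms by (simp add: prod_powi_unit_vec)
  qed
  have "fps_nth (fps_eval g x (long_factor i j)) n =
     (\<Sum>(r, s) | r\<^sup>2 + s\<^sup>2 = 2 * int n + 1. (if even r then -1 else 1) * (x i powi r * x j powi s))"
    by (auto simp: fps_eval_def long_factor_def eval_at_sum eval_at_single mono[unfolded plus_fun_apply] case_prod_beta neg_one_power_square intro!: sum.cong)
  also have "\<dots> = (\<Sum>(r, s) | r\<^sup>2 + s\<^sup>2 = 2 * int n + 1. inverse (x i) *
      ((- (x i * x j)) powi ((r + s + 1) div 2) * (- (x i / x j)) powi ((r - s + 1) div 2)))"
  proof (rule sum.cong[OF refl], clarify)
    fix r s assume eq: "r\<^sup>2 + s\<^sup>2 = 2 * int n + 1"
    have "odd (r\<^sup>2 + s\<^sup>2)" unfolding eq by simp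
    then have "odd (r + s)" by simp
    then obtain k' where "r + s = 2 * k' + 1" by (rule oddE)
    then have r: "r = 2 * k' + 1 - s" by simp
    define k l where "k = (r + s + 1) div 2" and "l = (r - s + 1) div 2"
    have kl: "r = k + l - 1" "s = k - l" by (simp_all add: k_def l_def r)
    have "x i powi r * x j powi s = inverse (x i) * ((x i * x j) powi k * (x i / x j) powi l)"
      using nz by (simp add: kl power_int_add power_int_diff power_int_mult_distrib power_int_divide_distrib field_simps)
    moreover have "even r \<longleftrightarrow> odd (k + l)" by (simp add: kl)
    ultimately show "(if even r then -1 else 1) * (x i powi r * x j powi s) = inverse (x i) *
      ((- (x i * x j)) powi ((r + s + 1) div 2) * (- (x i / x j)) powi ((r - s + 1) div 2))"
      unfolding k_def[symmetric] l_def[symmetric] by (auto simp: power_int_minus_left)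
  qed
  also have "\<dots> = fps_nth (fps_const (inverse (x i)) * (theta 2 (- (x i * x j)) * theta 2 (- (x i / x j)))) n"
    by (simp add: theta_2_mult sum_distrib_left case_prod_beta)
  finally show "fps_nth (fps_eval g x (long_factor i j)) n =
    fps_nth (fps_const (inverse (x i)) * (theta 2 (- (x i * x j)) * theta 2 (- (x i / x j)))) n" .
qed

section \<open>Product form of the specialised theta product\<close>

definition theta_const :: "nat \<Rightarrow> 'a::field fps" where
  "theta_const e = tprod (\<lambda>m. 1 - fps_X ^ (e * m))"

definition theta_term :: "nat \<Rightarrow> 'a::field \<Rightarrow> nat \<Rightarrow> 'a fps" where
  "theta_term e Y m = (1 + fps_const Y * fps_X ^ (e * m)) * (1 + fps_const (inverse Y) * fps_X ^ (e * m))"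

text \<open>The Weyl denominator of type B with signs changed in the short factors: the factor of a
  pair is (1 - x_i x_j) (1 - x_i / x_j) / x_i.\<close>

definition weyl :: "nat \<Rightarrow> (nat \<Rightarrow> 'a::field) \<Rightarrow> 'a" where
  "weyl g x = (\<Prod>i<g. 1 + x i) * (\<Prod>(i, j)\<in>pairs g. x i + inverse (x i) - x j - inverse (x j))"

text \<open>The layer m of real affine roots; the exponents m for short and 2 m for long roots come
  from the parameters 1 and 2 of \<open>theta_term\<close>.\<close>

definition affine_term :: "nat \<Rightarrow> (nat \<Rightarrow> 'a::field) \<Rightarrow> nat \<Rightarrow> 'a fps" where
  "affine_term g x m = (\<Prod>i<g. theta_term 1 (x i) m) *
     (\<Prod>(i, j)\<in>pairs g. theta_term 2 (- (x i * x j)) m * theta_term 2 (- (x i / x j)) m)"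

definition macdonald_const :: "nat \<Rightarrow> 'a::field fps" where
  "macdonald_const g = theta_const 1 ^ g * (\<Prod>p\<in>pairs g. theta_const 2 * theta_const 2)"

lemma near_one_theta_term: "1 \<le> e \<Longrightarrow> near_one (theta_term e Y)"
  unfolding theta_term_def by (intro near_one_mult near_one_linear)

lemma near_one_affine_term: "near_one (affine_term g x)"
  unfolding affine_term_def case_prod_beta
  by (intro near_one_mult near_one_prod near_one_theta_term) auto

lemma theta_product: "1 \<le> e \<Longrightarrow> Y \<noteq> 0 \<Longrightarrow> theta e Y = theta_const e * fps_const (1 + Y) * tprod (theta_term e Y)"
  using jacobi_triple_product[of e Y] by (simp add: theta_const_def theta_term_def[abs_def] flip: fps_const_add)

lemma fps_const_prod: "fps_const (\<Prod>i\<in>I. f i) = (\<Prod>i\<in>I. fps_const (f i :: 'a::comm_ring_1))"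
  by (induction I rule: infinite_finite_induct) (simp_all flip: fps_const_mult)

lemma macdonald_product:
  assumes x: "\<And>i. i < g \<Longrightarrow> x i \<noteq> 0"
  shows "fps_eval g x (macdonald g) = macdonald_const g * fps_const (weyl g x) * tprod (affine_term g x)"
proof -
  have short: "fps_eval g x (short_factor i) = theta_const 1 * fps_const (1 + x i) * tprod (theta_term 1 (x i))" if "i < g" for i
    using that x by (simp add: fps_eval_short theta_product)
  have long: "fps_eval g x (long_factor i j) = (theta_const 2 * theta_const 2) *
      fps_const (x i + inverse (x i) - x j - inverse (x j)) *
      tprod (\<lambda>m. theta_term 2 (- (x i * x j)) m * theta_term 2 (- (x i / x j)) m)" if "(i, j) \<in> pairs g" for i j
  proof -
    have ij: "i < g" "j < g" "i \<noteq> j" using that by (auto simp: pairs_def)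
    have nz: "x i \<noteq> 0" "x j \<noteq> 0" using ij x by auto
    have "inverse (x i) * ((1 + - (x i * x j)) * (1 + - (x i / x j))) = x i + inverse (x i) - x j - inverse (x j)"
      using nz by (simp add: field_simps)
    then have "fps_const (x i + inverse (x i) - x j - inverse (x j)) =
       fps_const (inverse (x i)) * (fps_const (1 + - (x i * x j)) * fps_const (1 + - (x i / x j)))"
      by (simp only: fps_const_mult)
    moreover have "theta 2 (- (x i * x j)) = theta_const 2 * fps_const (1 + - (x i * x j)) * tprod (theta_term 2 (- (x i * x j)))"
      "theta 2 (- (x i / x j)) = theta_const 2 * fps_const (1 + - (x i / x j)) * tprod (theta_term 2 (- (x i / x j)))"
      by (rule theta_product; use nz in simp)+
    moreover have "fps_eval g x (long_factor i j) = fps_const (inverse (x i)) * (theta 2 (- (x i * x j)) * theta 2 (- (x i / x j)))"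
      by (rule fps_eval_long) (use ij x in auto)
    moreover have "tprod (\<lambda>m. theta_term 2 (- (x i * x j)) m * theta_term 2 (- (x i / x j)) m) =
      tprod (theta_term 2 (- (x i * x j))) * tprod (theta_term 2 (- (x i / x j)))"
      by (intro tprod_mult near_one_theta_term) auto
    ultimately show ?thesis by (simp only: mult_ac)
  qed
  have "fps_eval g x (macdonald g) = (\<Prod>i<g. fps_eval g x (short_factor i)) * (\<Prod>(i, j)\<in>pairs g. fps_eval g x (long_factor i j))"
    using x by (simp add: macdonald_def fps_eval_mult fps_eval_prod case_prod_unfold)
  also have "(\<Prod>i<g. fps_eval g x (short_factor i)) = theta_const 1 ^ g * fps_const (\<Prod>i<g. 1 + x i) * (\<Prod>i<g. tprod (theta_term 1 (x i)))"
    by (simp add: short prod.distrib fps_const_prod)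
  also have "(\<Prod>(i, j)\<in>pairs g. fps_eval g x (long_factor i j)) =
     (\<Prod>p\<in>pairs g. theta_const 2 * theta_const 2) *
     fps_const (\<Prod>(i, j)\<in>pairs g. x i + inverse (x i) - x j - inverse (x j)) *
     (\<Prod>(i, j)\<in>pairs g. tprod (\<lambda>m. theta_term 2 (- (x i * x j)) m * theta_term 2 (- (x i / x j)) m))"
  proof -
    have "(\<Prod>(i, j)\<in>pairs g. fps_eval g x (long_factor i j)) = (\<Prod>p\<in>pairs g. (theta_const 2 * theta_const 2) *
      fps_const (x (fst p) + inverse (x (fst p)) - x (snd p) - inverse (x (snd p))) *
      tprod (\<lambda>m. theta_term 2 (- (x (fst p) * x (snd p))) m * theta_term 2 (- (x (fst p) / x (snd p))) m))"
      by (rule prod.cong) (auto simp: long)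
    then show ?thesis by (simp only: prod.distrib fps_const_prod case_prod_unfold)
  qed
  also have "(\<Prod>i<g. tprod (theta_term 1 (x i))) = tprod (\<lambda>m. \<Prod>i<g. theta_term 1 (x i) m)"
    by (rule tprod_prod[symmetric]) (auto intro: near_one_theta_term)
  also have "(\<Prod>(i, j)\<in>pairs g. tprod (\<lambda>m. theta_term 2 (- (x i * x j)) m * theta_term 2 (- (x i / x j)) m)) =
      tprod (\<lambda>m. \<Prod>(i, j)\<in>pairs g. theta_term 2 (- (x i * x j)) m * theta_term 2 (- (x i / x j)) m)"
    unfolding case_prod_unfold
    by (rule tprod_prod[symmetric]) (auto intro!: near_one_mult near_one_theta_term)
  finally have "fps_eval g x (macdonald g) = macdonald_const g * fps_const (weyl g x) *
     (tprod (\<lambda>m. \<Prod>i<g. theta_term 1 (x i) m) * tprod (\<lambda>m. \<Prod>(i, j)\<in>pairs g. theta_term 2 (- (x i * x j)) m * theta_term 2 (- (x i / x j)) m))"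
    by (simp only: macdonald_const_def weyl_def fps_const_mult[symmetric] mult_ac)
  also have "tprod (\<lambda>m. \<Prod>i<g. theta_term 1 (x i) m) * tprod (\<lambda>m. \<Prod>(i, j)\<in>pairs g. theta_term 2 (- (x i * x j)) m * theta_term 2 (- (x i / x j)) m) =
     tprod (affine_term g x)"
    unfolding affine_term_def[abs_def] case_prod_unfold
    by (rule tprod_mult[symmetric]; intro near_one_prod near_one_mult near_one_theta_term) auto
  finally show ?thesis .
qed

lemma fps_prod_nth_0: "fps_nth (\<Prod>i\<in>I. f i) 0 = (\<Prod>i\<in>I. fps_nth (f i :: 'a::comm_ring_1 fps) 0)"
  by (induction I rule: infinite_finite_induct) simp_all

text \<open>The finite denominator formula is the comparison of constant coefficients in the affine
  one, since 0 is the only lattice vector of energy at most 0.\<close>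

lemma weyl_orbit_sum:
  assumes "0 < g" "\<And>i. i < g \<Longrightarrow> x i \<noteq> 0"
  shows "weyl g x = of_int (rho_coeff g 0) * orbit_sum g x 0"
proof -
  have "fps_nth (macdonald_const g :: 'a fps) 0 = 1"
    by (simp add: macdonald_const_def theta_const_def fps_prod_nth_0 fps_power_zeroth)
  then have "weyl g x = fps_nth (fps_eval g x (macdonald g)) 0"
    by (simp add: macdonald_product[OF assms(2)])
  also have "\<dots> = (\<Sum>m | m \<in> restricted g \<and> total_energy g m \<le> 0. of_int (rho_coeff g (0 - total_energy g m)) * orbit_sum g x m)"
    using macdonald_expansion[OF assms(1), of x 0] by (simp add: fps_eval_def)
  also have "{m. m \<in> restricted g \<and> total_energy g m \<le> 0} = {0}"
    using total_energy_zero_iff[of _ g] by (auto simp: restricted_def)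
  finally show ?thesis by (simp add: total_energy_def energy_def flip: zero_fun_def)
qed

text \<open>Equal to 2 c - 1 for the coordinate c on the first branch; on the second branch 2 c - 1
  is the negative of the charge.\<close>

definition charge :: "nat \<Rightarrow> (nat \<Rightarrow> int) \<Rightarrow> nat \<Rightarrow> int" where
  "charge g m i = 4 * int g * m i + 2 * int i + 1"

text \<open>The form that an orbit sum takes at the principal point, see
  \<open>core_value_orbit_sum\<close>; the monomial in front comes from the exchange of roles in
  \<open>orbit_sum_principal\<close>.\<close>

definition core_value :: "nat \<Rightarrow> 'a::field \<Rightarrow> (nat \<Rightarrow> int) \<Rightarrow> 'a" where
  "core_value g w m = w powi (- 2 * int g * (\<Sum>i<g. m i)) * weyl g (\<lambda>i. w powi charge g m i)"

lemma prod_powi: "w \<noteq> 0 \<Longrightarrow> (\<Prod>i\<in>I. w powi f i) = (w::'a::field) powi (\<Sum>i\<in>I. f i)"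
  by (induction I rule: infinite_finite_induct) (auto simp: power_int_add)

text \<open>With c on the first branch, the exponent (2 l + 1) c equals (l + 1) times the charge
  plus l - s - 2g m_s, and similarly for the second branch. The corrections sum to the same value
  for every permutation, because s runs through the same indices as l. What remains is the orbit sum
  with rows and columns exchanged, hence the passage to the inverse permutation.\<close>

lemma orbit_sum_principal:
  fixes w :: "'a::field"
  assumes w: "w \<noteq> 0"
  shows "orbit_sum g (\<lambda>i. w powi (2 * int i + 1)) m =
    w powi (- 2 * int g * (\<Sum>i<g. m i)) * orbit_sum g (\<lambda>i. w powi charge g m i) 0"
proof -
  define G where "G = (\<lambda>l s. (w powi charge g m l) powi (int s + 1) + (w powi charge g m l) powi (- int s))"
  have G: "(w powi charge g m l) powi coord g s ((0::nat \<Rightarrow> int) s) True + (w powi charge g m l) powi coord g s ((0::nat \<Rightarrow> int) s) False = G l s" for l s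
    by (simp add: G_def coord_def)
  have F: "(w powi (2 * int l + 1)) powi coord g s (m s) True + (w powi (2 * int l + 1)) powi coord g s (m s) False =
     w powi (int l - int s - 2 * int g * m s) * G s l" for l s
  proof -
    have T: "(2 * int l + 1) * coord g s (m s) True = (int l - int s - 2 * int g * m s) + charge g m s * (int l + 1)"
      and F: "(2 * int l + 1) * coord g s (m s) False = (int l - int s - 2 * int g * m s) + charge g m s * (- int l)"
      by (simp_all add: coord_def charge_def algebra_simps)
    have e: "w powi (a + b) = w powi a * w powi b" for a b using w by (simp add: power_int_add)
    show ?thesis
      unfolding G_def power_int_mult[symmetric] T F by (simp only: e distrib_left)
  qed
  have "orbit_sum g (\<lambda>i. w powi (2 * int i + 1)) m =
     (\<Sum>p | p permutes {..<g}. of_int (sign p) * (\<Prod>l<g. w powi (int l - int (p l) - 2 * int g * m (p l)) * G (p l) l))"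
    unfolding orbit_sum_def F ..
  also have "\<dots> = (\<Sum>p | p permutes {..<g}. of_int (sign (inv p)) * (w powi (- 2 * int g * (\<Sum>i<g. m i)) * (\<Prod>s<g. G s (inv p s))))"
  proof (rule sum.cong[OF refl])
    fix p assume "p \<in> {p. p permutes {..<g}}"
    then have p: "p permutes {..<g}" by simp
    have s1: "(\<Sum>l<g. m (p l)) = (\<Sum>i<g. m i)" "(\<Sum>l<g. int (p l)) = (\<Sum>l<g. int l)"
      using sum.permute[OF p, of m] sum.permute[OF p, of int] by (simp_all add: comp_def)
    have "(\<Sum>l<g. int l - int (p l) - 2 * int g * m (p l)) = - 2 * int g * (\<Sum>i<g. m i)"
      by (simp add: sum_subtractf s1 flip: sum_distrib_left)
    then have 1: "(\<Prod>l<g. w powi (int l - int (p l) - 2 * int g * m (p l))) = w powi (- 2 * int g * (\<Sum>i<g. m i))"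
      by (simp only: prod_powi[OF w])
    have "(\<Prod>s<g. G s (inv p s)) = (\<Prod>l<g. G (p l) (inv p (p l)))"
      using prod.permute[OF p, of "\<lambda>s. G s (inv p s)"] by (simp add: comp_def)
    then have 2: "(\<Prod>s<g. G s (inv p s)) = (\<Prod>l<g. G (p l) l)"
      by (simp add: permutes_inverses(2)[OF p])
    have "sign (inv p) = sign p"
      using p by (intro sign_inverse) (auto intro: permutes_imp_permutation)
    then show "of_int (sign p) * (\<Prod>l<g. w powi (int l - int (p l) - 2 * int g * m (p l)) * G (p l) l) =
       of_int (sign (inv p)) * (w powi (- 2 * int g * (\<Sum>i<g. m i)) * (\<Prod>s<g. G s (inv p s)))"
      by (simp only: prod.distrib 1 2)
  qed
  also have "\<dots> = (\<Sum>p | p permutes {..<g}. of_int (sign p) * (w powi (- 2 * int g * (\<Sum>i<g. m i)) * (\<Prod>s<g. G s (p s))))"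
    by (rule sum.reindex_bij_witness[of _ inv inv]) (auto simp: permutes_inv permutes_inv_inv)
  also have "\<dots> = w powi (- 2 * int g * (\<Sum>i<g. m i)) * orbit_sum g (\<lambda>i. w powi charge g m i) 0"
    unfolding orbit_sum_def G sum_distrib_left by (simp only: mult_ac)
  finally show ?thesis .
qed

lemma core_value_orbit_sum:
  assumes "0 < g" "w \<noteq> 0"
  shows "core_value g w m = of_int (rho_coeff g 0) * orbit_sum g (\<lambda>i. w powi (2 * int i + 1)) m"
  using weyl_orbit_sum[OF assms(1), of "\<lambda>i. w powi charge g m i"] assms(2)
  by (simp add: core_value_def orbit_sum_principal)

definition core_series :: "nat \<Rightarrow> 'a::field \<Rightarrow> 'a fps" where
  "core_series g w = Abs_fps (\<lambda>n. \<Sum>m | m \<in> restricted g \<and> total_energy g m = int n. core_value g w m)"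

definition rho_series :: "nat \<Rightarrow> 'a::field fps" where
  "rho_series g = Abs_fps (\<lambda>n. of_int (rho_coeff g (int n)))"

text \<open>The orbit sum of a lattice vector does not depend on the order n, so the coefficients
  left open by the symmetries separate off as the factor \<open>rho_series\<close>, which is free of
  w.\<close>

theorem macdonald_principal:
  fixes w :: "'a::field"
  assumes g: "0 < g" and w: "w \<noteq> 0"
  shows "fps_const (of_int (rho_coeff g 0)) * (macdonald_const g *
      fps_const (weyl g (\<lambda>i. w powi (2 * int i + 1))) * tprod (affine_term g (\<lambda>i. w powi (2 * int i + 1)))) =
    rho_series g * core_series g w"
proof -
  let ?x = "\<lambda>i. w powi (2 * int i + 1)"
  have "fps_const (of_int (rho_coeff g 0)) * fps_eval g ?x (macdonald g) = rho_series g * core_series g w"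
  proof (rule fps_ext)
    fix n
    let ?M = "{m. m \<in> restricted g \<and> total_energy g m \<le> int n}"
    have fin: "finite ?M" using finite_total_energy_le by simp
    have "fps_nth (fps_const (of_int (rho_coeff g 0)) * fps_eval g ?x (macdonald g)) n =
       (\<Sum>m\<in>?M. of_int (rho_coeff g (int n - total_energy g m)) * core_value g w m)"
      by (simp add: fps_eval_def macdonald_expansion[OF g] core_value_orbit_sum[OF g w] sum_distrib_left mult_ac)
    also have "\<dots> = (\<Sum>k\<in>{0..n}. \<Sum>m | m \<in> ?M \<and> nat (total_energy g m) = k. of_int (rho_coeff g (int n - total_energy g m)) * core_value g w m)"
      by (rule sum.group[symmetric, OF fin]) auto
    also have "\<dots> = (\<Sum>k\<in>{0..n}. of_int (rho_coeff g (int (n - k))) * (\<Sum>m | m \<in> restricted g \<and> total_energy g m = int k. core_value g w m))"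
    proof (rule sum.cong[OF refl])
      fix k assume k: "k \<in> {0..n}"
      have "{m. m \<in> ?M \<and> nat (total_energy g m) = k} = {m. m \<in> restricted g \<and> total_energy g m = int k}"
        using k total_energy_nonneg[of g] by (auto simp: nat_eq_iff)
      then show "(\<Sum>m | m \<in> ?M \<and> nat (total_energy g m) = k. of_int (rho_coeff g (int n - total_energy g m)) * core_value g w m) =
        of_int (rho_coeff g (int (n - k))) * (\<Sum>m | m \<in> restricted g \<and> total_energy g m = int k. core_value g w m)"
        using k by (simp add: sum_distrib_left of_nat_diff)
    qed
    also have "\<dots> = fps_nth (core_series g w * rho_series g) n"
      unfolding fps_mult_nth core_series_def rho_series_def fps_nth_Abs_fps by (simp only: mult.commute)
    finally show "fps_nth (fps_const (of_int (rho_coeff g 0)) * fps_eval g ?x (macdonald g)) n = fps_nth (rho_series g * core_series g w) n"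
      by (simp add: mult.commute)
  qed
  then show ?thesis using macdonald_product[of g ?x] w by simp
qed

section \<open>Maya diagrams and cores\<close>

text \<open>For a self-conjugate partition \<open>p\<close> and \<open>A = frobenius p\<close> this is the set of the numbers \<open>p\<^sub>i - i\<close>, \<open>i \<ge> 1\<close>.
  The hook lengths off the diagonal are the sums \<open>b + c + 1 > 0\<close> of two beads, each occurring once
  above and once below the diagonal.\<close>

definition maya :: "nat set \<Rightarrow> int set" where
  "maya A = {b. if b \<ge> 0 then nat b \<in> A else nat (- 1 - b) \<notin> A}"

definition maya_pairs :: "int set \<Rightarrow> (int \<times> int) set" where
  "maya_pairs S = {(b, c). b \<in> S \<and> c \<in> S \<and> b < c \<and> b + c + 1 > 0}"

text \<open>The diagonal hook lengths are 2 b + 1 for the nonnegative beads b. The two functions are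
  parameters so that the formal weight and its specialisation are both instances.\<close>

definition maya_prod :: "(int \<Rightarrow> 'a::comm_monoid_mult) \<Rightarrow> (int \<Rightarrow> 'a) \<Rightarrow> int set \<Rightarrow> 'a" where
  "maya_prod f h S = (\<Prod>(b, c)\<in>maya_pairs S. f (b + c + 1)) * (\<Prod>b\<in>S \<inter> {0..}. h (2 * b + 1))"

lemma maya_mirror: "- 1 - b \<in> maya A \<longleftrightarrow> b \<notin> maya A"
  by (auto simp: maya_def)

lemma maya_Int_nonneg: "maya A \<inter> {0..} = int ` A"
proof (intro equalityI subsetI)
  fix b assume "b \<in> maya A \<inter> {0..}"
  then show "b \<in> int ` A" by (intro image_eqI[of b int "nat b"]) (auto simp: maya_def)
qed (auto simp: maya_def)

lemma maya_bounded:
  assumes "finite A"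
  obtains c where "\<And>b. b \<in> maya A \<Longrightarrow> b < c" "0 \<le> c"
proof (rule that[of "int (Suc (Max (insert 0 A)))"])
  fix b assume b: "b \<in> maya A"
  show "b < int (Suc (Max (insert 0 A)))"
  proof (cases "b \<ge> 0")
    case True
    then have "nat b \<in> A" using b by (simp add: maya_def)
    then have "nat b \<le> Max (insert 0 A)" using assms by (intro Max_ge) auto
    then show ?thesis using True by linarith
  qed simp
qed simp

lemma finite_maya_pairs:
  assumes "finite A"
  shows "finite (maya_pairs (maya A))"
proof -
  obtain c where c: "\<And>b. b \<in> maya A \<Longrightarrow> b < c" "0 \<le> c" using maya_bounded[OF assms] by blast
  have "maya_pairs (maya A) \<subseteq> {- c..c} \<times> {- c..c}"
    using c(1) by (fastforce simp: maya_pairs_def)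
  then show ?thesis by (rule finite_subset) simp
qed

text \<open>The vector \<open>m\<close> gives the fill levels of the residue classes modulo \<open>2g\<close>; self-conjugacy makes the
  levels of \<open>r\<close> and \<open>2g - 1 - r\<close> opposite.\<close>

definition level :: "nat \<Rightarrow> (nat \<Rightarrow> int) \<Rightarrow> int \<Rightarrow> int" where
  "level g m r = (if r \<ge> int g then m (nat (r - int g)) else - m (nat (int g - 1 - r)))"

definition core_set :: "nat \<Rightarrow> (nat \<Rightarrow> int) \<Rightarrow> int set" where
  "core_set g m = {b. b div (2 * int g) < level g m (b mod (2 * int g))}"

definition core_beads :: "nat \<Rightarrow> (nat \<Rightarrow> int) \<Rightarrow> nat set" where
  "core_beads g m = {a. int a \<in> core_set g m}"

lemma level_mirror: "level g m (2 * int g - 1 - r) = - level g m r"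
  by (auto simp: level_def algebra_simps)

lemma level_simps: "level g m (int g + int j) = m j" "j < g \<Longrightarrow> level g m (int g - 1 - int j) = - m j"
  by (simp_all add: level_def)

lemma div_mod_mirror:
  assumes "0 < g"
  shows "(- 1 - b) div (2 * int g) = - 1 - b div (2 * int g)"
    "(- 1 - b) mod (2 * int g) = 2 * int g - 1 - b mod (2 * int g)"
proof -
  have b: "b = 2 * int g * (b div (2 * int g)) + b mod (2 * int g)" by simp
  have r: "0 \<le> b mod (2 * int g)" "b mod (2 * int g) < 2 * int g" using assms by simp_all
  have eq: "- 1 - b = 2 * int g * (- 1 - b div (2 * int g)) + (2 * int g - 1 - b mod (2 * int g))"
    using b by (simp add: algebra_simps)
  show "(- 1 - b) div (2 * int g) = - 1 - b div (2 * int g)"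
    by (rule int_div_pos_eq[OF eq]) (use r in auto)
  show "(- 1 - b) mod (2 * int g) = 2 * int g - 1 - b mod (2 * int g)"
    by (rule int_mod_pos_eq[OF eq]) (use r in auto)
qed

lemma core_set_mirror: "0 < g \<Longrightarrow> - 1 - b \<in> core_set g m \<longleftrightarrow> b \<notin> core_set g m"
  by (simp add: core_set_def div_mod_mirror level_mirror) linarith

lemma core_set_iff:
  assumes "0 \<le> r" "r < 2 * int g"
  shows "2 * int g * j + r \<in> core_set g m \<longleftrightarrow> j < level g m r"
  using assms by (simp add: core_set_def)

lemma maya_core_beads: "0 < g \<Longrightarrow> maya (core_beads g m) = core_set g m"
  using core_set_mirror[of g _ m] by (auto simp: maya_def core_beads_def split: if_splits)

lemma finite_core_beads:
  assumes g: "0 < g"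
  shows "finite (core_beads g m)"
proof -
  define B where "B = Max (level g m ` {0..<2 * int g})"
  have lev: "b div (2 * int g) < B" if "b \<in> core_set g m" for b
  proof -
    have "b mod (2 * int g) \<in> {0..<2 * int g}" using g by simp
    then have "level g m (b mod (2 * int g)) \<le> B" unfolding B_def by (intro Max_ge) auto
    then show ?thesis using that by (simp add: core_set_def)
  qed
  then have "b < 2 * int g * B" if "b \<in> core_set g m" for b
  proof -
    have "2 * int g * (b div (2 * int g) + 1) \<le> 2 * int g * B"
      using lev[OF that] by (intro mult_left_mono) auto
    moreover have "b < 2 * int g * (b div (2 * int g) + 1)"
    proof -
      have "b mod (2 * int g) < 2 * int g" using g by simp
      moreover have "b = 2 * int g * (b div (2 * int g)) + b mod (2 * int g)" by simp
      ultimately show ?thesis unfolding distrib_left mult_1_right by linarith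
    qed
    ultimately show ?thesis by linarith
  qed
  then have "int ` core_beads g m \<subseteq> {0..2 * int g * B}"
    by (auto simp: core_beads_def order.strict_implies_order)
  then have "finite (int ` core_beads g m)" by (rule finite_subset) simp
  then show ?thesis by (rule finite_imageD) simp
qed

lemma core_beads_inj:
  assumes g: "0 < g"
  shows "inj_on (core_beads g) (restricted g)"
proof (rule inj_onI)
  fix m m' assume m: "m \<in> restricted g" "m' \<in> restricted g" and eq: "core_beads g m = core_beads g m'"
  then have S: "core_set g m = core_set g m'" using maya_core_beads[OF g] by metis
  show "m = m'"
  proof
    fix i show "m i = m' i"
    proof (cases "i < g")
      case True
      have "j < m i \<longleftrightarrow> j < m' i" for j
        using core_set_iff[of "int g + int i" g j m] core_set_iff[of "int g + int i" g j m'] True S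
        by (simp add: level_simps)
      then show ?thesis by (meson linorder_neqE less_irrefl)
    next
      case False
      then show ?thesis using m by (simp add: restricted_def)
    qed
  qed
qed

lemma int_threshold:
  fixes P :: "int \<Rightarrow> bool"
  assumes down: "\<And>j. P (j + 1) \<Longrightarrow> P j" and lo: "P lo" and hi: "\<And>j. hi \<le> j \<Longrightarrow> \<not> P j"
  obtains s where "\<And>j. P j \<longleftrightarrow> j < s"
proof -
  define J where "J = {j \<in> {lo..hi}. P j}"
  have fin: "finite J" by (rule finite_subset[of _ "{lo..hi}"]) (auto simp: J_def)
  have "lo < hi" using lo hi[of lo] by (meson not_le)
  then have ne: "J \<noteq> {}" using lo by (auto simp: J_def intro!: exI[of _ lo])
  have below: "P j" if "j \<le> k" "P k" for j k
    using that by (induction rule: int_le_induct) (auto intro: down[of "_ - 1", simplified])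
  have "P j \<longleftrightarrow> j < Max J + 1" for j
  proof
    assume "P j"
    show "j < Max J + 1"
    proof (cases "j < lo")
      case True
      have "lo \<le> Max J" using fin ne \<open>lo < hi\<close> lo by (intro Max_ge) (auto simp: J_def)
      then show ?thesis using True by simp
    next
      case False
      moreover have "j < hi" using \<open>P j\<close> hi[of j] by (meson not_le)
      ultimately have "j \<in> J" using \<open>P j\<close> by (auto simp: J_def)
      then show ?thesis using fin by (simp add: le_less_Suc_eq zle_add1_eq_le)
    qed
  next
    assume "j < Max J + 1"
    moreover have "P (Max J)" using Max_in[OF fin ne] by (simp add: J_def)
    ultimately show "P j" using below by auto
  qed
  then show thesis using that by blast
qed

text \<open>Closure under subtracting 2g makes every residue class a ray of integers, given by its
  threshold; mirror symmetry makes the thresholds of r and 2g - 1 - r opposite, so those of the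
  upper half determine the set.\<close>

lemma core_beads_surj:
  assumes g: "0 < g" and A: "finite A" and closed: "\<And>b. b \<in> maya A \<Longrightarrow> b - 2 * int g \<in> maya A"
  obtains m where "m \<in> restricted g" "core_beads g m = A"
proof -
  obtain c where c: "\<And>b. b \<in> maya A \<Longrightarrow> b < c" "0 \<le> c" using maya_bounded[OF A] by blast
  have "\<exists>s. \<forall>j. 2 * int g * j + r \<in> maya A \<longleftrightarrow> j < s" if r: "0 \<le> r" "r < 2 * int g" for r
  \<comment> \<open>No bead is at c or above, so by the mirror every position below - c is a bead;
    the quotient - 2 - c lies low enough for every residue r < 2g.\<close>
  proof (rule int_threshold[of "\<lambda>j. 2 * int g * j + r \<in> maya A" "- 2 - c" c])
    fix j assume "2 * int g * (j + 1) + r \<in> maya A"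
    from closed[OF this] show "2 * int g * j + r \<in> maya A" by (simp add: algebra_simps)
  next
    have "2 * int g * (c + 1) \<ge> 1 * (c + 1)" using g c(2) by (intro mult_right_mono) auto
    then have "- 1 - (2 * int g * (- 2 - c) + r) \<ge> c" using r by (simp add: algebra_simps)
    then have "- 1 - (2 * int g * (- 2 - c) + r) \<notin> maya A" using c(1) by fastforce
    then show "2 * int g * (- 2 - c) + r \<in> maya A" using maya_mirror by blast
  next
    fix j assume j: "c \<le> j"
    have "2 * int g * j \<ge> 1 * j" using g c(2) j by (intro mult_right_mono) auto
    then show "2 * int g * j + r \<notin> maya A" using c(1) j r by fastforce
  qed blast
  then have "\<forall>r. \<exists>s. 0 \<le> r \<longrightarrow> r < 2 * int g \<longrightarrow> (\<forall>j. 2 * int g * j + r \<in> maya A \<longleftrightarrow> j < s)" by blast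
  then obtain F where F: "\<And>r j. 0 \<le> r \<Longrightarrow> r < 2 * int g \<Longrightarrow> 2 * int g * j + r \<in> maya A \<longleftrightarrow> j < F r" by metis
  have mirror: "F (2 * int g - 1 - r) = - F r" if r: "0 \<le> r" "r < 2 * int g" for r
  proof -
    have "j < - F r \<longleftrightarrow> j < F (2 * int g - 1 - r)" for j
    proof -
      have "j < F (2 * int g - 1 - r) \<longleftrightarrow> 2 * int g * j + (2 * int g - 1 - r) \<in> maya A"
        using F[of "2 * int g - 1 - r" j] r by simp
      also have "2 * int g * j + (2 * int g - 1 - r) = - 1 - (2 * int g * (- 1 - j) + r)"
        by (simp add: algebra_simps)
      also have "\<dots> \<in> maya A \<longleftrightarrow> \<not> (- 1 - j < F r)" using F[of r "- 1 - j"] r maya_mirror by simp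
      also have "\<dots> \<longleftrightarrow> j < - F r" by linarith
      finally show ?thesis by simp
    qed
    then show ?thesis by (meson linorder_neqE less_irrefl)
  qed
  define m where "m = (\<lambda>i. if i < g then F (int g + int i) else 0)"
  have lev: "level g m r = F r" if r: "0 \<le> r" "r < 2 * int g" for r
  proof (cases "r \<ge> int g")
    case True
    then show ?thesis using r by (simp add: level_def m_def nat_less_iff)
  next
    case False
    then have "nat (int g - 1 - r) < g" "int (nat (int g - 1 - r)) = int g - 1 - r" using r by auto
    then have "level g m r = - F (int g + (int g - 1 - r))" using False by (simp add: level_def m_def)
    also have "int g + (int g - 1 - r) = 2 * int g - 1 - r" by simp
    finally show ?thesis using mirror[OF r] by simp
  qed
  have "b \<in> core_set g m \<longleftrightarrow> b \<in> maya A" for b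
  proof -
    have r: "0 \<le> b mod (2 * int g)" "b mod (2 * int g) < 2 * int g" using g by simp_all
    show ?thesis
      using core_set_iff[OF r, of "b div (2 * int g)" m] F[OF r, of "b div (2 * int g)"] lev[OF r] by simp
  qed
  then have "core_beads g m = A" by (auto simp: core_beads_def maya_def)
  moreover have "m \<in> restricted g" by (simp add: restricted_def m_def)
  ultimately show thesis using that by blast
qed

section \<open>Weights of cores\<close>

text \<open>\<open>w\<close> stands for q. Genericity means that it is not a root of unity, so that
  all factors that have to be divided by are nonzero.\<close>

locale principal =
  fixes w :: "'a::field" and g :: nat
  assumes w_nonzero: "w \<noteq> 0" and w_generic: "\<And>k::int. k \<noteq> 0 \<Longrightarrow> w powi k \<noteq> 1" and g_pos: "0 < g"
begin

definition R :: "int \<Rightarrow> 'a" where "R k = 1 - w powi (2 * k)"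

text \<open>The two factors of a mirrored pair of boxes with hook length h at u = - w^(2g); they
  depend on u^2 only.\<close>

definition off_diag :: "int \<Rightarrow> 'a" where
  "off_diag h = R (h + 2 * int g) * R (h - 2 * int g) / (R h)\<^sup>2"

text \<open>The box factor and the diagonal factor together are (1 + w^h / u) (1 - u w^h) / (1 -
  w^(2h)) after the common factor is cancelled; here u = - w^(2g).\<close>

definition on_diag :: "int \<Rightarrow> 'a" where
  "on_diag h = (1 - w powi (h - 2 * int g)) * (1 + w powi (h + 2 * int g)) / R h"

abbreviation weight :: "int set \<Rightarrow> 'a" where
  "weight S \<equiv> maya_prod off_diag on_diag S"

lemma w_add: "w powi (a + b) = w powi a * w powi b"
  using w_nonzero by (simp add: power_int_add)

lemma w_powi_nonzero [simp]: "w powi k \<noteq> 0" using w_nonzero by simp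

lemma R_eq_0_iff [simp]: "R k = 0 \<longleftrightarrow> k = 0"
  using w_generic[of "2 * k"] by (auto simp: R_def)

lemma one_minus_odd: "odd k \<Longrightarrow> 1 - w powi k \<noteq> 0"
  using w_generic[of k] by (cases "k = 0") auto

lemma one_plus_odd:
  assumes "odd k" shows "1 + w powi k \<noteq> 0"
proof
  assume "1 + w powi k = 0"
  then have "w powi k = -1" by (simp add: eq_neg_iff_add_eq_0 add.commute)
  then have "w powi (k + k) = 1" by (simp only: w_add) simp
  then have "k + k = 0" using w_generic[of "k + k"] by auto
  then show False using assms by simp
qed

text \<open>If b - 2g is not a bead, its mirror c = 2g - 1 - b is one, and the pair of b and c has
  hook length 2g, where \<open>off_diag\<close> vanishes. Parity excludes b = c.\<close>

lemma weight_eq_0: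
  assumes A: "finite A" and b: "b \<in> maya A" "b - 2 * int g \<notin> maya A"
  shows "weight (maya A) = 0"
proof -
  define c where "c = 2 * int g - 1 - b"
  have "c \<in> maya A" using maya_mirror[of "b - 2 * int g" A] b(2) by (simp add: c_def algebra_simps)
  moreover have "c \<noteq> b" unfolding c_def by presburger
  ultimately have "(min b c, max b c) \<in> maya_pairs (maya A)"
    using b(1) g_pos by (auto simp: maya_pairs_def min_def max_def c_def)
  moreover have "off_diag (min b c + max b c + 1) = 0"
    by (auto simp: min_def max_def c_def off_diag_def)
  ultimately have "(\<Prod>(b, c)\<in>maya_pairs (maya A). off_diag (b + c + 1)) = 0"
    using finite_maya_pairs[OF A]
    by (intro prod_zero bexI[of _ "(min b c, max b c)"]) simp_all
  then show ?thesis by (simp add: maya_prod_def)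
qed

text \<open>\<open>off_diag h\<close> is the quotient of R (h + 2g) / R h by R h / R (h - 2g), so
  the product along steps of 2g telescopes and leaves its two ends.\<close>

lemma off_diag_run:
  assumes "0 < s" "s < 2 * int g"
  shows "(\<Prod>i<K. off_diag (s + 2 * int g * int i)) =
    R (s + 2 * int g * int K) / R (s + 2 * int g * int K - 2 * int g) * (R (s - 2 * int g) / R s)"
proof (induction K)
  case 0
  then show ?case using assms by simp
next
  case (Suc K)
  let ?h = "s + 2 * int g * int K"
  have "?h mod (2 * int g) = s" "(?h - 2 * int g) mod (2 * int g) = s"
    using assms mod_mult_self1[of ?h "-1" "2 * int g"] by simp_all
  then have "?h \<noteq> 0" "?h - 2 * int g \<noteq> 0" using assms by (metis mod_0 less_irrefl)+
  then have nz: "R ?h \<noteq> 0" "R (?h - 2 * int g) \<noteq> 0" unfolding R_eq_0_iff .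
  have e: "s + 2 * int g * int (Suc K) = ?h + 2 * int g" by (simp add: algebra_simps)
  have "(\<Prod>i<Suc K. off_diag (s + 2 * int g * int i)) =
    R ?h / R (?h - 2 * int g) * (R (s - 2 * int g) / R s) * off_diag ?h"
    by (simp add: Suc.IH)
  also have "\<dots> = R (?h + 2 * int g) / R ?h * (R (s - 2 * int g) / R s)"
    unfolding off_diag_def power2_eq_square using nz by (simp add: field_simps)
  finally show ?case unfolding e by simp
qed

lemma R_neg: "R (- k) = - (w powi (- 2 * k)) * R k"
proof -
  have "w powi (- 2 * k) * w powi (2 * k) = 1" by (simp flip: w_add)
  then show ?thesis by (simp add: R_def algebra_simps)
qed

text \<open>Inverting the argument, R (s - 2g) is a monomial times - R (2g - s); the reflection s
  \<mapsto> 2g - s then cancels all of R and leaves an odd number of signs.\<close>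

lemma prod_boundary:
  "(\<Prod>s\<in>{1..<2 * int g}. R (s - 2 * int g) / R s) = - (w powi (- (2 * int g * (2 * int g - 1))))"
proof -
  have re: "(\<Prod>s\<in>{1..<2 * int g}. R (2 * int g - s)) = (\<Prod>s\<in>{1..<2 * int g}. R s)"
    by (rule prod.reindex_bij_witness[of _ "\<lambda>s. 2 * int g - s" "\<lambda>s. 2 * int g - s"]) auto
  have "(\<Prod>s\<in>{1..<2 * int g}. R (s - 2 * int g)) = (\<Prod>s\<in>{1..<2 * int g}. (- 1) * w powi (- 2 * (2 * int g - s)) * R (2 * int g - s))"
    by (rule prod.cong[OF refl]) (use R_neg[of "2 * int g - _"] in simp)
  also have "\<dots> = (- 1) ^ (nat (2 * int g - 1)) * w powi (\<Sum>s\<in>{1..<2 * int g}. - 2 * (2 * int g - s)) * (\<Prod>s\<in>{1..<2 * int g}. R s)"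
    by (simp only: prod.distrib prod_powi[OF w_nonzero] re prod_constant card_atLeastLessThan_int)
  also have "(- 1 :: 'a) ^ (nat (2 * int g - 1)) = - 1"
  proof -
    have "odd (nat (2 * int g - 1))" using g_pos by (simp add: even_nat_iff)
    then show ?thesis by simp
  qed
  also have "(\<Sum>s\<in>{1..<2 * int g}. - 2 * (2 * int g - s)) = - (2 * int g * (2 * int g - 1))"
  proof -
    have "(\<Sum>s\<in>{1..<2 * int g}. - 2 * (2 * int g - s)) = (\<Sum>s\<in>{1..<2 * int g}. - 2 * s)"
      by (rule sum.reindex_bij_witness[of _ "\<lambda>s. 2 * int g - s" "\<lambda>s. 2 * int g - s"]) auto
    moreover have "(\<Sum>s\<in>{1..<int n}. - 2 * s) = - (int n * (int n - 1))" if "0 < n" for n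
      using that
    proof (induction n)
      case (Suc n)
      show ?case
      proof (cases "n = 0")
        case False
        then have "{1..<int (Suc n)} = insert (int n) {1..<int n}" by auto
        then show ?thesis using Suc False by (simp add: algebra_simps)
      qed simp
    qed simp
    from this[of "2 * g"] have "(\<Sum>s\<in>{1..<2 * int g}. - 2 * s) = - (2 * int g * (2 * int g - 1))" using g_pos by simp
    ultimately show ?thesis by simp
  qed
  finally have "(\<Prod>s\<in>{1..<2 * int g}. R (s - 2 * int g)) = - (w powi (- (2 * int g * (2 * int g - 1)))) * (\<Prod>s\<in>{1..<2 * int g}. R s)"
    by simp
  moreover have "(\<Prod>s\<in>{1..<2 * int g}. R s) \<noteq> 0" by (simp add: prod_zero_iff)
  ultimately show ?thesis by (simp add: prod_dividef field_simps)
qed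

text \<open>Only the beads that form a pair with the largest bead \<open>a\<close> are seen by the ratio.  Along a
  residue class modulo \<open>2g\<close> the factors telescope, and the lower ends of the classes together
  contribute a monomial.\<close>

lemma weight_remove_top:
  assumes S: "S = insert (int a) (S' - {- 1 - int a})" and a: "int a \<notin> S'" "- 1 - int a \<in> S'"
    and fin: "finite (maya_pairs S)" "finite (S \<inter> {0..})"
    and top: "\<And>b. b \<in> S' \<Longrightarrow> b < int a"
  shows "weight S = weight S' * on_diag (2 * int a + 1) * (\<Prod>h | 0 < h \<and> h - int a - 1 \<in> S'. off_diag h)"
proof -
  let ?f = "\<lambda>(b, c). off_diag (b + c + 1)"
  let ?N = "{(b, c). b \<in> S' \<and> - 1 - int a < b \<and> c = int a}"
  have split: "maya_pairs S = maya_pairs S' \<union> ?N"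
    using top a by (fastforce simp: maya_pairs_def S)
  have disj: "maya_pairs S' \<inter> ?N = {}" using a by (auto simp: maya_pairs_def)
  have "(\<Prod>p\<in>maya_pairs S. ?f p) = (\<Prod>p\<in>maya_pairs S'. ?f p) * (\<Prod>p\<in>?N. ?f p)"
    using fin(1) unfolding split by (intro prod.union_disjoint disj) (auto dest: finite_subset[rotated])
  also have "(\<Prod>p\<in>?N. ?f p) = (\<Prod>h | 0 < h \<and> h - int a - 1 \<in> S'. off_diag h)"
    by (rule prod.reindex_bij_witness[of _ "\<lambda>h. (h - int a - 1, int a)" "\<lambda>(b, c). b + c + 1"]) auto
  finally have pairs: "(\<Prod>p\<in>maya_pairs S. ?f p) = (\<Prod>p\<in>maya_pairs S'. ?f p) * (\<Prod>h | 0 < h \<and> h - int a - 1 \<in> S'. off_diag h)" .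
  have "S \<inter> {0..} = insert (int a) (S' \<inter> {0..})" by (auto simp: S)
  then have "(\<Prod>b\<in>S \<inter> {0..}. on_diag (2 * b + 1)) = on_diag (2 * int a + 1) * (\<Prod>b\<in>S' \<inter> {0..}. on_diag (2 * b + 1))"
    using fin(2) a(1) by simp
  then show ?thesis using pairs by (simp add: maya_prod_def mult_ac)
qed

text \<open>The least position of residue class r that is not occupied.\<close>

definition vacancy :: "(nat \<Rightarrow> int) \<Rightarrow> int \<Rightarrow> int" where
  "vacancy m r = 2 * int g * level g m r + r"

lemma vacancy_iff:
  assumes "0 \<le> r" "r < 2 * int g" "b mod (2 * int g) = r"
  shows "b \<in> core_set g m \<longleftrightarrow> b < vacancy m r"
proof -
  have b: "b = 2 * int g * (b div (2 * int g)) + r" using assms(3) by (metis mult_div_mod_eq)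
  have "b \<in> core_set g m \<longleftrightarrow> b div (2 * int g) < level g m r"
    using core_set_iff[OF assms(1,2), of "b div (2 * int g)" m] b by simp
  also have "\<dots> \<longleftrightarrow> 2 * int g * (b div (2 * int g)) < 2 * int g * level g m r"
    using g_pos by simp
  finally show ?thesis using b unfolding vacancy_def by linarith
qed

text \<open>The hook lengths h are sorted by their class s modulo 2g. By \<open>low\<close> each
  class other than 0 is a run s, s + 2g, ... of possibly zero length, to which
  \<open>off_diag_run\<close> applies; by \<open>edge\<close> the class 0 is empty. The lower ends
  multiply to the monomial of \<open>prod_boundary\<close>.\<close>

lemma prod_off_diag_runs:
  assumes low: "\<And>b. b < - 1 - int a \<Longrightarrow> b \<in> core_set g m"
    and edge: "vacancy m ((- 1 - int a) mod (2 * int g)) = - 1 - int a + 2 * int g"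
  shows "(\<Prod>h | 0 < h \<and> h - int a - 1 \<in> core_set g m. off_diag h) =
    - (w powi (- (2 * int g * (2 * int g - 1)))) *
    (\<Prod>r\<in>{0..<2 * int g} - {(- 1 - int a) mod (2 * int g)}.
       R (vacancy m r + int a + 1) / R (vacancy m r + int a + 1 - 2 * int g))"
proof -
  let ?n = "2 * int g"
  \<comment> \<open>\<open>v s\<close> is the least h congruent to s for which h - a - 1 is not
    occupied.\<close>
  define v where "v = (\<lambda>s. vacancy m ((s - int a - 1) mod ?n) + int a + 1)"
  have n: "0 < ?n" using g_pos by simp
  have vmod: "v s mod ?n = s mod ?n" for s
  proof -
    have "v s = ?n * level g m ((s - int a - 1) mod ?n) + ((s - int a - 1) mod ?n + int a + 1)"
      by (simp add: v_def vacancy_def)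
    then have "v s mod ?n = ((s - int a - 1) mod ?n + (int a + 1)) mod ?n"
      by (simp only: mod_mult_self4 add.assoc)
    also have "\<dots> = s mod ?n" by (simp add: mod_add_left_eq)
    finally show ?thesis .
  qed
  have v_iff: "h - int a - 1 \<in> core_set g m \<longleftrightarrow> h < v s" if "h mod ?n = s mod ?n" for h s
  proof -
    have "(h - int a - 1) mod ?n = (s - int a - 1) mod ?n" using mod_diff_cong[OF mod_diff_cong[OF that refl] refl] .
    then show ?thesis
      using vacancy_iff[OF pos_mod_sign[OF n] pos_mod_bound[OF n], of "h - int a - 1" "s - int a - 1" m]
      unfolding v_def by linarith
  qed
  define K where "K = (\<lambda>s. nat (v s div ?n))"
  have vK: "v s = s + ?n * int (K s)" if s: "s \<in> {1..<?n}" for s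
  proof -
    have "s - ?n - int a - 1 \<in> core_set g m" using low s by auto
    moreover have "(s - ?n) mod ?n = s mod ?n" using mod_mult_self1[of s "- 1" ?n] by simp
    ultimately have "s - ?n < v s" using v_iff by blast
    moreover have sm: "v s = ?n * (v s div ?n) + s" using vmod[of s] s mult_div_mod_eq[of ?n "v s"] by simp
    ultimately have "?n * (-1) < ?n * (v s div ?n)" by linarith
    then have "0 \<le> v s div ?n" using n by (simp only: mult_less_cancel_left_pos)
    then show ?thesis using sm by (simp add: K_def)
  qed
  have "{h. 0 < h \<and> h - int a - 1 \<in> core_set g m} = (\<Union>s\<in>{1..<?n}. (\<lambda>i. s + ?n * int i) ` {..<K s})"
  proof (intro equalityI subsetI)
    fix h assume h: "h \<in> {h. 0 < h \<and> h - int a - 1 \<in> core_set g m}"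
    define s where "s = h mod ?n"
    have hs: "h = s + ?n * (h div ?n)" by (simp add: s_def)
    \<comment> \<open>The first gap of class 0 is at h = 2g, so no positive multiple of 2g
      occurs.\<close>
    have "s \<noteq> 0"
    proof
      assume "s = 0"
      then have "h < v 0" using h v_iff[of h 0] by (simp add: s_def)
      moreover have "v 0 = ?n" using edge by (simp add: v_def diff_diff_eq add.commute)
      moreover have "h = ?n * (h div ?n)" using hs \<open>s = 0\<close> by simp
      ultimately have "?n * (h div ?n) < ?n * 1" "?n * 0 < ?n * (h div ?n)" using h by auto
      then show False using n by (simp only: mult_less_cancel_left_pos)
    qed
    then have s: "s \<in> {1..<?n}" using pos_mod_sign[OF n, of h] pos_mod_bound[OF n, of h] unfolding s_def by auto
    have "h < v s" using h v_iff[of h s] by (simp add: s_def)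
    then have "?n * (h div ?n) < ?n * int (K s)" using hs vK[OF s] by linarith
    then have "h div ?n < int (K s)" using n by (simp only: mult_less_cancel_left_pos)
    moreover have "0 \<le> h div ?n" using h n by (simp add: pos_imp_zdiv_nonneg_iff)
    ultimately have "h \<in> (\<lambda>i. s + ?n * int i) ` {..<K s}"
      using hs by (intro image_eqI[of _ _ "nat (h div ?n)"]) auto
    then show "h \<in> (\<Union>s\<in>{1..<?n}. (\<lambda>i. s + ?n * int i) ` {..<K s})" using s by blast
  next
    fix h assume "h \<in> (\<Union>s\<in>{1..<?n}. (\<lambda>i. s + ?n * int i) ` {..<K s})"
    then obtain s i where s: "s \<in> {1..<?n}" "i < K s" "h = s + ?n * int i" by auto
    have "?n * int i < ?n * int (K s)" using s(2) n by simp
    then have "h < v s" using s vK[OF s(1)] by linarith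
    moreover have "h mod ?n = s mod ?n" using s(3) by simp
    moreover have "0 \<le> ?n * int i" by simp
    then have "0 < h" using s(1,3) unfolding atLeastLessThan_iff by linarith
    ultimately show "h \<in> {h. 0 < h \<and> h - int a - 1 \<in> core_set g m}" using v_iff by blast
  qed
  then have "(\<Prod>h | 0 < h \<and> h - int a - 1 \<in> core_set g m. off_diag h) =
      (\<Prod>s\<in>{1..<?n}. \<Prod>h\<in>(\<lambda>i. s + ?n * int i) ` {..<K s}. off_diag h)"
  proof (simp only:, intro prod.UNION_disjoint ballI impI)
    fix s s' assume s: "s \<in> {1..<?n}" "s' \<in> {1..<?n}" "s \<noteq> s'"
    have res: "h mod ?n = s" if "h \<in> (\<lambda>i. s + ?n * int i) ` {..<K s}" "s \<in> {1..<?n}" for s h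
      using that by auto
    show "(\<lambda>i. s + ?n * int i) ` {..<K s} \<inter> (\<lambda>i. s' + ?n * int i) ` {..<K s'} = {}"
    proof (rule equals0I, elim IntE)
      fix h assume "h \<in> (\<lambda>i. s + ?n * int i) ` {..<K s}" "h \<in> (\<lambda>i. s' + ?n * int i) ` {..<K s'}"
      then have "h mod ?n = s" "h mod ?n = s'" using s(1,2) by (auto intro: res simp only:)
      then show False using s(3) by simp
    qed
  qed auto
  also have "\<dots> = (\<Prod>s\<in>{1..<?n}. R (v s) / R (v s - ?n) * (R (s - ?n) / R s))"
  proof (rule prod.cong[OF refl])
    fix s assume s: "s \<in> {1..<?n}"
    have "inj_on (\<lambda>i. s + ?n * int i) {..<K s}" using g_pos by (auto intro: inj_onI)
    then have "(\<Prod>h\<in>(\<lambda>i. s + ?n * int i) ` {..<K s}. off_diag h) = (\<Prod>i<K s. off_diag (s + ?n * int i))"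
      by (simp add: prod.reindex)
    then show "(\<Prod>h\<in>(\<lambda>i. s + ?n * int i) ` {..<K s}. off_diag h) = R (v s) / R (v s - ?n) * (R (s - ?n) / R s)"
      using s by (subst (asm) off_diag_run) (auto simp: vK)
  qed
  also have "\<dots> = (\<Prod>s\<in>{1..<?n}. R (v s) / R (v s - ?n)) * - (w powi (- (?n * (?n - 1))))"
    unfolding prod.distrib prod_boundary ..
  also have "(\<Prod>s\<in>{1..<?n}. R (v s) / R (v s - ?n)) =
    (\<Prod>r\<in>{0..<?n} - {(- 1 - int a) mod ?n}. R (vacancy m r + int a + 1) / R (vacancy m r + int a + 1 - ?n))"
  proof (rule prod.reindex_bij_witness[of _ "\<lambda>r. (r + int a + 1) mod ?n" "\<lambda>s. (s - int a - 1) mod ?n"], goal_cases)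
    case (1 s)
    have "((s - int a - 1) mod ?n + (int a + 1)) mod ?n = s mod ?n" by (simp add: mod_add_left_eq)
    then show ?case using 1 by (simp add: add.assoc)
  next
    case (2 s)
    have "(s - int a - 1) mod ?n \<noteq> (- 1 - int a) mod ?n"
    proof
      assume "(s - int a - 1) mod ?n = (- 1 - int a) mod ?n"
      then have "(s - int a - 1 + (int a + 1)) mod ?n = (- 1 - int a + (int a + 1)) mod ?n"
        by (rule mod_add_cong[OF _ refl])
      then show False using 2 by simp
    qed
    then show ?case using n by simp
  next
    case (3 r)
    have "((r + int a + 1) mod ?n - (int a + 1)) mod ?n = r mod ?n" by (simp add: mod_diff_left_eq)
    then show ?case using 3 by (simp add: diff_diff_eq)
  next
    case (4 r)
    have "(r + int a + 1) mod ?n \<noteq> 0"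
    proof
      assume "(r + int a + 1) mod ?n = 0"
      then have "(r + int a + 1) mod ?n = 0 mod ?n" by simp
      then have "(r + int a + 1 - (int a + 1)) mod ?n = (0 - (int a + 1)) mod ?n"
        by (rule mod_diff_cong[OF _ refl])
      then show False using 4 by (simp add: algebra_simps)
    qed
    then show ?case using pos_mod_sign[OF n, of "r + int a + 1"] pos_mod_bound[OF n, of "r + int a + 1"] by auto
  next
    case (5 s)
    then show ?case by (simp add: v_def)
  qed
  finally show ?thesis by simp
qed

end

section \<open>Change of the Weyl denominator when one coordinate moves\<close>

definition weyl_pair :: "'a::field \<Rightarrow> 'a \<Rightarrow> 'a" where
  "weyl_pair y z = y + inverse y - z - inverse z"

lemma prod_pairs_through:
  assumes "l < g"
  shows "(\<Prod>p\<in>pairs g. if fst p = l \<or> snd p = l then h p else (1 :: 'a::comm_monoid_mult)) =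
         (\<Prod>i\<in>{..<g} - {l}. h (min i l, max i l))"
proof -
  have "(\<Prod>p\<in>pairs g. if fst p = l \<or> snd p = l then h p else 1) =
        prod h {p \<in> pairs g. fst p = l \<or> snd p = l}"
    by (subst prod.inter_filter) auto
  also have "\<dots> = (\<Prod>i\<in>{..<g} - {l}. h (min i l, max i l))"
    by (rule prod.reindex_bij_witness[of _ "\<lambda>i. (min i l, max i l)" "\<lambda>(i, j). if i = l then j else i"])
       (use assms in \<open>auto simp: pairs_def min_def max_def split: if_splits\<close>)
  finally show ?thesis .
qed

text \<open>The pairs through \<open>l\<close> are turned so that x_l comes first. The signs that
  this costs depend only on the positions, so they cancel when two values of x_l are
  compared.\<close>

lemma weyl_split:
  assumes l: "l < g"
  shows "weyl g x = (1 + x l) * (\<Prod>i\<in>{..<g} - {l}. weyl_pair (x l) (x i)) *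
    ((\<Prod>i\<in>{..<g} - {l}. (1 + x i) * (if l < i then 1 else -1)) *
     (\<Prod>p\<in>{p \<in> pairs g. fst p \<noteq> l \<and> snd p \<noteq> l}. weyl_pair (x (fst p)) (x (snd p))))"
proof -
  let ?h = "\<lambda>p. weyl_pair (x (fst p)) (x (snd p))"
  have "(\<Prod>p\<in>pairs g. ?h p) =
    (\<Prod>p\<in>pairs g. (if fst p = l \<or> snd p = l then ?h p else 1) * (if fst p \<noteq> l \<and> snd p \<noteq> l then ?h p else 1))"
    by (rule prod.cong) auto
  also have "\<dots> = (\<Prod>i\<in>{..<g} - {l}. ?h (min i l, max i l)) * (\<Prod>p\<in>{p \<in> pairs g. fst p \<noteq> l \<and> snd p \<noteq> l}. ?h p)"
    unfolding prod.distrib prod_pairs_through[OF l] by (simp only: prod.inter_filter[OF finite_pairs])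
  also have "(\<Prod>i\<in>{..<g} - {l}. ?h (min i l, max i l)) =
     (\<Prod>i\<in>{..<g} - {l}. weyl_pair (x l) (x i) * (if l < i then 1 else -1))"
    by (rule prod.cong) (auto simp: weyl_pair_def min_def max_def algebra_simps)
  finally have pairs: "(\<Prod>(i, j)\<in>pairs g. x i + inverse (x i) - x j - inverse (x j)) =
     (\<Prod>i\<in>{..<g} - {l}. weyl_pair (x l) (x i)) * (\<Prod>i\<in>{..<g} - {l}. if l < i then 1 else -1) *
     (\<Prod>p\<in>{p \<in> pairs g. fst p \<noteq> l \<and> snd p \<noteq> l}. ?h p)"
    by (simp add: prod.distrib case_prod_beta weyl_pair_def)
  have "(\<Prod>i<g. 1 + x i) = (1 + x l) * (\<Prod>i\<in>{..<g} - {l}. 1 + x i)"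
    using l by (intro prod.remove) auto
  then show ?thesis unfolding weyl_def pairs by (simp add: prod.distrib mult_ac)
qed

lemma weyl_update:
  assumes l: "l < g" and same: "\<And>i. i < g \<Longrightarrow> i \<noteq> l \<Longrightarrow> x' i = x i"
    and one: "1 + x l = \<alpha> * (1 + x' l)"
    and pair: "\<And>i. i < g \<Longrightarrow> i \<noteq> l \<Longrightarrow> weyl_pair (x l) (x i) = \<beta> i * weyl_pair (x' l) (x i)"
  shows "weyl g x = \<alpha> * (\<Prod>i\<in>{..<g} - {l}. \<beta> i) * weyl g x'"
proof -
  have 1: "(\<Prod>i\<in>{..<g} - {l}. weyl_pair (x l) (x i)) = (\<Prod>i\<in>{..<g} - {l}. \<beta> i) * (\<Prod>i\<in>{..<g} - {l}. weyl_pair (x' l) (x' i))"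
    unfolding prod.distrib[symmetric] by (rule prod.cong) (auto simp: same pair)
  have 2: "(\<Prod>i\<in>{..<g} - {l}. (1 + x i) * (if l < i then 1 else -1)) = (\<Prod>i\<in>{..<g} - {l}. (1 + x' i) * (if l < i then 1 else -1))"
    by (rule prod.cong) (auto simp: same)
  have 3: "(\<Prod>p\<in>{p \<in> pairs g. fst p \<noteq> l \<and> snd p \<noteq> l}. weyl_pair (x (fst p)) (x (snd p))) =
    (\<Prod>p\<in>{p \<in> pairs g. fst p \<noteq> l \<and> snd p \<noteq> l}. weyl_pair (x' (fst p)) (x' (snd p)))"
    by (rule prod.cong) (auto simp: same pairs_def)
  show ?thesis unfolding weyl_split[OF l, of x] weyl_split[OF l, of x'] 1 2 3 one by (simp add: mult_ac)
qed

lemma weyl_pair_inverse [simp]: "weyl_pair (inverse y) z = weyl_pair y z"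
  by (simp add: weyl_pair_def)

context principal
begin

lemma weyl_pair_powi:
  "weyl_pair (w powi k) (w powi l) = w powi (- k) * ((1 - w powi (k + l)) * (1 - w powi (k - l)))"
proof -
  have "w powi (k - l) = w powi k / w powi l" "w powi (- k) = inverse (w powi k)"
    using w_nonzero by (simp_all add: power_int_diff power_int_minus)
  moreover have "weyl_pair y z = inverse y * ((1 - y * z) * (1 - y / z))" if "y \<noteq> 0" "z \<noteq> 0" for y z :: 'a
    using that by (simp add: weyl_pair_def field_simps)
  from this[OF w_powi_nonzero w_powi_nonzero] have "weyl_pair (w powi k) (w powi l) =
    inverse (w powi k) * ((1 - w powi k * w powi l) * (1 - w powi k / w powi l))" .
  ultimately show ?thesis by (simp only: w_add)
qed

text \<open>A factor \<open>weyl_pair\<close> is invariant under inverting its first argument, so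
  both directions of the move reduce to a charge M that drops by 4g. The monomials of the g - 1
  pairs, of the short factor and of \<open>core_value\<close> combine to one that depends on g
  alone.\<close>

lemma core_value_ratio:
  assumes l: "l < g" and m': "m' = m(l := m l - \<epsilon>)" and \<epsilon>: "\<epsilon> = 1 \<or> \<epsilon> = -1"
    and M: "M = \<epsilon> * charge g m l"
  shows "core_value g w m = w powi (- (2 * int g * (2 * int g - 1))) *
    ((1 + w powi M) / (1 + w powi (M - 4 * int g))) *
    (\<Prod>i\<in>{..<g} - {l}. (1 - w powi (M + charge g m i)) * (1 - w powi (M - charge g m i)) /
       ((1 - w powi (M + charge g m i - 4 * int g)) * (1 - w powi (M - charge g m i - 4 * int g)))) *
    core_value g w m'"
proof -
  define n where "n = 4 * int g"
  define x where "x = (\<lambda>i. w powi charge g m i)"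
  define x' where "x' = (\<lambda>i. w powi charge g m' i)"
  have oddM: "odd M" "odd (M - n)" using \<epsilon> by (auto simp: M charge_def n_def)
  have charge_l: "charge g m' l = charge g m l - \<epsilon> * n" by (simp add: charge_def m' n_def algebra_simps)
  have charge_i: "charge g m' i = charge g m i" if "i \<noteq> l" for i using that by (simp add: charge_def m')
  have nz: "1 + w powi (M - n) \<noteq> 0" using oddM by (intro one_plus_odd)
  \<comment> \<open>For \<epsilon> = -1 the charge is - M, and 1 + w^(-M) = w^(-M) (1 + w^M)
    accounts for the extra power of w.\<close>
  define \<alpha> where "\<alpha> = w powi (if \<epsilon> = 1 then 0 else - n) * ((1 + w powi M) / (1 + w powi (M - n)))"
  define \<beta> where "\<beta> = (\<lambda>i. w powi (- n) * ((1 - w powi (M + charge g m i)) * (1 - w powi (M - charge g m i)) /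
       ((1 - w powi (M + charge g m i - n)) * (1 - w powi (M - charge g m i - n)))))"
  have W: "weyl g x = \<alpha> * (\<Prod>i\<in>{..<g} - {l}. \<beta> i) * weyl g x'"
  proof (rule weyl_update[OF l])
    show "x' i = x i" if "i < g" "i \<noteq> l" for i using that by (simp add: x_def x'_def charge_i)
    show "1 + x l = \<alpha> * (1 + x' l)"
    proof (cases "\<epsilon> = 1")
      case True
      then show ?thesis using nz by (simp add: \<alpha>_def x_def x'_def charge_l M)
    next
      case False
      then have e: "charge g m l = - M" "charge g m' l = - (M - n)" using \<epsilon> by (auto simp: M charge_l)
      have 1: "1 + w powi (- k) = w powi (- k) * (1 + w powi k)" for k by (simp add: distrib_left flip: w_add)
      have 2: "w powi (- n) * w powi (- (M - n)) = w powi (- M)" by (simp flip: w_add)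
      have "\<alpha> * (1 + x' l) = (w powi (- n) * w powi (- (M - n))) * ((1 + w powi M) / (1 + w powi (M - n)) * (1 + w powi (M - n)))"
        using False unfolding \<alpha>_def x'_def e 1 by (simp add: mult_ac)
      also have "\<dots> = w powi (- M) * (1 + w powi M)" unfolding 2 using nz by simp
      finally show ?thesis unfolding x_def e 1 by simp
    qed
    fix i assume i: "i < g" "i \<noteq> l"
    have pm: "weyl_pair (x l) (x i) = weyl_pair (w powi M) (x i)" "weyl_pair (x' l) (x i) = weyl_pair (w powi (M - n)) (x i)"
    proof -
      have "charge g m l = \<epsilon> * M" "charge g m' l = \<epsilon> * (M - n)" using \<epsilon> by (auto simp: M charge_l)
      moreover have "weyl_pair (w powi (\<epsilon> * k)) z = weyl_pair (w powi k) z" for k z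
        using \<epsilon> by (auto simp: power_int_minus)
      ultimately show "weyl_pair (x l) (x i) = weyl_pair (w powi M) (x i)" "weyl_pair (x' l) (x i) = weyl_pair (w powi (M - n)) (x i)"
        by (simp_all only: x_def x'_def)
    qed
    \<comment> \<open>Up to multiples of 4g these numbers are twice an integer that is nonzero and
      smaller than 2g in absolute value, because l and i are distinct and below g.\<close>
    have ne: "M + charge g m i - n \<noteq> 0" "M - charge g m i - n \<noteq> 0"
    proof -
      have "\<not> 4 * int g dvd 2 * k" if "k \<noteq> 0" "\<bar>k\<bar> < 2 * int g" for k
      proof
        assume "4 * int g dvd 2 * k"
        then have "2 * (2 * int g) dvd 2 * k" by simp
        then have "2 * int g dvd k" by (subst (asm) dvd_mult_cancel_left) simp
        then have "\<bar>2 * int g\<bar> \<le> \<bar>k\<bar>" using that(1) by (intro dvd_imp_le_int)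
        then show False using that(2) by simp
      qed
      note dv = this
      have dvd_summand: "4 * int g dvd y" if "4 * int g * c + y = 0" for c y
      proof
        show "y = 4 * int g * (- c)" using that by simp
      qed
      have 1: "M + charge g m i - n = 4 * int g * (\<epsilon> * m l + m i - 1) + 2 * (if \<epsilon> = 1 then int l + int i + 1 else int i - int l)"
        "M - charge g m i - n = 4 * int g * (\<epsilon> * m l - m i - 1) + 2 * (if \<epsilon> = 1 then int l - int i else - int i - int l - 1)"
        using \<epsilon> by (auto simp: M charge_def n_def algebra_simps)
      show "M + charge g m i - n \<noteq> 0"
      proof
        assume "M + charge g m i - n = 0"
        then have "4 * int g dvd 2 * (if \<epsilon> = 1 then int l + int i + 1 else int i - int l)"
          unfolding 1 by (rule dvd_summand)
        moreover have "(if \<epsilon> = 1 then int l + int i + 1 else int i - int l) \<noteq> 0" "\<bar>if \<epsilon> = 1 then int l + int i + 1 else int i - int l\<bar> < 2 * int g"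
          using i l by (cases "\<epsilon> = 1"; simp; arith)+
        ultimately show False using dv by blast
      qed
      show "M - charge g m i - n \<noteq> 0"
      proof
        assume "M - charge g m i - n = 0"
        then have "4 * int g dvd 2 * (if \<epsilon> = 1 then int l - int i else - int i - int l - 1)"
          unfolding 1 by (rule dvd_summand)
        moreover have "(if \<epsilon> = 1 then int l - int i else - int i - int l - 1) \<noteq> 0" "\<bar>if \<epsilon> = 1 then int l - int i else - int i - int l - 1\<bar> < 2 * int g"
          using i l by (cases "\<epsilon> = 1"; simp; arith)+
        ultimately show False using dv by blast
      qed
    qed
    have nz1: "1 - w powi (M + charge g m i - n) \<noteq> 0" "1 - w powi (M - charge g m i - n) \<noteq> 0"
      using w_generic[OF ne(1)] w_generic[OF ne(2)] by simp_all
    have sh: "M - n + charge g m i = M + charge g m i - n" "M - n - charge g m i = M - charge g m i - n" by simp_all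
    have xi: "x i = w powi charge g m i" by (simp add: x_def)
    define A B A' B' where "A = 1 - w powi (M + charge g m i)" and "B = 1 - w powi (M - charge g m i)"
      and "A' = 1 - w powi (M + charge g m i - n)" and "B' = 1 - w powi (M - charge g m i - n)"
    have p1: "weyl_pair (x l) (x i) = w powi (- M) * (A * B)"
      unfolding pm(1) unfolding xi weyl_pair_powi A_def B_def by (rule refl)
    have p2: "weyl_pair (x' l) (x i) = w powi (- (M - n)) * (A' * B')"
      unfolding pm(2) unfolding xi weyl_pair_powi A'_def B'_def sh by (rule refl)
    have nz2: "A' * B' \<noteq> 0" using nz1 by (simp add: A'_def B'_def)
    have "\<beta> i * weyl_pair (x' l) (x i) = (w powi (- n) * w powi (- (M - n))) * (A * B / (A' * B') * (A' * B'))"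
      unfolding p2 \<beta>_def A_def B_def A'_def B'_def by (simp only: mult_ac)
    also have "w powi (- n) * w powi (- (M - n)) = w powi (- M)" by (simp flip: w_add)
    also have "A * B / (A' * B') * (A' * B') = A * B" using nz2 by simp
    finally show "weyl_pair (x l) (x i) = \<beta> i * weyl_pair (x' l) (x i)"
      unfolding p1 by (rule sym)
  qed
  have E: "w powi (- 2 * int g * (\<Sum>i<g. m i)) * (\<alpha> * (\<Prod>i\<in>{..<g} - {l}. \<beta> i)) =
     w powi (- (2 * int g * (2 * int g - 1))) * ((1 + w powi M) / (1 + w powi (M - n))) *
     (\<Prod>i\<in>{..<g} - {l}. (1 - w powi (M + charge g m i)) * (1 - w powi (M - charge g m i)) /
       ((1 - w powi (M + charge g m i - n)) * (1 - w powi (M - charge g m i - n)))) * w powi (- 2 * int g * (\<Sum>i<g. m' i))"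
  proof -
    have card: "card ({..<g} - {l}) = g - 1" using l by simp
    have P1: "(\<Prod>i\<in>{..<g} - {l}. w powi (- n)) = w powi (- (n * int (g - 1)))"
      by (simp add: card power_int_mult[symmetric] flip: power_int_of_nat)
    have P2: "(\<Sum>i<g. m' i) = (\<Sum>i<g. m i) - \<epsilon>"
    proof -
      have "(\<Sum>i<g. m' i) = (m l - \<epsilon>) + (\<Sum>i\<in>{..<g} - {l}. m i)"
        using l by (subst sum.remove[of _ l]) (auto simp: m' intro!: sum.cong)
      moreover have "(\<Sum>i<g. m i) = m l + (\<Sum>i\<in>{..<g} - {l}. m i)"
        using l by (subst sum.remove[of _ l]) auto
      ultimately show ?thesis by simp
    qed
    have P3: "w powi (- 2 * int g * (\<Sum>i<g. m i)) * (w powi (if \<epsilon> = 1 then 0 else - n) * w powi (- (n * int (g - 1)))) =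
      w powi (- (2 * int g * (2 * int g - 1))) * w powi (- 2 * int g * ((\<Sum>i<g. m i) - \<epsilon>))"
    proof -
      have "int (g - 1) = int g - 1" using g_pos by simp
      then have "- 2 * int g * (\<Sum>i<g. m i) + ((if \<epsilon> = 1 then 0 else - n) + (- (n * int (g - 1)))) =
        - (2 * int g * (2 * int g - 1)) + (- 2 * int g * ((\<Sum>i<g. m i) - \<epsilon>))"
        using \<epsilon> by (auto simp: n_def algebra_simps)
      then show ?thesis by (simp only: w_add[symmetric])
    qed
    show ?thesis
      unfolding \<alpha>_def \<beta>_def prod.distrib P1 P2
      using arg_cong[OF P3, of "\<lambda>z. z * ((1 + w powi M) / (1 + w powi (M - n)) *
        (\<Prod>i\<in>{..<g} - {l}. (1 - w powi (M + charge g m i)) * (1 - w powi (M - charge g m i)) /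
         ((1 - w powi (M + charge g m i - n)) * (1 - w powi (M - charge g m i - n)))))"]
      by (simp only: mult_ac)
  qed
  show ?thesis
    unfolding core_value_def x_def[symmetric] x'_def[symmetric] n_def[symmetric] W
    using arg_cong[OF E, of "\<lambda>z. z * weyl g x'"] by (simp only: mult_ac)
qed

text \<open>Removing the largest bead strips off the outermost principal hook and moves one lattice
  coordinate a step towards 0. The weight and the core value change by the same ratio up to a sign,
  and this sign is what the factor (-1)^d supplies.\<close>

lemma core_step:
  assumes m: "m \<in> restricted g" and ne: "core_beads g m \<noteq> {}"
  obtains m' a \<rho> where "m' \<in> restricted g" "a \<notin> core_beads g m'" "core_beads g m = insert a (core_beads g m')"
    "total_energy g m = total_energy g m' + 2 * int a + 1"
    "weight (core_set g m) = - \<rho> * weight (core_set g m')" "core_value g w m = \<rho> * core_value g w m'"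
proof -
  let ?n = "2 * int g"
  define a where "a = Max (core_beads g m)"
  have fin: "finite (core_beads g m)" by (rule finite_core_beads[OF g_pos])
  have aS: "int a \<in> core_set g m" using Max_in[OF fin ne] by (simp add: a_def core_beads_def)
  have a_max: "b \<le> int a" if "b \<in> core_set g m" for b
  proof (cases "b \<ge> 0")
    case True
    then have "nat b \<in> core_beads g m" using that by (simp add: core_beads_def)
    then have "nat b \<le> a" unfolding a_def using fin by (intro Max_ge)
    then show ?thesis using True by linarith
  qed simp
  define r where "r = int a mod ?n"
  define k where "k = int a div ?n"
  have r: "0 \<le> r" "r < ?n" using g_pos by (simp_all add: r_def)
  have ak: "int a = ?n * k + r" by (simp add: r_def k_def)
  have "k < level g m r" using aS core_set_iff[OF r, of k m] ak by simp
  moreover have "\<not> k + 1 < level g m r"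
  proof
    assume "k + 1 < level g m r"
    then have "?n * (k + 1) + r \<in> core_set g m" using core_set_iff[OF r] by simp
    from a_max[OF this] show False using ak g_pos by (simp add: algebra_simps)
  qed
  ultimately have lev: "level g m r = k + 1" by linarith
  \<comment> \<open>The class of the largest bead belongs to coordinate \<open>l\<close>: directly
    for residues from g on, through the mirror with opposite level below g.\<close>
  define \<epsilon> :: int where "\<epsilon> = (if r \<ge> int g then 1 else -1)"
  define l where "l = (if r \<ge> int g then nat (r - int g) else nat (int g - 1 - r))"
  have l: "l < g" using r by (auto simp: l_def)
  have rl: "r = (if \<epsilon> = 1 then int g + int l else int g - 1 - int l)" using r by (auto simp: \<epsilon>_def l_def)
  have ml: "m l = \<epsilon> * (k + 1)" using lev by (auto simp: level_def \<epsilon>_def l_def)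
  have \<epsilon>: "\<epsilon> = 1 \<or> \<epsilon> = -1" by (simp add: \<epsilon>_def)
  define m' where "m' = m(l := m l - \<epsilon>)"
  have mr: "m' \<in> restricted g" using m l by (auto simp: m'_def restricted_def)
  have rr: "r \<noteq> ?n - 1 - r" by presburger
  have lev': "level g m' s = (if s = r then k else if s = ?n - 1 - r then - k else level g m s)" if s: "0 \<le> s" "s < ?n" for s
  proof -
    have "level g m' s = level g m s - (if s = int g + int l then \<epsilon> else 0) + (if s = int g - 1 - int l then \<epsilon> else 0)"
    proof (cases "s \<ge> int g")
      case True
      then have "nat (s - int g) = l \<longleftrightarrow> s = int g + int l" by linarith
      then show ?thesis using True by (simp add: level_def m'_def)
    next
      case False
      then have "nat (int g - 1 - s) = l \<longleftrightarrow> s = int g - 1 - int l" by linarith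
      then show ?thesis using False by (simp add: level_def m'_def)
    qed
    moreover have "level g m (?n - 1 - r) = - (k + 1)" using level_mirror[of g m r] lev by simp
    moreover have "?n - 1 - r = (if \<epsilon> = 1 then int g - 1 - int l else int g + int l)" using rl \<epsilon> by auto
    ultimately show ?thesis using rl lev \<epsilon> rr by (cases "\<epsilon> = 1") auto
  qed
  have mirror: "(- 1 - int a) div ?n = - 1 - k" "(- 1 - int a) mod ?n = ?n - 1 - r"
    using div_mod_mirror[OF g_pos, of "int a"] by (simp_all add: k_def r_def)
  have in_iff: "b \<in> core_set g m' \<longleftrightarrow> b \<noteq> int a \<and> (b \<in> core_set g m \<or> b = - 1 - int a)" for b
  proof -
    define j s where "j = b div ?n" and "s = b mod ?n"
    have s: "0 \<le> s" "s < ?n" using g_pos by (simp_all add: s_def)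
    have b: "b = ?n * j + s" by (simp add: j_def s_def)
    have uniq: "b = ?n * j' + s' \<longleftrightarrow> j = j' \<and> s = s'" if "0 \<le> s'" "s' < ?n" for j' s'
    proof
      assume "b = ?n * j' + s'"
      then show "j = j' \<and> s = s'" using that g_pos by (simp add: j_def s_def)
    qed (simp add: b)
    have eq1: "b = int a \<longleftrightarrow> j = k \<and> s = r" using uniq[OF r, of k] ak by simp
    have "- 1 - int a = ?n * (- 1 - k) + (?n - 1 - r)" using ak by (simp add: algebra_simps)
    then have eq2: "b = - 1 - int a \<longleftrightarrow> j = - 1 - k \<and> s = ?n - 1 - r"
      by (simp only:) (rule uniq; use r in simp)
    have lev2: "level g m (?n - 1 - r) = - k - 1" using level_mirror[of g m r] lev by simp
    have "b \<in> core_set g m' \<longleftrightarrow> j < level g m' s" "b \<in> core_set g m \<longleftrightarrow> j < level g m s"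
      using core_set_iff[OF s] b by simp_all
    then show ?thesis unfolding eq1 eq2 lev'[OF s] using lev lev2 rr by (cases "s = r"; cases "s = ?n - 1 - r") auto
  qed
  have a_notin: "int a \<notin> core_set g m'" by (simp add: in_iff)
  have S_eq: "core_set g m = insert (int a) (core_set g m' - {- 1 - int a})"
    using aS core_set_mirror[OF g_pos, of "int a" m] by (auto simp: in_iff)
  have low: "b \<in> core_set g m'" if "b < - 1 - int a" for b
  proof -
    have "- 1 - b \<notin> core_set g m" using a_max[of "- 1 - b"] that by auto
    then have "b \<in> core_set g m" using core_set_mirror[OF g_pos, of b m] by simp
    then show ?thesis using that by (simp add: in_iff)
  qed
  have "- 1 - int a \<in> core_set g m'" by (simp add: in_iff) 
  have beads: "core_beads g m = insert a (core_beads g m')"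
    using S_eq by (auto simp: core_beads_def)
  have edge: "vacancy m' ((- 1 - int a) mod ?n) = - 1 - int a + ?n"
    unfolding mirror vacancy_def using lev'[of "?n - 1 - r"] r rr ak by (simp add: algebra_simps)
  \<comment> \<open>Chosen so that 2 a + 1 - 2g and 2 a + 1 + 2g, the exponents in
    \<open>on_diag\<close>, are M - 4g and M.\<close>
  define M where "M = 2 * int a + 1 + ?n"
  have M: "M = \<epsilon> * charge g m l" using \<epsilon> ak rl unfolding M_def charge_def ml by (auto simp: algebra_simps)
  define X where "X = (\<lambda>y. R (y + int a + 1) / R (y + int a + 1 - ?n))"
  have Rv: "R (y + int a + 1) = 1 - w powi (M + (2 * y + 1 - ?n))"
    "R (y + int a + 1 - ?n) = 1 - w powi (M + (2 * y + 1 - ?n) - 4 * int g)" for y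
    by (simp_all add: R_def M_def algebra_simps)
  have vac_r: "vacancy m' r = int a" using lev'[OF r] ak by (simp add: vacancy_def)
  have "(\<Prod>s\<in>{0..<?n} - {(- 1 - int a) mod ?n}. X (vacancy m' s)) =
     X (int a) * (\<Prod>s\<in>{0..<?n} - {?n - 1 - r} - {r}. X (vacancy m' s))"
    unfolding mirror using r rr by (subst prod.remove[of _ r]) (auto simp: vac_r)
  \<comment> \<open>The remaining classes are paired as g + i and g - 1 - i; their opposite levels
    give the factors with + and - the charge of i.\<close>
  also have "(\<Prod>s\<in>{0..<?n} - {?n - 1 - r} - {r}. X (vacancy m' s)) =
     (\<Prod>(i, e)\<in>({..<g} - {l}) \<times> UNIV. X (vacancy m' (if e then int g + int i else int g - 1 - int i)))"
    by (rule prod.reindex_bij_witness[of _ "\<lambda>(i, e). if e then int g + int i else int g - 1 - int i"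
        "\<lambda>s. if s \<ge> int g then (nat (s - int g), True) else (nat (int g - 1 - s), False)"])
       (use rl r \<epsilon> l in \<open>auto split: if_splits\<close>)
  also have "\<dots> = (\<Prod>i\<in>{..<g} - {l}. X (vacancy m' (int g + int i)) * X (vacancy m' (int g - 1 - int i)))"
    by (simp add: prod.cartesian_product[symmetric] UNIV_bool mult.commute)
  also have "\<dots> = (\<Prod>i\<in>{..<g} - {l}. (1 - w powi (M + charge g m i)) * (1 - w powi (M - charge g m i)) /
       ((1 - w powi (M + charge g m i - 4 * int g)) * (1 - w powi (M - charge g m i - 4 * int g))))"
  proof (rule prod.cong[OF refl])
    fix i assume i: "i \<in> {..<g} - {l}"
    have levs: "level g m' (int g + int i) = m i" "level g m' (int g - 1 - int i) = - m i"
      using i level_simps(2)[of i g m'] by (auto simp: level_simps(1) m'_def)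
    have 1: "2 * vacancy m' (int g + int i) + 1 - ?n = charge g m i"
      unfolding vacancy_def levs charge_def by (simp add: algebra_simps)
    have 2: "2 * vacancy m' (int g - 1 - int i) + 1 - ?n = - charge g m i"
      unfolding vacancy_def levs charge_def by (simp add: algebra_simps)
    show "X (vacancy m' (int g + int i)) * X (vacancy m' (int g - 1 - int i)) =
      (1 - w powi (M + charge g m i)) * (1 - w powi (M - charge g m i)) /
       ((1 - w powi (M + charge g m i - 4 * int g)) * (1 - w powi (M - charge g m i - 4 * int g)))"
      unfolding X_def Rv 1 2 by simp
  qed
  finally have prodX: "(\<Prod>s\<in>{0..<?n} - {(- 1 - int a) mod ?n}. X (vacancy m' s)) = X (int a) * \<dots>" .
  define P where "P = (\<Prod>i\<in>{..<g} - {l}. (1 - w powi (M + charge g m i)) * (1 - w powi (M - charge g m i)) /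
       ((1 - w powi (M + charge g m i - 4 * int g)) * (1 - w powi (M - charge g m i - 4 * int g))))"
  define \<rho> where "\<rho> = w powi (- (?n * (?n - 1))) * ((1 + w powi M) / (1 + w powi (M - 4 * int g))) * P"
  \<comment> \<open>The class of the removed bead has its vacancy at \<open>a\<close> itself, so its
    numerator cancels the denominator of \<open>on_diag\<close>, and 1 - w^(M - 4g) cancels out of
    the difference of squares.\<close>
  have D: "on_diag (2 * int a + 1) * X (int a) = (1 + w powi M) / (1 + w powi (M - 4 * int g))"
  proof -
    have e: "2 * int a + 1 - ?n = M - 4 * int g" "2 * int a + 1 + ?n = M" "int a + int a + 1 = 2 * int a + 1"
      "int a + int a + 1 - ?n = M - 4 * int g" by (simp_all add: M_def)
    have odd: "odd (M - 4 * int g)" by (simp add: M_def)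
    have sq: "R (M - 4 * int g) = (1 - w powi (M - 4 * int g)) * (1 + w powi (M - 4 * int g))"
    proof -
      have "w powi (2 * y) = w powi y * w powi y" for y by (simp only: mult_2 w_add)
      then show ?thesis by (simp only: R_def) (simp add: algebra_simps)
    qed
    show ?thesis
      unfolding on_diag_def X_def e sq using one_minus_odd[OF odd] one_plus_odd[OF odd] by simp
  qed
  have WT: "weight (core_set g m) = weight (core_set g m') * on_diag (2 * int a + 1) *
      (\<Prod>h | 0 < h \<and> h - int a - 1 \<in> core_set g m'. off_diag h)"
  proof (rule weight_remove_top[OF S_eq a_notin])
    show "- 1 - int a \<in> core_set g m'" by fact
    show "finite (maya_pairs (core_set g m))" "finite (core_set g m \<inter> {0..})"
      using finite_maya_pairs[OF fin] maya_Int_nonneg[of "core_beads g m"] fin by (simp_all add: maya_core_beads[OF g_pos])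
    show "b < int a" if "b \<in> core_set g m'" for b using that a_max[of b] by (auto simp: in_iff order.order_iff_strict)
  qed
  have RN: "(\<Prod>h | 0 < h \<and> h - int a - 1 \<in> core_set g m'. off_diag h) = - (w powi (- (?n * (?n - 1)))) * (X (int a) * P)"
    using prod_off_diag_runs[OF low edge] prodX unfolding X_def P_def by simp
  have "weight (core_set g m) = - \<rho> * weight (core_set g m')"
    unfolding WT RN \<rho>_def D[symmetric] by (simp only: mult_minus_left mult_minus_right mult_ac)
  moreover have "core_value g w m = \<rho> * core_value g w m'"
    using core_value_ratio[OF l m'_def \<epsilon> M] unfolding \<rho>_def P_def by simp
  moreover have "total_energy g m = total_energy g m' + 2 * int a + 1"
  proof -
    have "total_energy g m = energy g l (m l) + (\<Sum>j\<in>{..<g} - {l}. energy g j (m j))"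
      unfolding total_energy_def using l by (intro sum.remove) auto
    moreover have "total_energy g m' = energy g l (m l - \<epsilon>) + (\<Sum>j\<in>{..<g} - {l}. energy g j (m j))"
      unfolding total_energy_def using l by (subst sum.remove[of _ l]) (auto simp: m'_def intro!: sum.cong)
    moreover have "energy g l (m l) = energy g l (m l - \<epsilon>) + 2 * int a + 1"
      using \<epsilon> rl unfolding ml ak energy_def by (auto simp: power2_eq_square algebra_simps)
    ultimately show ?thesis by simp
  qed
  ultimately show thesis using that mr beads a_notin by (auto simp: core_beads_def)
qed

text \<open>Induction over the beads by \<open>core_step\<close>. The core value of 0 is the
  normalisation, since the empty partition has weight 1.\<close>

lemma core_weight_energy:
  assumes "m \<in> restricted g"
  shows "(- 1) ^ card (core_beads g m) * weight (core_set g m) * core_value g w 0 = core_value g w m \<and>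
    (\<Sum>a\<in>core_beads g m. 2 * int a + 1) = total_energy g m"
  using assms
proof (induction "card (core_beads g m)" arbitrary: m)
  case 0
  have empty: "core_beads g m = {}" using 0 finite_core_beads[OF g_pos] by simp
  have zero: "core_beads g 0 = {}" using g_pos by (auto simp: core_beads_def core_set_def level_def not_less pos_imp_zdiv_nonneg_iff)
  have "(0 :: nat \<Rightarrow> int) \<in> restricted g" by (simp add: restricted_def)
  then have m0: "m = 0" using core_beads_inj[OF g_pos] 0(2) empty zero by (metis inj_onD)
  have "core_set g 0 = maya {}" using zero maya_core_beads[OF g_pos, of 0] by simp
  moreover have "maya_pairs (maya {}) = {}" "maya {} \<inter> {0..} = {}" by (auto simp: maya_pairs_def maya_def split: if_splits)
  ultimately have "weight (core_set g 0) = 1" by (simp add: maya_prod_def)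
  then show ?case unfolding m0 zero by (simp add: total_energy_def energy_def flip: zero_fun_def)
next
  case (Suc n)
  have ne: "core_beads g m \<noteq> {}" using Suc(2) by auto
  obtain m' a \<rho> where s: "m' \<in> restricted g" "a \<notin> core_beads g m'" "core_beads g m = insert a (core_beads g m')"
    "total_energy g m = total_energy g m' + 2 * int a + 1"
    "weight (core_set g m) = - \<rho> * weight (core_set g m')" "core_value g w m = \<rho> * core_value g w m'"
    using core_step[OF Suc(3) ne] by blast
  have fin': "finite (core_beads g m')" by (rule finite_core_beads[OF g_pos])
  have card: "card (core_beads g m) = Suc (card (core_beads g m'))" using s fin' by simp
  then have n: "n = card (core_beads g m')" using Suc(2) by simp
  have IH: "(- 1) ^ card (core_beads g m') * weight (core_set g m') * core_value g w 0 = core_value g w m'"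
    "(\<Sum>a\<in>core_beads g m'. 2 * int a + 1) = total_energy g m'"
    using Suc(1)[OF n s(1)] by auto
  have "(- 1) ^ card (core_beads g m) * weight (core_set g m) * core_value g w 0 = core_value g w m"
    unfolding card s(5,6) IH(1)[symmetric] by simp
  moreover have "(\<Sum>a\<in>core_beads g m. 2 * int a + 1) = total_energy g m"
    using IH(2) s fin' by simp
  ultimately show ?case by simp
qed

end

section \<open>Self-conjugate partitions as Maya diagrams\<close>

lemma initial_segment:
  fixes E :: "nat set"
  assumes "finite E" "0 \<notin> E" and down: "\<And>i j. j \<in> E \<Longrightarrow> 1 \<le> i \<Longrightarrow> i \<le> j \<Longrightarrow> i \<in> E"
  shows "E = {1..card E}"
proof (cases "E = {}")
  case False
  have "E = {1..Max E}"
  proof (intro equalityI subsetI)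
    fix x assume "x \<in> E"
    then show "x \<in> {1..Max E}" using assms(1,2) by (cases x) auto
  next
    fix x assume "x \<in> {1..Max E}"
    then show "x \<in> E" using down[of "Max E" x] Max_in[OF assms(1) False] by auto
  qed
  moreover from this have "card E = Max E" by (metis card_atLeastAtMost diff_Suc_1)
  ultimately show ?thesis by simp
qed simp

lemma part_decreasing:
  assumes "is_partition p" "1 \<le> i" "i \<le> j"
  shows "part p j \<le> part p i"
proof (cases "i = j \<or> length p < j")
  case False
  then have "p ! (j - 1) \<le> p ! (i - 1)"
    using assms sorted_wrt_nth_less[of "(\<ge>)" p "i - 1" "j - 1"] by (auto simp: is_partition_def)
  then show ?thesis using False assms by (simp add: part_def)
qed (auto simp: part_def)

lemma part_pos_iff:
  assumes "is_partition p"
  shows "1 \<le> part p i \<longleftrightarrow> 1 \<le> i \<and> i \<le> length p"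
proof (cases "1 \<le> i \<and> i \<le> length p")
  case True
  then have "p ! (i - 1) \<in> set p" by (intro nth_mem) auto
  then have "p ! (i - 1) \<noteq> 0" using assms by (metis is_partition_def)
  then show ?thesis using True by (simp add: part_def)
qed (auto simp: part_def)

definition column :: "nat list \<Rightarrow> nat \<Rightarrow> nat set" where
  "column p j = {i. 1 \<le> i \<and> j \<le> part p i}"

lemma column_segment:
  assumes "is_partition p" "1 \<le> j"
  shows "column p j = {1..card (column p j)}"
proof (rule initial_segment)
  have "column p j \<subseteq> {1..length p}"
  proof
    fix i assume "i \<in> column p j"
    then have "1 \<le> part p i" using assms(2) by (simp add: column_def)
    then show "i \<in> {1..length p}" using part_pos_iff[OF assms(1), of i] by simp
  qed
  then show "finite (column p j)" by (rule finite_subset) simp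
  show "i \<in> column p j" if "k \<in> column p j" "1 \<le> i" "i \<le> k" for i k
    using that part_decreasing[OF assms(1), of i k] by (auto simp: column_def)
qed (simp add: column_def)

text \<open>Columns of a partition are initial segments of the rows, so equality of row and column
  lengths amounts to symmetry of the diagram, the form in which self-conjugacy is used
  below.\<close>

lemma SC_iff: "p \<in> SC \<longleftrightarrow> is_partition p \<and> (\<forall>i\<ge>1. \<forall>j\<ge>1. j \<le> part p i \<longleftrightarrow> i \<le> part p j)"
proof
  assume p: "p \<in> SC"
  then have part: "is_partition p" by (simp add: SC_def)
  have "j \<le> part p i \<longleftrightarrow> i \<le> part p j" if ij: "1 \<le> i" "1 \<le> j" for i j
  proof -
  have conj: "conjugate p = p" using p by (simp add: SC_def)
  have "length (conjugate p) = part p 1" by (simp add: conjugate_def del: upt_Suc)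
  then have len: "length p = part p 1" by (simp only: conj)
  have "card (column p j) = part p j"
  proof (cases "j \<le> part p 1")
    case True
    then have "[1..<Suc (part p 1)] ! (j - 1) = j" "j - 1 < length [1..<Suc (part p 1)]"
      using ij True nth_upt[of 1 "j - 1" "Suc (part p 1)"] by (simp_all del: upt_Suc)
    then have "conjugate p ! (j - 1) = card (column p j)"
      unfolding conjugate_def column_def by (simp only: nth_map)
    then have "p ! (j - 1) = card (column p j)" by (simp only: conj)
    moreover have "j \<le> length p" using True len by simp
    ultimately show ?thesis using ij by (simp add: part_def)
  next
    case False
    then have "column p j = {}" using part_decreasing[OF part, of 1] by (fastforce simp: column_def)
    moreover have "\<not> j \<le> length p" using False len by simp
    ultimately show ?thesis by (simp add: part_def)
  qed
  then show ?thesis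
    using column_segment[OF part ij(2)] ij by (auto simp: column_def set_eq_iff)
  qed
  then show "is_partition p \<and> (\<forall>i\<ge>1. \<forall>j\<ge>1. j \<le> part p i \<longleftrightarrow> i \<le> part p j)" using part by blast
next
  assume R: "is_partition p \<and> (\<forall>i\<ge>1. \<forall>j\<ge>1. j \<le> part p i \<longleftrightarrow> i \<le> part p j)"
  then have part: "is_partition p" and sym: "\<And>i j. 1 \<le> i \<Longrightarrow> 1 \<le> j \<Longrightarrow> j \<le> part p i \<longleftrightarrow> i \<le> part p j" by auto
  have len: "length p = part p 1"
  proof (rule antisym)
    show "length p \<le> part p 1"
      using sym[of "length p" 1] part_pos_iff[OF part, of "length p"] by (cases "length p = 0") auto
    show "part p 1 \<le> length p"
      using sym[of "part p 1" 1] part_pos_iff[OF part, of "part p 1"] by (cases "part p 1 = 0") auto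
  qed
  have "conjugate p = p"
  proof (rule nth_equalityI)
    show "length (conjugate p) = length p" by (simp add: conjugate_def len)
    fix k assume "k < length (conjugate p)"
    then have k: "k < part p 1" by (simp add: conjugate_def del: upt_Suc)
    have "{i. 1 \<le> i \<and> Suc k \<le> part p i} = {1..part p (Suc k)}" using sym[of _ "Suc k"] by auto
    moreover have "part p (Suc k) = p ! k" using k len by (subst part_def) simp
    moreover have "conjugate p ! k = card {i. 1 \<le> i \<and> Suc k \<le> part p i}"
      using k nth_upt[of 1 k "Suc (part p 1)"] by (simp add: conjugate_def del: upt_Suc)
    ultimately show "conjugate p ! k = p ! k" by simp
  qed
  then show "p \<in> SC" using part by (simp add: SC_def)
qed

definition bead :: "nat list \<Rightarrow> nat \<Rightarrow> int" where
  "bead p i = int (part p i) - int i"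

text \<open>The arm lengths of the diagonal boxes. In a self-conjugate partition the legs are the
  same numbers, so one half of the Frobenius coordinates suffices.\<close>

definition frobenius :: "nat list \<Rightarrow> nat set" where
  "frobenius p = (\<lambda>i. part p i - i) ` {i. 1 \<le> i \<and> i \<le> part p i}"

context
  fixes p assumes p: "p \<in> SC"
begin

lemma SC_partition: "is_partition p" and SC_sym: "1 \<le> i \<Longrightarrow> 1 \<le> j \<Longrightarrow> j \<le> part p i \<longleftrightarrow> i \<le> part p j"
  using p by (auto simp: SC_iff)

lemma bead_less: "1 \<le> i \<Longrightarrow> i < j \<Longrightarrow> bead p j < bead p i"
  using part_decreasing[OF SC_partition, of i j] by (simp add: bead_def)

lemma bead_less_iff: "1 \<le> i \<Longrightarrow> 1 \<le> j \<Longrightarrow> bead p j < bead p i \<longleftrightarrow> i < j"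
  using bead_less[of i j] bead_less[of j i] by (metis less_asym less_irrefl linorder_neqE_nat)

lemma bead_eq_iff: "1 \<le> i \<Longrightarrow> 1 \<le> j \<Longrightarrow> bead p i = bead p j \<longleftrightarrow> i = j"
  using bead_less[of i j] bead_less[of j i] by (metis less_irrefl linorder_neqE_nat)

text \<open>By symmetry p_i - j and p_j - i are both nonnegative inside the diagram and both
  negative outside; their sum plus 1 is the hook length in the first case and negative in the
  second.\<close>

lemma boxes_iff: "(i, j) \<in> boxes p \<longleftrightarrow> 1 \<le> i \<and> 1 \<le> j \<and> bead p i + bead p j + 1 > 0"
  using SC_sym[of i j] by (auto simp: boxes_def bead_def)

lemma bead_sum: "1 \<le> i \<Longrightarrow> 1 \<le> j \<Longrightarrow> bead p i + bead p j \<noteq> - 1"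
  using SC_sym[of i j] by (auto simp: bead_def)

lemma hook_eq:
  assumes "(i, j) \<in> boxes p"
  shows "hook p (i, j) = nat (bead p i + bead p j + 1)"
proof -
  have ij: "1 \<le> i" "1 \<le> j" "j \<le> part p i" using assms by (auto simp: boxes_def)
  then have ji: "i \<le> part p j" using SC_sym by blast
  have "{(i', j') \<in> boxes p. i' = i \<and> j \<le> j' \<or> j' = j \<and> i \<le> i'} =
     (\<lambda>j'. (i, j')) ` {j..part p i} \<union> (\<lambda>i'. (i', j)) ` {i<..part p j}"
    using ij SC_sym[of _ j] by (auto simp: boxes_def image_iff)
  then have "hook p (i, j) = card ((\<lambda>j'. (i, j')) ` {j..part p i} \<union> (\<lambda>i'. (i', j)) ` {i<..part p j})"
    by (simp add: hook_def)
  also have "\<dots> = card ((\<lambda>j'. (i, j')) ` {j..part p i}) + card ((\<lambda>i'. (i', j)) ` {i<..part p j})"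
    by (rule card_Un_disjoint) auto
  also have "\<dots> = (part p i + 1 - j) + (part p j - i)"
    by (simp add: card_image inj_on_def)
  finally show ?thesis using ij ji by (simp add: bead_def)
qed

text \<open>The nonnegative beads are the Frobenius coordinates; the negative ones follow because
  exactly one of b and - 1 - b is a bead.\<close>

lemma bead_image: "bead p ` {1..} = maya (frobenius p)"
proof -
  have nonneg: "b \<in> bead p ` {1..} \<longleftrightarrow> nat b \<in> frobenius p" if "0 \<le> b" for b
  proof
    assume "b \<in> bead p ` {1..}"
    then obtain i where i: "1 \<le> i" "b = bead p i" by auto
    then show "nat b \<in> frobenius p"
      using that by (auto simp: frobenius_def bead_def nat_diff_distrib intro!: image_eqI[of _ _ i])
  next
    assume "nat b \<in> frobenius p"
    then obtain i where i: "1 \<le> i" "i \<le> part p i" "nat b = part p i - i" by (auto simp: frobenius_def)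
    then show "b \<in> bead p ` {1..}" using that by (intro image_eqI[of _ _ i]) (auto simp: bead_def)
  qed
  have mirror: "- 1 - b \<in> bead p ` {1..} \<longleftrightarrow> b \<notin> bead p ` {1..}" if b: "0 \<le> b" for b
  proof
    assume "- 1 - b \<in> bead p ` {1..}"
    then obtain i where i: "1 \<le> i" "- 1 - b = bead p i" by auto
    show "b \<notin> bead p ` {1..}"
    proof
      assume "b \<in> bead p ` {1..}"
      then obtain j where "1 \<le> j" "b = bead p j" by auto
      then show False using i bead_sum[of i j] by linarith
    qed
  next
    assume nb: "b \<notin> bead p ` {1..}"
    \<comment> \<open>If b is missed, let i be the first row whose bead is below b. Then column b +
      i has length i - 1, and by symmetry the row of this number has the bead - 1 - b.\<close>
    define Q where "Q = (\<lambda>i. 1 \<le> i \<and> bead p i \<le> b)"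
    have "Q (Suc (length p))" using b by (simp add: Q_def bead_def part_def)
    then have ex: "Q (LEAST i. Q i)" by (rule LeastI)
    define i where "i = (LEAST i. Q i)"
    have "Q i" using ex by (simp only: i_def)
    then have i: "1 \<le> i" "bead p i \<le> b" by (simp_all add: Q_def)
    moreover have "bead p i \<noteq> b" using nb i(1) by auto
    ultimately have i: "1 \<le> i" "bead p i < b" by auto
    define j where "j = nat b + i"
    have j: "1 \<le> j" "part p i < j" using i b by (auto simp: j_def bead_def)
    then have "part p j < i" using SC_sym[of i j] i by auto
    moreover have "i - 1 \<le> part p j"
    proof (cases "i = 1")
      case False
      then have "\<not> Q (i - 1)" using not_less_Least[of "i - 1" Q] i(1) unfolding i_def[symmetric] by auto
      then have "b < bead p (i - 1)" "1 \<le> i - 1" using False i(1) by (auto simp: Q_def)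
      then have "j \<le> part p (i - 1)" using b by (auto simp: j_def bead_def)
      then show ?thesis using SC_sym[of "i - 1" j] j \<open>1 \<le> i - 1\<close> by auto
    qed simp
    ultimately have "part p j = i - 1" by simp
    then have "bead p j = - 1 - b" using i b by (simp add: bead_def j_def)
    then show "- 1 - b \<in> bead p ` {1..}" using j by (intro image_eqI[of _ _ j]) auto
  qed
  show ?thesis
  proof (intro set_eqI)
    fix b
    show "b \<in> bead p ` {1..} \<longleftrightarrow> b \<in> maya (frobenius p)"
    proof (cases "b \<ge> 0")
      case True
      then show ?thesis using nonneg by (simp add: maya_def)
    next
      case False
      then have "b \<in> bead p ` {1..} \<longleftrightarrow> nat (- 1 - b) \<notin> frobenius p"
        using mirror[of "- 1 - b"] nonneg[of "- 1 - b"] by simp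
      then show ?thesis using False by (simp add: maya_def)
    qed
  qed
qed

lemma finite_boxes: "finite (boxes p)"
proof (rule finite_subset)
  show "boxes p \<subseteq> {1..length p} \<times> {1..part p 1}"
  proof safe
    fix i j assume ij: "(i, j) \<in> boxes p"
    then have "1 \<le> part p i" by (auto simp: boxes_def)
    then show "i \<in> {1..length p}" using part_pos_iff[OF SC_partition, of i] by simp
    show "j \<in> {1..part p 1}" using ij part_decreasing[OF SC_partition, of 1 i] by (auto simp: boxes_def)
  qed
qed simp

lemma boxes_split:
  "boxes p = {(i, j) \<in> boxes p. i < j} \<union> {(i, j) \<in> boxes p. j < i} \<union> diag p"
  by (auto simp: diag_def)

text \<open>Reflection in the diagonal keeps the hook length and turns \<open>eps\<close> into - 1,
  so each box above the diagonal carries both factors. These boxes correspond to the pairs of beads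
  and the diagonal boxes to the nonnegative beads.\<close>

lemma SC_prod:
  fixes f :: "int \<Rightarrow> nat \<Rightarrow> 'a::comm_monoid_mult"
  shows "(\<Prod>s\<in>boxes p. f (eps s) (hook p s)) * (\<Prod>s\<in>diag p. e (hook p s)) =
    maya_prod (\<lambda>h. f 1 (nat h) * f (- 1) (nat h)) (\<lambda>h. f 1 (nat h) * e (nat h)) (maya (frobenius p))"
proof -
  let ?S = "maya (frobenius p)"
  let ?U = "{(i, j) \<in> boxes p. i < j}" and ?L = "{(i, j) \<in> boxes p. j < i}"
  have fin: "finite ?U" "finite ?L" "finite (diag p)"
    using finite_boxes by (auto intro: finite_subset simp: diag_def)
  have "(\<Prod>s\<in>boxes p. f (eps s) (hook p s)) =
    (\<Prod>s\<in>?U. f (eps s) (hook p s)) * (\<Prod>s\<in>?L. f (eps s) (hook p s)) * (\<Prod>s\<in>diag p. f (eps s) (hook p s))"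
    using fin by (subst boxes_split, subst prod.union_disjoint, (auto simp: diag_def)[3], subst prod.union_disjoint) (auto simp: diag_def)
  also have "(\<Prod>s\<in>?U. f (eps s) (hook p s)) = (\<Prod>(i, j)\<in>?U. f 1 (nat (bead p i + bead p j + 1)))"
    by (rule prod.cong) (auto simp: eps_def hook_eq)
  also have "(\<Prod>s\<in>?L. f (eps s) (hook p s)) = (\<Prod>(i, j)\<in>?U. f (- 1) (nat (bead p i + bead p j + 1)))"
    by (rule prod.reindex_bij_witness[of _ "\<lambda>(i, j). (j, i)" "\<lambda>(i, j). (j, i)"])
       (auto simp: eps_def hook_eq boxes_iff add.commute)
  also have "(\<Prod>s\<in>diag p. f (eps s) (hook p s)) = (\<Prod>s\<in>diag p. f 1 (hook p s))"
    by (rule prod.cong) (auto simp: eps_def diag_def)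
  finally have "(\<Prod>s\<in>boxes p. f (eps s) (hook p s)) * (\<Prod>s\<in>diag p. e (hook p s)) =
     (\<Prod>(i, j)\<in>?U. f 1 (nat (bead p i + bead p j + 1)) * f (- 1) (nat (bead p i + bead p j + 1))) *
     (\<Prod>s\<in>diag p. f 1 (hook p s) * e (hook p s))"
    by (simp only: prod.distrib case_prod_unfold mult_ac)
  also have "(\<Prod>(i, j)\<in>?U. f 1 (nat (bead p i + bead p j + 1)) * f (- 1) (nat (bead p i + bead p j + 1))) =
     (\<Prod>(b, c)\<in>maya_pairs ?S. f 1 (nat (b + c + 1)) * f (- 1) (nat (b + c + 1)))"
  proof (rule prod.reindex_bij_betw[of "\<lambda>(i, j). (bead p j, bead p i)" ?U "maya_pairs ?S"
        "\<lambda>(b, c). f 1 (nat (b + c + 1)) * f (- 1) (nat (b + c + 1))", symmetric, THEN trans, symmetric])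
    show "bij_betw (\<lambda>(i, j). (bead p j, bead p i)) ?U (maya_pairs ?S)"
    proof (rule bij_betw_imageI)
      show "inj_on (\<lambda>(i, j). (bead p j, bead p i)) ?U"
        by (rule inj_onI) (auto simp: boxes_iff bead_eq_iff)
      show "(\<lambda>(i, j). (bead p j, bead p i)) ` ?U = maya_pairs ?S"
      proof (intro equalityI subsetI)
        fix z assume "z \<in> (\<lambda>(i, j). (bead p j, bead p i)) ` ?U"
        then obtain i j where "(i, j) \<in> boxes p" "i < j" "z = (bead p j, bead p i)" by auto
        then show "z \<in> maya_pairs ?S"
          unfolding bead_image[symmetric] by (auto simp: maya_pairs_def boxes_iff bead_less)
      next
        fix z assume "z \<in> maya_pairs ?S"
        then obtain i j where "1 \<le> i" "1 \<le> j" "z = (bead p j, bead p i)" "bead p j < bead p i" "bead p j + bead p i + 1 > 0"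
          unfolding bead_image[symmetric] by (auto simp: maya_pairs_def)
        then show "z \<in> (\<lambda>(i, j). (bead p j, bead p i)) ` ?U"
          by (intro image_eqI[of _ _ "(i, j)"]) (auto simp: boxes_iff bead_less_iff)
      qed
    qed
  qed (auto intro!: prod.cong simp: add.commute)
  also have "(\<Prod>s\<in>diag p. f 1 (hook p s) * e (hook p s)) = (\<Prod>b\<in>?S \<inter> {0..}. f 1 (nat (2 * b + 1)) * e (nat (2 * b + 1)))"
  proof (rule prod.reindex_bij_betw[of "\<lambda>(i, j). bead p i" "diag p" "?S \<inter> {0..}"
        "\<lambda>b. f 1 (nat (2 * b + 1)) * e (nat (2 * b + 1))", symmetric, THEN trans, symmetric])
    show "bij_betw (\<lambda>(i, j). bead p i) (diag p) (?S \<inter> {0..})"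
    proof (rule bij_betw_imageI)
      show "inj_on (\<lambda>(i, j). bead p i) (diag p)"
        by (rule inj_onI) (auto simp: diag_def boxes_iff bead_eq_iff)
      show "(\<lambda>(i, j). bead p i) ` diag p = ?S \<inter> {0..}"
      proof (intro equalityI subsetI)
        fix z assume "z \<in> (\<lambda>(i, j). bead p i) ` diag p"
        then show "z \<in> ?S \<inter> {0..}" unfolding bead_image[symmetric] by (auto simp: diag_def boxes_iff)
      next
        fix z assume "z \<in> ?S \<inter> {0..}"
        then obtain i where "1 \<le> i" "z = bead p i" "0 \<le> z" unfolding bead_image[symmetric] by auto
        then show "z \<in> (\<lambda>(i, j). bead p i) ` diag p"
          by (intro image_eqI[of _ _ "(i, i)"]) (auto simp: diag_def boxes_iff)
      qed
    qed
  qed (auto intro!: prod.cong simp: diag_def hook_eq)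
  finally show ?thesis by (simp add: maya_prod_def)
qed

lemma durfee_segment: "{i. 1 \<le> i \<and> i \<le> part p i} = {1..card {i. 1 \<le> i \<and> i \<le> part p i}}"
proof (rule initial_segment)
  have "{i. 1 \<le> i \<and> i \<le> part p i} \<subseteq> {1..length p}"
  proof
    fix i assume "i \<in> {i. 1 \<le> i \<and> i \<le> part p i}"
    then show "i \<in> {1..length p}" using part_pos_iff[OF SC_partition, of i] by simp
  qed
  then show "finite {i. 1 \<le> i \<and> i \<le> part p i}" by (rule finite_subset) simp
  show "i \<in> {i. 1 \<le> i \<and> i \<le> part p i}" if "j \<in> {i. 1 \<le> i \<and> i \<le> part p i}" "1 \<le> i" "i \<le> j" for i j
    using that part_decreasing[OF SC_partition, of i j] by auto
qed simp

lemma inj_on_frobenius: "inj_on (\<lambda>i. part p i - i) {i. 1 \<le> i \<and> i \<le> part p i}"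
proof (rule inj_onI)
  fix i j assume "i \<in> {i. 1 \<le> i \<and> i \<le> part p i}" "j \<in> {i. 1 \<le> i \<and> i \<le> part p i}" "part p i - i = part p j - j"
  then show "i = j" using bead_eq_iff[of i j] by (auto simp: bead_def)
qed

lemma finite_durfee: "finite {i. 1 \<le> i \<and> i \<le> part p i}"
  by (subst durfee_segment) simp

lemma finite_frobenius: "finite (frobenius p)"
  unfolding frobenius_def using finite_durfee by simp

lemma durfee_eq: "durfee p = card (frobenius p)"
proof -
  let ?d = "card {i. 1 \<le> i \<and> i \<le> part p i}"
  have "durfee p = Max (insert 0 {1..?d})" unfolding durfee_def using durfee_segment by simp
  also have "\<dots> = ?d" by (rule Max_eqI) auto
  also have "\<dots> = card (frobenius p)" unfolding frobenius_def by (rule card_image[OF inj_on_frobenius, symmetric])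
  finally show ?thesis .
qed

text \<open>The diagram is cut into its diagonal and two mirrored halves; a diagonal box with arm a
  thus accounts for 2 a + 1 boxes, its principal hook.\<close>

lemma sum_list_eq: "sum_list p = (\<Sum>a\<in>frobenius p. 2 * a + 1)"
proof -
  let ?D = "{i. 1 \<le> i \<and> i \<le> part p i}"
  let ?U = "{(i, j) \<in> boxes p. i < j}" and ?L = "{(i, j) \<in> boxes p. j < i}"
  have fin: "finite ?U" "finite ?L" "finite (diag p)"
    using finite_boxes by (auto intro: finite_subset simp: diag_def)
  have "sum_list p = (\<Sum>i\<in>{1..length p}. part p i)"
  proof -
    have "sum_list p = (\<Sum>i = 0..<length p. p ! i)" by (rule sum_list_sum_nth)
    also have "\<dots> = (\<Sum>i\<in>{1..length p}. part p i)"
      by (rule sum.reindex_bij_witness[of _ "\<lambda>i. i - 1" Suc]) (auto simp: part_def)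
    finally show ?thesis .
  qed
  also have "\<dots> = card (SIGMA i:{1..length p}. {1..part p i})" by simp
  also have "(SIGMA i:{1..length p}. {1..part p i}) = boxes p"
  proof -
    have "i \<le> length p" if "1 \<le> j" "j \<le> part p i" for i j
      using part_pos_iff[OF SC_partition, of i] that by simp
    then show ?thesis by (auto simp: boxes_def)
  qed
  also have "card (boxes p) = card ?U + card ?L + card (diag p)"
    using fin by (subst boxes_split, subst card_Un_disjoint, (auto simp: diag_def)[3], subst card_Un_disjoint) (auto simp: diag_def)
  also have "card ?L = card ?U"
    by (rule bij_betw_same_card[of "\<lambda>(i, j). (j, i)"], rule bij_betw_byWitness[of _ "\<lambda>(i, j). (j, i)"]) (auto simp: boxes_iff add.commute)
  also have "?U = (SIGMA i:?D. {i<..part p i})" by (auto simp: boxes_def)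
  also have "card \<dots> = (\<Sum>i\<in>?D. part p i - i)" using finite_durfee by simp
  also have "card (diag p) = card ?D"
    by (rule bij_betw_same_card[of fst], rule bij_betw_byWitness[of _ "\<lambda>i. (i, i)"]) (auto simp: diag_def boxes_def)
  also have "(\<Sum>i\<in>?D. part p i - i) + (\<Sum>i\<in>?D. part p i - i) + card ?D = (\<Sum>i\<in>?D. 2 * (part p i - i) + 1)"
    by (simp only: sum.distrib sum_distrib_left[symmetric]) simp
  also have "\<dots> = (\<Sum>a\<in>frobenius p. 2 * a + 1)"
    unfolding frobenius_def sum.reindex[OF inj_on_frobenius] comp_def by (rule refl)
  finally show ?thesis .
qed

end

section \<open>Self-conjugate partitions correspond to finite sets\<close>

lemma strict_antimono_range_unique:
  fixes f h :: "nat \<Rightarrow> int"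
  assumes f: "\<And>i j. i < j \<Longrightarrow> f j < f i" and h: "\<And>i j. i < j \<Longrightarrow> h j < h i" and r: "range f = range h"
  shows "f n = h n"
proof (induction n rule: less_induct)
  case (less n)
  obtain k where k: "f n = h k" using r by (metis rangeE rangeI)
  obtain l where l: "h n = f l" using r by (metis rangeE rangeI)
  have "\<not> k < n" using less[of k] k f[of k n] by auto
  moreover have "\<not> l < n" using less[of l] l h[of l n] by auto
  ultimately have "h k \<le> h n" "f l \<le> f n" using h[of n k] f[of n l] by (auto simp: order.order_iff_strict not_less)
  then show ?case using k l by simp
qed

text \<open>The set determines all beads, and listing them in decreasing order recovers the
  rows.\<close>

lemma frobenius_inj: "inj_on frobenius SC"
proof (rule inj_onI)
  fix p p' assume p: "p \<in> SC" "p' \<in> SC" "frobenius p = frobenius p'"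
  have "bead p (Suc n) = bead p' (Suc n)" for n
  proof (rule strict_antimono_range_unique[of "\<lambda>n. bead p (Suc n)" "\<lambda>n. bead p' (Suc n)"])
    have "range (\<lambda>n. bead p (Suc n)) = bead p ` {1..}" for p
    proof -
      have "range Suc = {1..}" by (auto simp: image_iff) (metis Suc_le_D)
      then show ?thesis by (metis image_image)
    qed
    then show "range (\<lambda>n. bead p (Suc n)) = range (\<lambda>n. bead p' (Suc n))"
      using bead_image p by simp
  qed (use p bead_less in auto)
  then have part: "part p i = part p' i" if "1 \<le> i" for i using that by (cases i) (auto simp: bead_def)
  have pp: "is_partition p" "is_partition p'" using p by (auto simp: SC_def)
  have "1 \<le> i \<and> i \<le> length p \<longleftrightarrow> 1 \<le> i \<and> i \<le> length p'" for i
    using part_pos_iff[OF pp(1), of i] part_pos_iff[OF pp(2), of i] part[of i] by (cases "1 \<le> i") (simp_all only: simp_thms)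
  from this[of "length p"] this[of "length p'"] have len: "length p = length p'"
    by (cases "length p = 0"; cases "length p' = 0") auto
  show "p = p'"
  proof (rule nth_equalityI[OF len])
    fix k assume "k < length p"
    then show "p ! k = p' ! k" using part[of "Suc k"] len by (simp add: part_def)
  qed
qed

text \<open>Wraps a principal hook with arm and leg \<open>a\<close> around the diagram;
  \<open>part\<close> is 0 beyond the last row, so the rows added below consist of one box.\<close>

definition add_hook :: "nat \<Rightarrow> nat list \<Rightarrow> nat list" where
  "add_hook a p = (a + 1) # map (\<lambda>i. part p i + 1) [1..<Suc a]"

lemma part_add_hook:
  "part (add_hook a p) i = (if i = 1 then a + 1 else if 1 \<le> i \<and> i \<le> a + 1 then part p (i - 1) + 1 else 0)"
  by (auto simp: part_def add_hook_def nth_Cons' simp del: upt_Suc)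

lemma add_hook_SC:
  assumes p: "p \<in> SC" and a: "part p 1 \<le> a"
  shows "add_hook a p \<in> SC"
  unfolding SC_iff
proof (intro conjI allI impI)
  have dec: "part p j \<le> part p i" if "1 \<le> i" "i \<le> j" for i j
    using part_decreasing[OF SC_partition[OF p] that] .
  have "sorted_wrt (\<ge>) (map (\<lambda>i. part p i + 1) [1..<Suc a])"
    unfolding sorted_wrt_map by (rule sorted_wrt_mono_rel[OF _ sorted_wrt_upt]) (auto intro: dec)
  moreover have "part p i \<le> a" if "1 \<le> i" for i using dec[of 1 i] a that by simp
  ultimately show "is_partition (add_hook a p)" by (auto simp: is_partition_def add_hook_def simp del: upt_Suc)
  fix i j :: nat assume ij: "1 \<le> i" "1 \<le> j"
  have le: "part p i \<le> a" if "1 \<le> i" for i using dec[of 1 i] a that by simp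
  show "j \<le> part (add_hook a p) i \<longleftrightarrow> i \<le> part (add_hook a p) j"
  proof (cases "i = 1 \<or> j = 1")
    case True
    then show ?thesis using ij by (auto simp: part_add_hook)
  next
    case False
    then have "j - 1 \<le> part p (i - 1) \<longleftrightarrow> i - 1 \<le> part p (j - 1)" using ij SC_sym[OF p, of "i - 1" "j - 1"] by auto
    moreover have "part p (i - 1) \<le> a" "part p (j - 1) \<le> a" using False ij by (auto intro!: le)
    ultimately show ?thesis using False ij by (auto simp: part_add_hook)
  qed
qed

lemma frobenius_add_hook:
  assumes p: "p \<in> SC" and a: "part p 1 \<le> a"
  shows "frobenius (add_hook a p) = insert a (frobenius p)"
proof -
  have le: "part p i \<le> a" if "1 \<le> i" for i using part_decreasing[OF SC_partition[OF p], of 1 i] a that by simp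
  let ?D = "{i. 1 \<le> i \<and> i \<le> part p i}"
  have "{i. 1 \<le> i \<and> i \<le> part (add_hook a p) i} = insert 1 (Suc ` ?D)"
  proof (intro set_eqI)
    fix i
    show "i \<in> {i. 1 \<le> i \<and> i \<le> part (add_hook a p) i} \<longleftrightarrow> i \<in> insert 1 (Suc ` ?D)"
      using le[of "i - 1"] by (cases i) (auto simp: part_add_hook image_iff)
  qed
  then have "frobenius (add_hook a p) = insert a ((\<lambda>i. part (add_hook a p) (Suc i) - Suc i) ` ?D)"
    by (simp add: frobenius_def image_image part_add_hook)
  also have "(\<lambda>i. part (add_hook a p) (Suc i) - Suc i) ` ?D = frobenius p"
    unfolding frobenius_def by (rule image_cong) (use le in \<open>fastforce simp: part_add_hook\<close>)+
  finally show ?thesis .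
qed

text \<open>Elements are inserted in increasing order, so each new hook lies outside all earlier
  ones and the first row fits.\<close>

lemma frobenius_surj: "finite A \<Longrightarrow> \<exists>p\<in>SC. frobenius p = A"
proof (induction A rule: finite_linorder_max_induct)
  case empty
  have "[] \<in> SC" by (simp add: SC_iff is_partition_def part_def)
  moreover have "frobenius [] = {}" by (auto simp: frobenius_def part_def)
  ultimately show ?case by blast
next
  case (insert a A)
  then obtain p where p: "p \<in> SC" "frobenius p = A" by blast
  have "part p 1 \<le> a"
  proof (cases "1 \<le> part p 1")
    case True
    then have "part p 1 - 1 \<in> frobenius p" by (auto simp: frobenius_def)
    then show ?thesis using insert(2) p by auto
  qed simp
  then show ?case using add_hook_SC[OF p(1)] frobenius_add_hook[OF p(1)] p(2) by blast
qed

lemma bij_betw_frobenius: "bij_betw frobenius SC {A. finite A}"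
  unfolding bij_betw_def using frobenius_inj frobenius_surj finite_frobenius by auto

section \<open>Evaluation at Laurent series\<close>

text \<open>The bound is uniform in the power of q; this makes the substitution for u a finite sum
  over the exponents of u.\<close>

definition u_bounded :: "nat \<Rightarrow> laurent fps \<Rightarrow> bool" where
  "u_bounded B F \<longleftrightarrow> (\<forall>k j. int B < \<bar>j\<bar> \<longrightarrow> lookup (fps_nth F k) j = 0)"

text \<open>Rational coefficients make the target, the Laurent series in q, a field, in which
  negative powers of the substituted value exist.\<close>

definition u_coeff :: "int \<Rightarrow> laurent fps \<Rightarrow> rat fls" where
  "u_coeff j F = fps_to_fls (Abs_fps (\<lambda>k. of_int (lookup (fps_nth F k) j)))"

text \<open>Meaningful for bounded arguments; over an infinite set of exponents the sum is 0 by
  convention.\<close>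

definition u_eval :: "rat fls \<Rightarrow> laurent fps \<Rightarrow> rat fls" where
  "u_eval U F = (\<Sum>j | u_coeff j F \<noteq> 0. u_coeff j F * U powi j)"

lemma u_coeff_add: "u_coeff j (F + G) = u_coeff j F + u_coeff j G"
  unfolding u_coeff_def fps_to_fls_plus[symmetric]
  by (intro arg_cong[of _ _ fps_to_fls] fps_ext) (simp add: lookup_add)

lemma u_coeff_zero [simp]: "u_coeff j 0 = 0"
  by (simp add: u_coeff_def fps_zero_def[symmetric])

lemma u_coeff_eq_0: "u_bounded B F \<Longrightarrow> int B < \<bar>j\<bar> \<Longrightarrow> u_coeff j F = 0"
  by (simp add: u_coeff_def u_bounded_def fps_zero_def[symmetric])

lemma u_eval_eq: "u_bounded B F \<Longrightarrow> u_eval U F = (\<Sum>j=-int B..int B. u_coeff j F * U powi j)"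
  unfolding u_eval_def
  by (rule sum.mono_neutral_left) (auto, (metis u_coeff_eq_0 abs_le_iff linorder_not_less minus_le_iff)+)

lemma u_bounded_mono: "u_bounded B F \<Longrightarrow> B \<le> C \<Longrightarrow> u_bounded C F"
  by (simp add: u_bounded_def)

lemma u_bounded_add: "u_bounded B F \<Longrightarrow> u_bounded B G \<Longrightarrow> u_bounded B (F + G)"
  by (simp add: u_bounded_def lookup_add)

lemma u_bounded_diff: "u_bounded B F \<Longrightarrow> u_bounded B G \<Longrightarrow> u_bounded B (F - G)"
  by (simp add: u_bounded_def lookup_minus)

lemma u_bounded_zero [simp]: "u_bounded B 0"
  by (simp add: u_bounded_def)

lemma u_bounded_sum: "(\<And>i. i \<in> I \<Longrightarrow> u_bounded B (F i)) \<Longrightarrow> u_bounded B (\<Sum>i\<in>I. F i)"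
  by (induction I rule: infinite_finite_induct) (auto intro: u_bounded_add)

lemma lookup_mult_bounded:
  assumes "u_bounded B F"
  shows "lookup (fps_nth (F * G) k) j =
    (\<Sum>i=-int B..int B. \<Sum>l=0..k. lookup (fps_nth F l) i * lookup (fps_nth G (k - l)) (j - i))"
proof -
  have "lookup (fps_nth (F * G) k) j = (\<Sum>l=0..k. lookup (fps_nth F l * fps_nth G (k - l)) j)"
    by (simp add: fps_mult_nth lookup_sum)
  also have "\<dots> = (\<Sum>l=0..k. \<Sum>i=-int B..int B. lookup (fps_nth F l) i * lookup (fps_nth G (k - l)) (j - i))"
  proof (rule sum.cong[OF refl])
    fix l
    have "i \<in> {-int B..int B}" if "i \<in> keys (fps_nth F l)" for i
    proof -
      have "\<not> int B < \<bar>i\<bar>" using that assms by (auto simp: u_bounded_def in_keys_iff)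
      then show ?thesis by auto
    qed
    then show "lookup (fps_nth F l * fps_nth G (k - l)) j =
       (\<Sum>i=-int B..int B. lookup (fps_nth F l) i * lookup (fps_nth G (k - l)) (j - i))"
      unfolding lookup_mult_group by (intro sum.mono_neutral_left) (auto simp: in_keys_iff)
  qed
  also have "\<dots> = (\<Sum>i=-int B..int B. \<Sum>l=0..k. lookup (fps_nth F l) i * lookup (fps_nth G (k - l)) (j - i))"
    by (rule sum.swap)
  finally show ?thesis .
qed

lemma u_bounded_mult:
  assumes "u_bounded B F" "u_bounded C G"
  shows "u_bounded (B + C) (F * G)"
  unfolding u_bounded_def
proof (intro allI impI)
  fix k j assume j: "int (B + C) < \<bar>j\<bar>"
  have "lookup (fps_nth G l) (j - i) = 0" if "i \<in> {-int B..int B}" for i l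
  proof -
    have "int C < \<bar>j - i\<bar>" using j that by auto
    then show ?thesis using assms(2) by (simp add: u_bounded_def)
  qed
  then show "lookup (fps_nth (F * G) k) j = 0"
    unfolding lookup_mult_bounded[OF assms(1)] by simp
qed

lemma u_coeff_mult:
  assumes "u_bounded B F"
  shows "u_coeff j (F * G) = (\<Sum>i=-int B..int B. u_coeff i F * u_coeff (j - i) G)"
proof -
  have "u_coeff j (F * G) = fps_to_fls (\<Sum>i=-int B..int B.
     Abs_fps (\<lambda>k. of_int (lookup (fps_nth F k) i)) * Abs_fps (\<lambda>k. of_int (lookup (fps_nth G k) (j - i))))"
    unfolding u_coeff_def
  proof (intro arg_cong[of _ _ fps_to_fls] fps_ext)
    fix k
    show "fps_nth (Abs_fps (\<lambda>k. rat_of_int (lookup (fps_nth (F * G) k) j))) k =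
      fps_nth (\<Sum>i=-int B..int B. Abs_fps (\<lambda>k. of_int (lookup (fps_nth F k) i)) * Abs_fps (\<lambda>k. of_int (lookup (fps_nth G k) (j - i)))) k"
      unfolding fps_nth_Abs_fps lookup_mult_bounded[OF assms] by (simp add: fps_sum_nth fps_mult_nth)
  qed
  also have "\<dots> = (\<Sum>i=-int B..int B. u_coeff i F * u_coeff (j - i) G)"
  proof -
    have "fps_to_fls (\<Sum>i\<in>I. H i) = (\<Sum>i\<in>I. fps_to_fls (H i :: rat fps))" for I :: "int set" and H
      by (induction I rule: infinite_finite_induct) simp_all
    then show ?thesis by (simp add: u_coeff_def fls_times_fps_to_fls)
  qed
  finally show ?thesis .
qed

lemma u_eval_mult:
  assumes F: "u_bounded B F" and G: "u_bounded C G" and U: "U \<noteq> 0"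
  shows "u_eval U (F * G) = u_eval U F * u_eval U G"
proof -
  have "u_eval U (F * G) = (\<Sum>j=-int (B + C)..int (B + C). \<Sum>i=-int B..int B. u_coeff i F * u_coeff (j - i) G * U powi j)"
    by (simp add: u_eval_eq[OF u_bounded_mult[OF F G]] u_coeff_mult[OF F] sum_distrib_right)
  also have "\<dots> = (\<Sum>i=-int B..int B. \<Sum>j=-int (B + C)..int (B + C). u_coeff i F * u_coeff (j - i) G * U powi j)"
    by (rule sum.swap)
  also have "\<dots> = (\<Sum>i=-int B..int B. \<Sum>j=-int C..int C. u_coeff i F * u_coeff j G * U powi (i + j))"
  proof (rule sum.cong[OF refl])
    fix i assume i: "i \<in> {-int B..int B}"
    have "(\<Sum>j=-int (B + C)..int (B + C). u_coeff i F * u_coeff (j - i) G * U powi j) =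
       (\<Sum>j=i - int C..i + int C. u_coeff i F * u_coeff (j - i) G * U powi j)"
    proof (rule sum.mono_neutral_right)
      show "\<forall>j\<in>{- int (B + C)..int (B + C)} - {i - int C..i + int C}. u_coeff i F * u_coeff (j - i) G * U powi j = 0"
      proof
        fix j assume "j \<in> {- int (B + C)..int (B + C)} - {i - int C..i + int C}"
        then have "int C < \<bar>j - i\<bar>" by auto
        then show "u_coeff i F * u_coeff (j - i) G * U powi j = 0" using u_coeff_eq_0[OF G] by simp
      qed
    qed (use i in auto)
    also have "\<dots> = (\<Sum>j=-int C..int C. u_coeff i F * u_coeff j G * U powi (i + j))"
      by (rule sum.reindex_bij_witness[of _ "\<lambda>j. i + j" "\<lambda>j. j - i"]) auto
    finally show "(\<Sum>j=-int (B + C)..int (B + C). u_coeff i F * u_coeff (j - i) G * U powi j) = \<dots>" .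
  qed
  also have "\<dots> = u_eval U F * u_eval U G"
    using U by (simp add: u_eval_eq[OF F] u_eval_eq[OF G] sum_product power_int_add mult_ac)
  finally show ?thesis .
qed

lemma u_eval_add:
  assumes F: "u_bounded B F" and G: "u_bounded B G"
  shows "u_eval U (F + G) = u_eval U F + u_eval U G"
  by (simp add: u_eval_eq[OF F] u_eval_eq[OF G] u_eval_eq[OF u_bounded_add[OF F G]] u_coeff_add distrib_right sum.distrib)

lemma u_eval_zero [simp]: "u_eval U 0 = 0"
  by (simp add: u_eval_def)

definition u_mono :: "int \<Rightarrow> nat \<Rightarrow> laurent fps" where
  "u_mono j a = fps_const (Poly_Mapping.single j 1) * fps_X ^ a"

lemma u_mono_nth: "fps_nth (u_mono j a) k = (if k = a then Poly_Mapping.single j 1 else 0)"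
  by (auto simp: u_mono_def fps_X_power_nth)

lemma u_mono_mult: "u_mono i a * u_mono j b = u_mono (i + j) (a + b)"
proof -
  have "u_mono i a * u_mono j b =
    fps_const (Poly_Mapping.single i 1 * Poly_Mapping.single j 1) * (fps_X ^ a * fps_X ^ b)"
    by (simp only: u_mono_def fps_const_mult[symmetric] mult_ac)
  then show ?thesis by (simp only: u_mono_def mult_single power_add mult_1_right)
qed

lemma u_mono_0 [simp]: "u_mono 0 0 = 1"
  by (simp add: u_mono_def)

lemma u_bounded_mono_term: "nat \<bar>j\<bar> \<le> B \<Longrightarrow> u_bounded B (u_mono j a)"
  by (auto simp: u_bounded_def u_mono_nth lookup_single when_def)

lemma u_eval_mono: "u_eval U (u_mono j a) = fls_X ^ a * U powi j"
proof -
  have "u_coeff i (u_mono j a) = (if i = j then fls_X ^ a else 0)" for i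
  proof -
    have "Abs_fps (\<lambda>k. of_int (lookup (fps_nth (u_mono j a) k) i)) = (if i = j then fps_X ^ a else (0 :: rat fps))"
      by (rule fps_ext) (auto simp: u_mono_nth lookup_single when_def fps_X_power_nth)
    then show ?thesis by (simp add: u_coeff_def fps_to_fls_power)
  qed
  then show ?thesis
    by (simp add: u_eval_eq[OF u_bounded_mono_term[of j "nat \<bar>j\<bar>" a, OF order_refl]] if_distrib[of "\<lambda>x. x * _"] sum.delta' cong: if_cong)
       (auto simp: sum.delta)
qed

lemma u_eval_one: "u_eval U 1 = 1"
  using u_eval_mono[of U 0 0] by simp

lemma u_bounded_one [simp]: "u_bounded B 1"
  using u_bounded_mono_term[of 0 B 0] by simp

definition u_finite :: "laurent fps \<Rightarrow> bool" where "u_finite F \<longleftrightarrow> (\<exists>B. u_bounded B F)"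

lemma u_finite_common: "u_finite F \<Longrightarrow> u_finite G \<Longrightarrow> \<exists>B. u_bounded B F \<and> u_bounded B G"
  unfolding u_finite_def by (meson u_bounded_mono max.cobounded1 max.cobounded2)

lemma u_finite_mult: "u_finite F \<Longrightarrow> u_finite G \<Longrightarrow> u_finite (F * G)"
  unfolding u_finite_def using u_bounded_mult by blast

lemma u_finite_add: "u_finite F \<Longrightarrow> u_finite G \<Longrightarrow> u_finite (F + G)"
  using u_finite_common[of F G] unfolding u_finite_def using u_bounded_add by blast

lemma u_finite_diff: "u_finite F \<Longrightarrow> u_finite G \<Longrightarrow> u_finite (F - G)"
  using u_finite_common[of F G] unfolding u_finite_def using u_bounded_diff by blast

lemma u_finite_one [simp]: "u_finite 1" by (auto simp: u_finite_def)
lemma u_finite_zero [simp]: "u_finite 0" by (auto simp: u_finite_def)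
lemma u_finite_mono [simp]: "u_finite (u_mono j a)" unfolding u_finite_def using u_bounded_mono_term by blast

lemma u_finite_sum: "(\<And>i. i \<in> I \<Longrightarrow> u_finite (F i)) \<Longrightarrow> u_finite (\<Sum>i\<in>I. F i)"
  by (induction I rule: infinite_finite_induct) (auto intro: u_finite_add)

lemma u_finite_prod: "(\<And>i. i \<in> I \<Longrightarrow> u_finite (F i)) \<Longrightarrow> u_finite (\<Prod>i\<in>I. F i)"
  by (induction I rule: infinite_finite_induct) (auto intro: u_finite_mult)

lemma u_eval_add': "u_finite F \<Longrightarrow> u_finite G \<Longrightarrow> u_eval U (F + G) = u_eval U F + u_eval U G"
  using u_finite_common u_eval_add by metis

lemma u_eval_diff: "u_finite F \<Longrightarrow> u_finite G \<Longrightarrow> u_eval U (F - G) = u_eval U F - u_eval U G"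
  using u_eval_add'[of "F - G" G U] u_finite_diff[of F G] by simp

lemma u_eval_mult': "u_finite F \<Longrightarrow> u_finite G \<Longrightarrow> U \<noteq> 0 \<Longrightarrow> u_eval U (F * G) = u_eval U F * u_eval U G"
  unfolding u_finite_def using u_eval_mult by blast

lemma u_eval_sum': "(\<And>i. i \<in> I \<Longrightarrow> u_finite (F i)) \<Longrightarrow> u_eval U (\<Sum>i\<in>I. F i) = (\<Sum>i\<in>I. u_eval U (F i))"
  by (induction I rule: infinite_finite_induct) (auto simp: u_eval_add' u_finite_sum)

lemma u_eval_prod: "U \<noteq> 0 \<Longrightarrow> (\<And>i. i \<in> I \<Longrightarrow> u_finite (F i)) \<Longrightarrow> u_eval U (\<Prod>i\<in>I. F i) = (\<Prod>i\<in>I. u_eval U (F i))"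
  by (induction I rule: infinite_finite_induct) (auto simp: u_eval_mult' u_finite_prod u_eval_one)

section \<open>Evaluation of series in t, with bounds on the powers of u\<close>

definition series_eval :: "rat fls \<Rightarrow> series \<Rightarrow> rat fls fps" where
  "series_eval U f = Abs_fps (\<lambda>n. u_eval U (fps_nth f n))"

definition tame :: "series \<Rightarrow> bool" where "tame f \<longleftrightarrow> (\<forall>n. u_finite (fps_nth f n))"

text \<open>A bound that follows the power of t is stable under products, under division by series
  with constant coefficient 1 and under formal products; tameness is inherited from it.\<close>

definition graded :: "series \<Rightarrow> bool" where "graded f \<longleftrightarrow> (\<forall>n. u_bounded n (fps_nth f n))"

lemma graded_tame: "graded f \<Longrightarrow> tame f" by (auto simp: graded_def tame_def u_finite_def)

lemma tame_mult: "tame f \<Longrightarrow> tame h \<Longrightarrow> tame (f * h)"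
  by (auto simp: tame_def fps_mult_nth intro!: u_finite_sum u_finite_mult)

lemma series_eval_mult: "tame f \<Longrightarrow> tame h \<Longrightarrow> U \<noteq> 0 \<Longrightarrow> series_eval U (f * h) = series_eval U f * series_eval U h"
  by (auto simp: fps_eq_iff series_eval_def fps_mult_nth tame_def u_eval_sum' u_finite_mult u_eval_mult')

lemma series_eval_one: "series_eval U 1 = 1"
  by (auto simp: fps_eq_iff series_eval_def u_eval_one)

lemma tame_one [simp]: "tame 1" by (simp add: tame_def fps_one_nth)

lemma series_eval_prod:
  "U \<noteq> 0 \<Longrightarrow> (\<And>i. i \<in> I \<Longrightarrow> tame (f i)) \<Longrightarrow> tame (\<Prod>i\<in>I. f i) \<and> series_eval U (\<Prod>i\<in>I. f i) = (\<Prod>i\<in>I. series_eval U (f i))"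
proof (induction I rule: infinite_finite_induct)
  case (insert x I)
  then show ?case by (simp add: tame_mult series_eval_mult)
qed (auto simp: series_eval_one)

lemma graded_mult: "graded f \<Longrightarrow> graded h \<Longrightarrow> graded (f * h)"
  unfolding graded_def fps_mult_nth
proof (intro allI u_bounded_sum)
  fix n i :: nat assume fh: "\<forall>n. u_bounded n (fps_nth f n)" "\<forall>n. u_bounded n (fps_nth h n)" and i: "i \<in> {0..n}"
  have "u_bounded (i + (n - i)) (fps_nth f i * fps_nth h (n - i))" using fh by (intro u_bounded_mult) auto
  then show "u_bounded n (fps_nth f i * fps_nth h (n - i))" using i by simp
qed

lemma graded_one [simp]: "graded 1" by (simp add: graded_def fps_one_nth)

lemma graded_diff: "graded f \<Longrightarrow> graded h \<Longrightarrow> graded (f - h)"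
  by (auto simp: graded_def intro: u_bounded_diff)

lemma graded_prod: "(\<And>i. i \<in> I \<Longrightarrow> graded (f i)) \<Longrightarrow> graded (\<Prod>i\<in>I. f i)"
  by (induction I rule: infinite_finite_induct) (auto intro: graded_mult)

lemma graded_power: "graded f \<Longrightarrow> graded (f ^ k)"
  using graded_prod[of "{..<k}" "\<lambda>_. f"] by simp

text \<open>Coefficient n of f is that of f h minus products of coefficients i < n of f and n - i of
  h, whose bounds add up to n.\<close>

lemma graded_cancel:
  assumes "graded (f * h)" "graded h" "fps_nth h 0 = 1"
  shows "graded f"
  unfolding graded_def
proof
  fix n
  show "u_bounded n (fps_nth f n)"
  proof (induction n rule: less_induct)
    case (less n)
    have "fps_nth (f * h) n = (\<Sum>i\<in>{0..<n}. fps_nth f i * fps_nth h (n - i)) + fps_nth f n"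
    proof -
      have "{0..n} = insert n {0..<n}" by auto
      then show ?thesis by (simp add: fps_mult_nth assms(3) add.commute)
    qed
    then have eq: "fps_nth f n = fps_nth (f * h) n - (\<Sum>i\<in>{0..<n}. fps_nth f i * fps_nth h (n - i))" by simp
    have "u_bounded n (fps_nth f i * fps_nth h (n - i))" if "i \<in> {0..<n}" for i
      using u_bounded_mult[OF less.IH[of i], of "n - i" "fps_nth h (n - i)"] that assms(2) by (simp add: graded_def)
    then show ?case unfolding eq using assms(1) by (intro u_bounded_diff u_bounded_sum) (auto simp: graded_def)
  qed
qed

lemma graded_divide:
  assumes "graded f" "graded h" "fps_nth h 0 = 1"
  shows "graded (f \<oslash> h)"
  using assms graded_cancel[of "f \<oslash> h" h] series_divide_mult_cancel[of h f] by simp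

definition smono :: "int \<Rightarrow> nat \<Rightarrow> nat \<Rightarrow> series" where
  "smono j a m = fps_const (u_mono j a) * fps_X ^ m"

lemma smono_eq: "u_pow j * q ^ a * t ^ m = smono j a m"
  by (simp add: smono_def u_pow_def q_def t_def u_mono_def fps_const_power)

lemma smono_nth: "fps_nth (smono j a m) n = (if n = m then u_mono j a else 0)"
  by (auto simp: smono_def fps_X_power_nth)

lemma graded_smono: "nat \<bar>j\<bar> \<le> m \<Longrightarrow> graded (smono j a m)"
  by (auto simp: graded_def smono_nth u_bounded_mono_term)

lemma series_eval_one_minus_smono:
  "series_eval U (1 - smono j a m) = 1 - fps_const (fls_X ^ a * U powi j) * fps_X ^ m"
  by (rule fps_ext) (auto simp: series_eval_def smono_nth fps_X_power_nth u_eval_diff u_eval_mono u_eval_one fps_one_nth)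

section \<open>Agreement in both variables and formal products\<close>

definition agree2 :: "nat \<Rightarrow> nat \<Rightarrow> series \<Rightarrow> series \<Rightarrow> bool" where
  "agree2 n k f h \<longleftrightarrow> (\<forall>i\<le>n. \<forall>l\<le>k. fps_nth (fps_nth f i) l = fps_nth (fps_nth h i) l)"

lemma agree2_refl [simp]: "agree2 n k f f" by (simp add: agree2_def)

lemma agree2_mult: "agree2 n k f f' \<Longrightarrow> agree2 n k h h' \<Longrightarrow> agree2 n k (f * h) (f' * h')"
  by (auto simp: agree2_def fps_mult_nth fps_sum_nth intro!: sum.cong)

lemma agree2_cancel:
  assumes "agree2 n k (f * h) h" "fps_nth (fps_nth h 0) 0 = 1"
  shows "agree2 n k f 1"
proof -
  have "(1 \<oslash> h) * h = 1" using assms(2) by (rule series_divide_mult_cancel)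
  then have "agree2 n k (f * (h * (1 \<oslash> h))) (h * (1 \<oslash> h))"
    using agree2_mult[OF assms(1) agree2_refl[of n k "1 \<oslash> h"]] by (simp add: mult.assoc)
  then show ?thesis using \<open>(1 \<oslash> h) * h = 1\<close> by (simp add: mult.commute)
qed

lemma agree2_prod_one:
  "(\<And>i. i \<in> I \<Longrightarrow> agree2 n k (f i) 1) \<Longrightarrow> agree2 n k (\<Prod>i\<in>I. f i) 1"
proof (induction I rule: infinite_finite_induct)
  case (insert x I)
  then show ?case using agree2_mult[of n k "f x" 1 "prod f I" 1] by simp
qed simp_all

text \<open>Each coefficient is taken from the factors that still differ from 1 up to its orders;
  where these are always finitely many, this is the limit of the partial products.\<close>

definition formal_prod :: "('i \<Rightarrow> series) \<Rightarrow> 'i set \<Rightarrow> series" where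
  "formal_prod f A = Abs_fps (\<lambda>n. Abs_fps (\<lambda>k. fps_nth (fps_nth (\<Prod>i\<in>{i \<in> A. \<not> agree2 n k (f i) 1}. f i) n) k))"

lemma formal_prod_partial:
  assumes fin: "finite S" "S \<subseteq> A" and S: "\<And>i. i \<in> A - S \<Longrightarrow> agree2 n k (f i) 1"
  shows "agree2 n k (formal_prod f A) (\<Prod>i\<in>S. f i)"
  unfolding agree2_def
proof (intro allI impI)
  fix n' k' assume le: "n' \<le> n" "k' \<le> k"
  let ?B = "{i \<in> A. \<not> agree2 n' k' (f i) 1}"
  have "?B \<subseteq> S" using S le by (force simp: agree2_def)
  then have "(\<Prod>i\<in>S. f i) = (\<Prod>i\<in>S - ?B. f i) * (\<Prod>i\<in>?B. f i)"
    using fin by (intro prod.subset_diff)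
  moreover have "agree2 n' k' (\<Prod>i\<in>S - ?B. f i) 1" using fin(2) by (intro agree2_prod_one) auto
  ultimately have "agree2 n' k' (\<Prod>i\<in>S. f i) (\<Prod>i\<in>?B. f i)"
    using agree2_mult[of n' k' "\<Prod>i\<in>S - ?B. f i" 1 "\<Prod>i\<in>?B. f i"] by simp
  then show "fps_nth (fps_nth (formal_prod f A) n') k' = fps_nth (fps_nth (\<Prod>i\<in>S. f i) n') k'"
    by (simp add: formal_prod_def agree2_def)
qed

lemma has_formal_prod_formal_prod:
  assumes "\<And>n k. finite {i \<in> A. \<not> agree2 n k (f i) 1}"
  shows "has_formal_prod f A (formal_prod f A)"
  unfolding has_formal_prod_def
proof (intro allI)
  fix n k
  show "\<forall>\<^sub>F S in finite_subsets_at_top A. fps_nth (fps_nth (\<Prod>i\<in>S. f i) n) k = fps_nth (fps_nth (formal_prod f A) n) k"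
    unfolding eventually_finite_subsets_at_top
  proof (intro exI conjI allI impI)
    show "finite {i \<in> A. \<not> agree2 n k (f i) 1}" by (rule assms)
    show "{i \<in> A. \<not> agree2 n k (f i) 1} \<subseteq> A" by blast
    fix S assume "finite S \<and> {i \<in> A. \<not> agree2 n k (f i) 1} \<subseteq> S \<and> S \<subseteq> A"
    then have "agree2 n k (formal_prod f A) (\<Prod>i\<in>S. f i)" by (intro formal_prod_partial) auto
    then show "fps_nth (fps_nth (\<Prod>i\<in>S. f i) n) k = fps_nth (fps_nth (formal_prod f A) n) k"
      by (simp add: agree2_def)
  qed
qed

lemma graded_formal_prod:
  assumes "\<And>i. i \<in> A \<Longrightarrow> graded (f i)"
  shows "graded (formal_prod f A)"
proof -
  have "graded (\<Prod>i\<in>{i \<in> A. \<not> agree2 n k (f i) 1}. f i)" for n k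
    using assms by (intro graded_prod) auto
  then show ?thesis by (simp add: graded_def u_bounded_def formal_prod_def)
qed

section \<open>The specialised product side\<close>

lemma fls_X_powi: "fls_X powi k = (fls_shift (- k) 1 :: 'a::field fls)"
proof (cases "k \<ge> 0")
  case True
  then show ?thesis by (simp add: power_int_def fls_X_power_conv_shift_1)
next
  case False
  define n where "n = nat (- k)"
  have "fls_X ^ n * fls_shift (int n) (1 :: 'a fls) = 1"
    by (simp add: fls_X_power_conv_shift_1 fls_X_intpow_times_conv_shift)
  then have "inverse (fls_X ^ n) = fls_shift (int n) (1 :: 'a fls)" by (rule inverse_unique)
  then show ?thesis using False by (simp add: power_int_def n_def power_inverse)
qed

lemma principal_fls_X: "0 < g \<Longrightarrow> principal (fls_X :: rat fls) g"
proof
  fix k :: int assume k: "k \<noteq> 0"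
  have "fls_nth (fls_X powi k :: rat fls) k = 1" unfolding fls_X_powi by simp
  moreover have "fls_nth (1 :: rat fls) k = 0" using k by simp
  ultimately show "(fls_X powi k :: rat fls) \<noteq> 1" by (metis zero_neq_one)
qed auto

section \<open>Order in q of Laurent series, and closeness to 1\<close>

definition ord_ge :: "int \<Rightarrow> 'a::field fls \<Rightarrow> bool" where
  "ord_ge E x \<longleftrightarrow> (\<forall>k<E. fls_nth x k = 0)"

lemma ord_ge_zero [simp]: "ord_ge E 0" by (simp add: ord_ge_def)
lemma ord_ge_mono: "ord_ge E x \<Longrightarrow> E' \<le> E \<Longrightarrow> ord_ge E' x" by (simp add: ord_ge_def)
lemma ord_ge_add: "ord_ge E x \<Longrightarrow> ord_ge E y \<Longrightarrow> ord_ge E (x + y)" by (simp add: ord_ge_def)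
lemma ord_ge_diff: "ord_ge E x \<Longrightarrow> ord_ge E y \<Longrightarrow> ord_ge E (x - y)" by (simp add: ord_ge_def)
lemma ord_ge_uminus: "ord_ge E x \<Longrightarrow> ord_ge E (- x)" by (simp add: ord_ge_def)

lemma ord_ge_sum: "(\<And>i. i \<in> I \<Longrightarrow> ord_ge E (f i)) \<Longrightarrow> ord_ge E (\<Sum>i\<in>I. f i)"
  by (induction I rule: infinite_finite_induct) (auto intro: ord_ge_add)

lemma ord_ge_subdegree: "ord_ge E x \<Longrightarrow> x \<noteq> 0 \<Longrightarrow> E \<le> fls_subdegree x"
  by (intro fls_subdegree_geI) (auto simp: ord_ge_def)

lemma ord_ge_mult: "ord_ge E x \<Longrightarrow> ord_ge E' y \<Longrightarrow> ord_ge (E + E') (x * y)"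
proof (cases "x = 0 \<or> y = 0")
  case False
  assume "ord_ge E x" "ord_ge E' y"
  then have "E + E' \<le> fls_subdegree x + fls_subdegree y" using ord_ge_subdegree False by (intro add_mono) auto
  then show ?thesis unfolding ord_ge_def by (auto intro: fls_times_nth_eq0)
qed auto

lemma ord_ge_powi: "E \<le> k \<Longrightarrow> ord_ge E (fls_X powi k)"
  by (auto simp: ord_ge_def fls_X_powi)

lemma ord_ge_exists: "\<exists>c\<ge>0. ord_ge (- c) x"
  by (rule exI[of _ "max 0 (- fls_subdegree x)"]) (auto simp: ord_ge_def)

lemma ord_ge_all_imp_0: "(\<And>E. ord_ge E x) \<Longrightarrow> x = 0"
proof (rule fls_zero_eqI)
  fix n assume "\<And>E. ord_ge E x"
  then show "fls_nth x n = 0" using ord_ge_def[of "n + 1" x] by simp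
qed

definition ords_ge :: "int \<Rightarrow> 'a::field fls fps \<Rightarrow> bool" where
  "ords_ge E f \<longleftrightarrow> (\<forall>n. ord_ge E (fps_nth f n))"

lemma ords_ge_mult: "ords_ge E f \<Longrightarrow> ords_ge E' h \<Longrightarrow> ords_ge (E + E') (f * h)"
  by (auto simp: ords_ge_def fps_mult_nth intro!: ord_ge_sum ord_ge_mult)

lemma ords_ge_add: "ords_ge E f \<Longrightarrow> ords_ge E h \<Longrightarrow> ords_ge E (f + h)"
  by (simp add: ords_ge_def ord_ge_add)

lemma ords_ge_one: "ords_ge 0 1"
  by (auto simp: ords_ge_def fps_one_nth ord_ge_def)

definition near :: "int \<Rightarrow> 'a::field fls fps \<Rightarrow> bool" where
  "near E f \<longleftrightarrow> ords_ge E (f - 1)"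

lemma near_imp_ords_ge: "near E f \<Longrightarrow> 0 \<le> E \<Longrightarrow> ords_ge 0 f"
  using ords_ge_add[of 0 "f - 1" 1] ords_ge_one unfolding near_def ords_ge_def
  by (auto intro: ord_ge_mono)

lemma near_mult: "near E f \<Longrightarrow> near E h \<Longrightarrow> 0 \<le> E \<Longrightarrow> near E (f * h)"
proof -
  assume f: "near E f" and h: "near E h" and E: "0 \<le> E"
  have eq: "f * h - 1 = (f - 1) * h + (h - 1)" by (simp add: algebra_simps)
  have "ords_ge (E + 0) ((f - 1) * h)"
    using f near_imp_ords_ge[OF h E] unfolding near_def by (rule ords_ge_mult)
  then show ?thesis using h unfolding near_def eq by (simp add: ords_ge_add)
qed

lemma near_one [simp]: "near E 1"
  by (simp add: near_def ords_ge_def)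

lemma near_prod: "(\<And>i. i \<in> I \<Longrightarrow> near E (f i)) \<Longrightarrow> 0 \<le> E \<Longrightarrow> near E (\<Prod>i\<in>I. f i)"
  by (induction I rule: infinite_finite_induct) (auto intro: near_mult)

lemma near_power: "near E f \<Longrightarrow> 0 \<le> E \<Longrightarrow> near E (f ^ k)"
  using near_prod[of "{..<k}" E "\<lambda>_. f"] by simp

text \<open>The coefficients of the inverse have nonnegative order by recursion; the estimate then
  follows from inverse f - 1 = - inverse f (f - 1).\<close>

lemma near_inverse:
  assumes f: "near E f" and f0: "fps_nth f 0 = 1" and E: "0 \<le> E"
  shows "near E (inverse f)"
proof -
  let ?h = "inverse f"
  have hf: "?h * f = 1" using f0 by (intro inverse_mult_eq_1) simp
  have fi: "ords_ge 0 f" using f E by (rule near_imp_ords_ge)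
  have "ord_ge 0 (fps_nth ?h n)" for n
  proof (induction n rule: less_induct)
    case (less n)
    have "{0..n} = insert n {0..<n}" by auto
    then have "fps_nth (?h * f) n = (\<Sum>i\<in>{0..<n}. fps_nth ?h i * fps_nth f (n - i)) + fps_nth ?h n"
      by (simp add: fps_mult_nth f0 add.commute)
    then have eq: "fps_nth ?h n = fps_nth (1 :: 'a fls fps) n - (\<Sum>i\<in>{0..<n}. fps_nth ?h i * fps_nth f (n - i))"
      unfolding hf by simp
    have "ord_ge 0 (fps_nth ?h i * fps_nth f (n - i))" if "i \<in> {0..<n}" for i
      using ord_ge_mult[OF less.IH[of i], of 0 "fps_nth f (n - i)"] that fi by (simp add: ords_ge_def)
    moreover have "ord_ge 0 (fps_nth (1 :: 'a fls fps) n)" using ords_ge_one unfolding ords_ge_def by blast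
    ultimately show ?case unfolding eq by (intro ord_ge_diff ord_ge_sum)
  qed
  then have "ords_ge (0 + E) (?h * (f - 1))" using f unfolding near_def by (intro ords_ge_mult) (simp_all add: ords_ge_def)
  moreover have "?h - 1 = - (?h * (f - 1))" using hf by (simp add: algebra_simps)
  ultimately show ?thesis unfolding near_def by (simp add: ords_ge_def ord_ge_uminus)
qed

definition lin :: "'a::field \<Rightarrow> nat \<Rightarrow> 'a fps" where
  "lin c m = 1 - fps_const c * fps_X ^ m"

lemma lin_nth_0: "0 < m \<Longrightarrow> fps_nth (lin c m) 0 = 1"
  by (simp add: lin_def)

lemma near_lin: "ord_ge E c \<Longrightarrow> near E (lin c m)"
  by (auto simp: near_def lin_def ords_ge_def fps_X_power_nth ord_ge_uminus)

lemma prod_nth_0: "(\<And>i. i \<in> I \<Longrightarrow> fps_nth (f i) 0 = 1) \<Longrightarrow> fps_nth (\<Prod>i\<in>I. f i :: 'a::comm_ring_1 fps) 0 = 1"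
  by (simp add: fps_prod_nth_0)

text \<open>Products shifted by different c are rewritten over one common range of s, with the shift
  moved into the exponent, so that exponents can be compared factor by factor; the part beyond
  \<open>hi\<close> is left as a tail.\<close>

lemma prod_window:
  fixes a :: "int \<Rightarrow> 'a::comm_monoid_mult"
  assumes \<epsilon>: "\<And>s. s \<le> 0 \<Longrightarrow> \<epsilon> s = 0" and c: "lo \<le> c" "hi = int N + lo"
  shows "(\<Prod>r=1..N. a (int r + c) ^ \<epsilon> (int r)) =
    (\<Prod>s=lo..hi. a s ^ \<epsilon> (s - c)) * (\<Prod>r\<in>{r\<in>{1..N}. hi < int r + c}. a (int r + c) ^ \<epsilon> (int r))"
proof -
  let ?T = "{r\<in>{1..N}. hi < int r + c}"
  have "(\<Prod>r=1..N. a (int r + c) ^ \<epsilon> (int r)) =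
     (\<Prod>r\<in>{1..N} - ?T. a (int r + c) ^ \<epsilon> (int r)) * (\<Prod>r\<in>?T. a (int r + c) ^ \<epsilon> (int r))"
    by (rule prod.subset_diff) auto
  also have "(\<Prod>r\<in>{1..N} - ?T. a (int r + c) ^ \<epsilon> (int r)) = (\<Prod>s=1 + c..hi. a s ^ \<epsilon> (s - c))"
    by (rule prod.reindex_bij_witness[of _ "\<lambda>s. nat (s - c)" "\<lambda>r. int r + c"]) (use c in auto)
  also have "\<dots> = (\<Prod>s=lo..hi. a s ^ \<epsilon> (s - c))"
    by (rule prod.mono_neutral_left) (use c \<epsilon> in auto)
  finally show ?thesis .
qed

text \<open>At \<open>u = - q^(2g)\<close> the four factors with exponent \<open>\<lceil>r/2\<rceil>\<close> are shifts in \<open>r\<close> of one and the same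
  factor, so their exponents cancel outside a finite window.\<close>

definition half :: "int \<Rightarrow> nat" where "half s = nat ((s + 1) div 2)"

text \<open>This is g minus \<bar>s\<bar> / 2 rounded up, cut off at 0: the surplus of numerator
  over denominator at q^(2s).\<close>

definition excess :: "nat \<Rightarrow> int \<Rightarrow> nat" where
  "excess g s = nat (int g - (if s \<ge> 0 then (s + 1) div 2 else - (s div 2)))"

text \<open>The shifts 1 - 2g and 2g on the left belong to the numerator, the shifts 0 and 1 on the
  right to the denominator.\<close>

lemma half_excess: "half (s - (1 - 2 * int g)) + half (s - 2 * int g) = half s + half (s - 1) + excess g s"
proof -
  define \<alpha> \<beta> where "\<alpha> = s div 2" and "\<beta> = (s + 1) div 2"
  have 1: "(s - (1 - 2 * int g) + 1) div 2 = \<alpha> + int g" "(s - 2 * int g + 1) div 2 = \<beta> - int g" "(s - 1 + 1) div 2 = \<alpha>"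
    unfolding \<alpha>_def \<beta>_def by presburger+
  have 2: "s \<ge> 0 \<Longrightarrow> \<alpha> \<ge> 0" "s \<ge> 0 \<Longrightarrow> \<beta> \<ge> 0" "s < 0 \<Longrightarrow> \<alpha> < 0" "s < 0 \<Longrightarrow> \<beta> \<le> 0"
    unfolding \<alpha>_def \<beta>_def by presburger+
  show ?thesis
    unfolding half_def excess_def 1 \<alpha>_def[symmetric] \<beta>_def[symmetric] using 2 by (cases "s \<ge> 0") auto
qed

lemma excess_eq_0: "2 * int g \<le> \<bar>s\<bar> \<Longrightarrow> excess g s = 0"
  unfolding excess_def by (simp split: if_splits; presburger)

lemma excess_Suc: "excess (Suc g) s = excess g s + (if \<bar>s\<bar> \<le> 2 * int g then 1 else 0)"
proof -
  define c where "c = (if s \<ge> 0 then (s + 1) div 2 else - (s div 2))"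
  have "c \<le> int g \<longleftrightarrow> \<bar>s\<bar> \<le> 2 * int g" unfolding c_def by (cases "s \<ge> 0"; simp; presburger)
  moreover have "nat (int (Suc g) - c) = nat (int g - c) + (if c \<le> int g then 1 else 0)" by auto
  ultimately show ?thesis unfolding excess_def c_def[symmetric] by simp
qed

lemma prod_symmetric_window:
  fixes a :: "int \<Rightarrow> 'a::comm_monoid_mult"
  shows "(\<Prod>s=- (2 * int g)..2 * int g. a s) =
     a 0 * (\<Prod>i<g. (a (int i + int g + 1) * a (- (int i + int g + 1))) * (a (int g - int i) * a (- (int g - int i))))"
proof -
  define h where "h = (\<lambda>s. a s * a (- s))"
  have "{- (2 * int g)..2 * int g} = insert 0 ({1..2 * int g} \<union> {- (2 * int g)..-1})" by auto
  then have "(\<Prod>s=- (2 * int g)..2 * int g. a s) = a 0 * ((\<Prod>s=1..2 * int g. a s) * (\<Prod>s=- (2 * int g)..-1. a s))"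
    by (simp add: prod.union_disjoint)
  also have "(\<Prod>s=- (2 * int g)..-1. a s) = (\<Prod>s=1..2 * int g. a (- s))"
    by (rule prod.reindex_bij_witness[of _ uminus uminus]) auto
  also have "(\<Prod>s=1..2 * int g. a s) * (\<Prod>s=1..2 * int g. a (- s)) = (\<Prod>s=1..2 * int g. h s)"
    by (simp add: h_def prod.distrib)
  also have "\<dots> = (\<Prod>s=int g + 1..2 * int g. h s) * (\<Prod>s=1..int g. h s)"
  proof -
    have "{1..2 * int g} = {int g + 1..2 * int g} \<union> {1..int g}" by auto
    then show ?thesis by (simp add: prod.union_disjoint)
  qed
  also have "(\<Prod>s=int g + 1..2 * int g. h s) = (\<Prod>i<g. h (int i + int g + 1))"
    by (rule prod.reindex_bij_witness[of _ "\<lambda>i. int i + int g + 1" "\<lambda>s. nat (s - int g - 1)"]) auto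
  also have "(\<Prod>s=1..int g. h s) = (\<Prod>i<g. h (int g - int i))"
    by (rule prod.reindex_bij_witness[of _ "\<lambda>i. int g - int i" "\<lambda>s. nat (int g - s)"]) auto
  finally show ?thesis by (simp add: h_def prod.distrib)
qed

lemma pairs_Suc: "pairs (Suc g) = pairs g \<union> (\<lambda>i. (i, g)) ` {..<g}"
  by (auto simp: pairs_def)

text \<open>The surplus counts the long roots by their value at the principal point: s is plus or
  minus i + j + 1 or j - i. Passing from g to g + 1 adds one to the exponent for \<bar>s\<bar> \<le>
  2g, and for s different from 0 these are the values of the new pairs (i, g).\<close>

lemma prod_excess:
  fixes a :: "int \<Rightarrow> 'a::comm_monoid_mult"
  shows "(\<Prod>s=- (2 * int g)..2 * int g. a s ^ excess g s) =
     a 0 ^ g * (\<Prod>(i, j)\<in>pairs g. (a (int i + int j + 1) * a (- (int i + int j + 1))) * (a (int j - int i) * a (- (int j - int i))))"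
proof (induction g)
  case 0
  then show ?case by (simp add: excess_def pairs_def)
next
  case (Suc g)
  let ?f = "\<lambda>(i, j). (a (int i + int j + 1) * a (- (int i + int j + 1))) * (a (int j - int i) * a (- (int j - int i)))"
  let ?I = "{- (2 * int (Suc g))..2 * int (Suc g)}"
  have "(\<Prod>s\<in>?I. a s ^ excess (Suc g) s) = (\<Prod>s\<in>?I. a s ^ excess g s) * (\<Prod>s\<in>?I. if \<bar>s\<bar> \<le> 2 * int g then a s else 1)"
    unfolding prod.distrib[symmetric] by (rule prod.cong) (auto simp: excess_Suc power_add)
  also have "(\<Prod>s\<in>?I. a s ^ excess g s) = (\<Prod>s=- (2 * int g)..2 * int g. a s ^ excess g s)"
    by (rule prod.mono_neutral_right) (auto simp: excess_eq_0)
  also have "(\<Prod>s\<in>?I. if \<bar>s\<bar> \<le> 2 * int g then a s else 1) = (\<Prod>s=- (2 * int g)..2 * int g. a s)"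
    by (rule prod.mono_neutral_cong_right) auto
  also have "\<dots> = a 0 * (\<Prod>i<g. ?f (i, g))"
    unfolding prod_symmetric_window case_prod_conv ..
  also have "(\<Prod>i<g. ?f (i, g)) = (\<Prod>p\<in>(\<lambda>i. (i, g)) ` {..<g}. ?f p)"
    by (subst prod.reindex) (auto intro: inj_onI)
  finally have "(\<Prod>s\<in>?I. a s ^ excess (Suc g) s) = a 0 ^ Suc g * ((\<Prod>p\<in>pairs g. ?f p) * (\<Prod>p\<in>(\<lambda>i. (i, g)) ` {..<g}. ?f p))"
    unfolding Suc.IH by (simp only: power_Suc mult_ac)
  also have "(\<Prod>p\<in>pairs g. ?f p) * (\<Prod>p\<in>(\<lambda>i. (i, g)) ` {..<g}. ?f p) = (\<Prod>p\<in>pairs (Suc g). ?f p)"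
    unfolding pairs_Suc by (rule prod.union_disjoint[symmetric]) (simp_all, auto simp: pairs_def)
  finally show ?case .
qed

text \<open>The factor at level m that the double product should specialise to. The power g of 1 -
  t^(2m) is the contribution of s = 0, where the excess is g.\<close>

definition level_factor :: "nat \<Rightarrow> nat \<Rightarrow> rat fls fps" where
  "level_factor g m = (1 - fps_X ^ (2 * m)) ^ g * affine_term g (\<lambda>i. fls_X powi (2 * int i + 1)) m"

text \<open>At the principal point the short roots give the odd exponents 2 s - 1 with 1 - g \<le> s
  \<le> g, each once, and the long roots the even exponents with the multiplicities of
  \<open>prod_excess\<close>.\<close>

lemma level_factor_eq:
  "level_factor g m =
    (\<Prod>s=1 - int g..int g. lin (- (fls_X powi (2 * s - 1))) m) *
    (\<Prod>s=- (2 * int g)..2 * int g. lin (fls_X powi (2 * s)) (2 * m) ^ excess g s)"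
proof -
  define w :: "rat fls" where "w = fls_X"
  have X: "w \<noteq> 0" by (simp add: w_def)
  have add: "w powi (a + b) = w powi a * w powi b" for a b using X by (simp add: power_int_add)
  have inv: "inverse (w powi a) = w powi (- a)" for a by (simp add: power_int_minus)
  define b where "b = (\<lambda>s. lin (- (w powi (2 * s - 1))) m)"
  define a where "a = (\<lambda>s. lin (w powi (2 * s)) (2 * m))"
  have "{1 - int g..int g} = {1..int g} \<union> {1 - int g..0}" by auto
  then have "(\<Prod>s=1 - int g..int g. b s) = (\<Prod>s=1..int g. b s) * (\<Prod>s=1 - int g..0. b s)"
    by (simp add: prod.union_disjoint)
  also have "(\<Prod>s=1..int g. b s) = (\<Prod>i<g. b (int i + 1))"
    by (rule prod.reindex_bij_witness[of _ "\<lambda>i. int i + 1" "\<lambda>s. nat (s - 1)"]) auto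
  also have "(\<Prod>s=1 - int g..0. b s) = (\<Prod>i<g. b (- int i))"
    by (rule prod.reindex_bij_witness[of _ "\<lambda>i. - int i" "\<lambda>s. nat (- s)"]) auto
  also have "(\<Prod>i<g. b (int i + 1)) * (\<Prod>i<g. b (- int i)) = (\<Prod>i<g. theta_term 1 (w powi (2 * int i + 1)) m)"
    unfolding prod.distrib[symmetric]
  proof (rule prod.cong[OF refl])
    fix i
    have e: "2 * (int i + 1) - 1 = 2 * int i + 1" "2 * (- int i) - 1 = - (2 * int i + 1)" by simp_all
    show "b (int i + 1) * b (- int i) = theta_term 1 (w powi (2 * int i + 1)) m"
      unfolding b_def theta_term_def lin_def e inv by (simp flip: fps_const_neg)
  qed
  finally have short: "(\<Prod>s=1 - int g..int g. b s) = (\<Prod>i<g. theta_term 1 (w powi (2 * int i + 1)) m)" .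
  have T: "theta_term 2 (- (w powi (2 * s))) m = a s * a (- s)" for s
  proof -
    have "inverse (- (w powi (2 * s))) = - (w powi (2 * (- s)))" by (simp add: power_int_minus)
    then show ?thesis unfolding theta_term_def a_def lin_def by (simp flip: fps_const_neg)
  qed
  have "(\<Prod>s=- (2 * int g)..2 * int g. a s ^ excess g s) = (1 - fps_X ^ (2 * m)) ^ g *
     (\<Prod>(i, j)\<in>pairs g. theta_term 2 (- (w powi (2 * int i + 1) * w powi (2 * int j + 1))) m *
        theta_term 2 (- (w powi (2 * int i + 1) / w powi (2 * int j + 1))) m)"
    unfolding prod_excess
  proof (intro arg_cong2[of _ _ _ _ "(*)"] prod.cong refl)
    show "a 0 ^ g = (1 - fps_X ^ (2 * m)) ^ g" by (simp add: a_def lin_def)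
    fix p assume "p \<in> pairs g"
    obtain i j where p: "p = (i, j)" by (cases p)
    have e: "w powi (2 * int i + 1) * w powi (2 * int j + 1) = w powi (2 * (int i + int j + 1))"
      "w powi (2 * int i + 1) / w powi (2 * int j + 1) = w powi (2 * (- (int j - int i)))"
      by (simp_all add: divide_inverse inv algebra_simps flip: add)
    show "(case p of (i, j) \<Rightarrow> a (int i + int j + 1) * a (- (int i + int j + 1)) * (a (int j - int i) * a (- (int j - int i)))) =
      (case p of (i, j) \<Rightarrow> theta_term 2 (- (w powi (2 * int i + 1) * w powi (2 * int j + 1))) m *
        theta_term 2 (- (w powi (2 * int i + 1) / w powi (2 * int j + 1))) m)"
      unfolding p case_prod_conv e T by (simp add: mult_ac)
  qed
  then show ?thesis
    unfolding level_factor_def affine_term_def w_def[symmetric] using short by (simp add: a_def b_def mult_ac)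
qed

section \<open>The factors of the double product and their specialisation\<close>

definition product_factor :: "nat \<times> nat \<Rightarrow> series" where
  "product_factor = (\<lambda>(m::nat, r::nat).
         ((1 - u_pow (-1) * q ^ (2 * r - 1) * t ^ m) \<oslash> (1 - u_pow 1 * q ^ (2 * r - 1) * t ^ m)) *
         (((1 - u_pow (-2) * q ^ (2 * (r + 1)) * t ^ (2 * m)) ^ nat \<lceil>real r / 2\<rceil> *
           (1 - u_pow 2 * q ^ (2 * r) * t ^ (2 * m)) ^ nat \<lceil>real r / 2\<rceil>) \<oslash>
          ((1 - q ^ (2 * r) * t ^ (2 * m)) ^ nat \<lceil>real r / 2\<rceil> *
           (1 - q ^ (2 * (r + 1)) * t ^ (2 * m)) ^ nat \<lceil>real r / 2\<rceil>)))"

definition factor_num :: "nat \<Rightarrow> nat \<Rightarrow> series" where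
  "factor_num m r = (1 - smono (-1) (2 * r - 1) m) *
     ((1 - smono (-2) (2 * (r + 1)) (2 * m)) ^ half (int r) * (1 - smono 2 (2 * r) (2 * m)) ^ half (int r))"

definition factor_den :: "nat \<Rightarrow> nat \<Rightarrow> series" where
  "factor_den m r = (1 - smono 1 (2 * r - 1) m) *
     ((1 - smono 0 (2 * r) (2 * m)) ^ half (int r) * (1 - smono 0 (2 * (r + 1)) (2 * m)) ^ half (int r))"

lemma nat_ceiling_half: "nat \<lceil>real r / 2\<rceil> = half (int r)"
proof -
  have "\<lceil>real r / 2\<rceil> = (int r + 1) div 2"
  proof (rule ceiling_unique)
    have "2 * ((int r + 1) div 2) \<le> int r + 1" "int r \<le> 2 * ((int r + 1) div 2)" by presburger+
    then have "2 * real_of_int ((int r + 1) div 2) \<le> real r + 1" "real r \<le> 2 * real_of_int ((int r + 1) div 2)"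
      by linarith+
    then show "real_of_int ((int r + 1) div 2) - 1 < real r / 2" "real r / 2 \<le> real_of_int ((int r + 1) div 2)"
      by linarith+
  qed
  then show ?thesis by (simp add: half_def)
qed

lemma u_pow_0: "u_pow 0 = 1"
  by (simp add: u_pow_def)

lemma factor_den_0: "0 < m \<Longrightarrow> fps_nth (factor_den m r) 0 = 1"
  by (simp add: factor_den_def smono_nth fps_power_zeroth)

lemma product_factor_mult:
  assumes "0 < m"
  shows "product_factor (m, r) * factor_den m r = factor_num m r"
proof -
  have s0: "q ^ a * t ^ b = smono 0 a b" for a b using smono_eq[of 0 a b] by (simp add: u_pow_0)
  have c: "fps_nth (fps_nth d 0) 0 = 1 \<Longrightarrow> (f \<oslash> d) * d = f" for f d :: series
    by (rule series_divide_mult_cancel)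
  let ?N1 = "1 - smono (-1) (2 * r - 1) m" and ?D1 = "1 - smono 1 (2 * r - 1) m"
  let ?N2 = "(1 - smono (-2) (2 * (r + 1)) (2 * m)) ^ half (int r) * (1 - smono 2 (2 * r) (2 * m)) ^ half (int r)"
  let ?D2 = "(1 - smono 0 (2 * r) (2 * m)) ^ half (int r) * (1 - smono 0 (2 * (r + 1)) (2 * m)) ^ half (int r)"
  have "product_factor (m, r) = (?N1 \<oslash> ?D1) * (?N2 \<oslash> ?D2)"
    by (simp only: product_factor_def case_prod_conv smono_eq s0 nat_ceiling_half)
  then have "product_factor (m, r) * factor_den m r = ((?N1 \<oslash> ?D1) * ?D1) * ((?N2 \<oslash> ?D2) * ?D2)"
    by (simp only: factor_den_def mult_ac)
  also have "(?N1 \<oslash> ?D1) * ?D1 = ?N1" using assms by (intro c) (simp add: smono_nth)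
  also have "(?N2 \<oslash> ?D2) * ?D2 = ?N2" using assms by (intro c) (simp add: smono_nth fps_power_zeroth)
  finally show ?thesis by (simp add: factor_num_def)
qed

lemma graded_factor: "graded (factor_num m r)" "graded (factor_den m r)" if "0 < m"
  using that unfolding factor_num_def factor_den_def
  by (auto intro!: graded_mult graded_power graded_diff graded_smono)

lemma graded_product_factor:
  assumes "0 < m"
  shows "graded (product_factor (m, r))"
  using graded_cancel[of "product_factor (m, r)" "factor_den m r"] graded_factor[OF assms] factor_den_0[OF assms]
  by (simp add: product_factor_mult[OF assms])

lemma agree2_one_minus_smono: "n < m \<or> k < a \<Longrightarrow> agree2 n k (1 - smono j a m) 1"
  by (auto simp: agree2_def smono_nth u_mono_nth)

lemma agree2_power_one: "agree2 n k f 1 \<Longrightarrow> agree2 n k (f ^ e) 1"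
  using agree2_prod_one[of "{..<e}" n k "\<lambda>_. f"] by simp

lemma agree2_sym: "agree2 n k f h \<Longrightarrow> agree2 n k h f" by (simp add: agree2_def)
lemma agree2_trans: "agree2 n k f h \<Longrightarrow> agree2 n k h e \<Longrightarrow> agree2 n k f e" by (simp add: agree2_def)

text \<open>The lowest powers occurring besides 1 are t^m and q^(2r - 1); the quotient is treated
  through its cleared form.\<close>

lemma agree2_product_factor:
  assumes m: "0 < m" and r: "0 < r" and out: "n < m \<or> k < 2 * r - 1"
  shows "agree2 n k (product_factor (m, r)) 1"
proof (rule agree2_cancel)
  have one: "agree2 n k (f * h) 1" if "agree2 n k f 1" "agree2 n k h 1" for f h
    using agree2_mult[OF that] by simp
  have "agree2 n k (factor_num m r) 1" "agree2 n k (factor_den m r) 1"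
    unfolding factor_num_def factor_den_def
    by (intro one agree2_power_one agree2_one_minus_smono; use out r in auto)+
  then show "agree2 n k (product_factor (m, r) * factor_den m r) (factor_den m r)"
    unfolding product_factor_mult[OF m] using agree2_sym agree2_trans by blast
qed (simp add: factor_den_0[OF m])

definition product_Q :: series where
  "product_Q = formal_prod product_factor ({1..} \<times> {1..})"

lemma bad_factors: "{i \<in> {1..} \<times> {1..}. \<not> agree2 n k (product_factor i) 1} \<subseteq> {1..n} \<times> {r. 1 \<le> r \<and> 2 * r - 1 \<le> k}"
proof
  fix i assume "i \<in> {i \<in> {1..} \<times> {1..}. \<not> agree2 n k (product_factor i) 1}"
  then obtain m r where i: "i = (m, r)" "1 \<le> m" "1 \<le> r" "\<not> agree2 n k (product_factor (m, r)) 1" by auto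
  then have "\<not> (n < m \<or> k < 2 * r - 1)" using agree2_product_factor[of m r n k] by auto
  then show "i \<in> {1..n} \<times> {r. 1 \<le> r \<and> 2 * r - 1 \<le> k}" using i by (simp add: not_less)
qed

lemma has_formal_prod_Q: "has_formal_prod product_factor ({1..} \<times> {1..}) product_Q"
  unfolding product_Q_def
proof (rule has_formal_prod_formal_prod)
  fix n k :: nat
  have "{r. 1 \<le> r \<and> 2 * r - 1 \<le> k} \<subseteq> {..k}" by auto
  then have "finite ({1..n} \<times> {r. 1 \<le> r \<and> 2 * r - 1 \<le> k})" by (auto intro: finite_subset)
  then show "finite {i \<in> {1..} \<times> {1..}. \<not> agree2 n k (product_factor i) 1}"
    by (rule finite_subset[OF bad_factors])
qed

lemma graded_Q: "graded product_Q"
  unfolding product_Q_def by (rule graded_formal_prod) (auto intro: graded_product_factor)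

definition u_value :: "nat \<Rightarrow> rat fls" where "u_value g = - (fls_X powi (2 * int g))"

lemma u_value_nonzero [simp]: "u_value g \<noteq> 0" by (simp add: u_value_def)

lemma u_value_powi: "u_value g powi j = (-1) powi j * fls_X powi (2 * int g * j)"
proof -
  have "u_value g powi j = ((-1) * fls_X powi (2 * int g)) powi j" by (simp add: u_value_def)
  then show ?thesis by (simp only: power_int_mult_distrib power_int_mult)
qed

lemma ord_ge_u_value_powi: "ord_ge (2 * int g * j) (u_value g powi j)"
proof -
  have "u_value g powi j = fls_X powi (2 * int g * j) \<or> u_value g powi j = - (fls_X powi (2 * int g * j))"
    unfolding u_value_powi by (cases "even j") (auto simp: power_int_minus_left)
  then show ?thesis using ord_ge_powi ord_ge_uminus by (metis order_refl)
qed

lemma series_eval_lin: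
  assumes "j = 0 \<or> j = 1 \<or> j = -1 \<or> j = 2 \<or> j = -2"
  shows "series_eval (u_value g) (1 - smono j a m) =
    lin ((if odd j then -1 else 1) * fls_X powi (int a + 2 * int g * j)) m"
proof -
  have "fls_X ^ a * u_value g powi j = (if odd j then -1 else 1) * fls_X powi (int a + 2 * int g * j)"
  proof -
    have "(fls_X :: rat fls) ^ a * fls_X powi b = fls_X powi (int a + b)" for b
      unfolding power_int_of_nat[symmetric] by (rule power_int_add[symmetric]) simp
    then have F: "(if odd j then -1 else 1) * ((fls_X :: rat fls) ^ a * fls_X powi b) = (if odd j then -1 else 1) * fls_X powi (int a + b)" for b
      by (simp only:)
    have S: "(-1 :: rat fls) powi j = (if odd j then -1 else 1)"
      using assms by (auto simp: power_int_minus_left)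
    show ?thesis unfolding u_value_powi S F[symmetric] by (rule mult.left_commute)
  qed
  then show ?thesis unfolding series_eval_one_minus_smono lin_def by simp
qed

lemma tame_power: "tame f \<Longrightarrow> tame (f ^ k)"
  by (induction k) (auto intro: tame_mult)

lemma series_eval_power: "U \<noteq> 0 \<Longrightarrow> tame f \<Longrightarrow> series_eval U (f ^ k) = series_eval U f ^ k"
  by (induction k) (auto simp: series_eval_one series_eval_mult tame_power)

lemma tame_one_minus_smono: "tame (1 - smono j a m)"
  unfolding tame_def fps_sub_nth
proof (intro allI u_finite_diff)
  show "u_finite (fps_nth 1 n)" for n using tame_one by (simp only: tame_def)
  show "u_finite (fps_nth (smono j a m) n)" for n by (simp add: smono_nth)
qed

text \<open>After the substitution all factors are shifts of the two families \<open>a\<close> and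
  \<open>b\<close>. Inside a common window the exponents cancel up to \<open>level_factor\<close>,
  while the tails consist of factors of high order in q and form \<beta>.\<close>

lemma level_product:
  assumes g: "0 < g" and m: "0 < m" and N: "4 * g \<le> N"
  obtains \<beta> where "(\<Prod>r=1..N. series_eval (u_value g) (product_factor (m, r))) = level_factor g m * \<beta>"
    "near (2 * (int N - 2 * int g)) \<beta>"
proof -
  \<comment> \<open>The largest downward shift is by 2g - 1, so a window that starts at - 2g and has
    hi + 2g = N fits all shifts.\<close>
  define hi where "hi = int N - 2 * int g"
  have hi: "2 * int g \<le> hi" using N by (simp add: hi_def)
  define a where "a = (\<lambda>s. lin ((fls_X :: rat fls) powi (2 * s)) (2 * m))"
  define b where "b = (\<lambda>s. lin (- ((fls_X :: rat fls) powi (2 * s - 1))) m)"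
  define one where "one = (\<lambda>s::int. if 1 \<le> s then 1 else 0 :: nat)"
  let ?lo = "- (2 * int g)"
  let ?E = "2 * hi"
  have E: "0 \<le> ?E" using hi by simp
  have half0: "half s = 0" if "s \<le> 0" for s
  proof -
    have "(s + 1) div 2 \<le> 0" using that by presburger
    then show ?thesis by (simp add: half_def)
  qed
  have one0: "one s = 0" if "s \<le> 0" for s using that by (simp add: one_def)
  have near_a: "near ?E (a s)" if "hi < s" for s
    unfolding a_def by (intro near_lin ord_ge_powi) (use that in simp)
  have near_b: "near ?E (b s)" if "hi < s" for s
    unfolding b_def by (intro near_lin ord_ge_uminus ord_ge_powi) (use that in simp)
  have a0: "fps_nth (a s) 0 = 1" and b0: "fps_nth (b s) 0 = 1" for s
    using m by (simp_all add: a_def b_def lin_nth_0)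
  define A where "A = (\<lambda>c. \<Prod>s=?lo..hi. a s ^ half (s - c))"
  define B where "B = (\<lambda>c. \<Prod>s=?lo..hi. b s ^ one (s - c))"
  define TA where "TA = (\<lambda>c. \<Prod>r\<in>{r\<in>{1..N}. hi < int r + c}. a (int r + c) ^ half (int r))"
  define TB where "TB = (\<lambda>c. \<Prod>r\<in>{r\<in>{1..N}. hi < int r + c}. b (int r + c) ^ one (int r))"
  have PA: "(\<Prod>r=1..N. a (int r + c) ^ half (int r)) = A c * TA c" if "?lo \<le> c" for c
    unfolding A_def TA_def using that half0 by (intro prod_window) (auto simp: hi_def)
  have PB: "(\<Prod>r=1..N. b (int r + c) ^ one (int r)) = B c * TB c" if "?lo \<le> c" for c
    unfolding B_def TB_def using that one0 by (intro prod_window) (auto simp: hi_def)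
  have nearT: "near ?E (TA c)" "near ?E (TB c)" for c
    unfolding TA_def TB_def by (intro near_prod near_power E; use near_a near_b in simp)+
  have T0: "fps_nth (TA c) 0 = 1" "fps_nth (TB c) 0 = 1" "fps_nth (A c) 0 = 1" "fps_nth (B c) 0 = 1" for c
    unfolding TA_def TB_def A_def B_def by (intro prod_nth_0; simp add: fps_power_zeroth a0 b0)+
  \<comment> \<open>Multiplying by u^j moves the exponent of q by 2g j: hence the shifts - g and g
    in \<open>b\<close>, and 1 - 2g and 2g in \<open>a\<close>.\<close>
  define num where "num = (\<lambda>r. b (int r + - int g) ^ one (int r) * (a (int r + (1 - 2 * int g)) ^ half (int r) * a (int r + 2 * int g) ^ half (int r)))"
  define den where "den = (\<lambda>r. b (int r + int g) ^ one (int r) * (a (int r + 0) ^ half (int r) * a (int r + 1) ^ half (int r)))"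
  have U: "u_value g \<noteq> 0" by simp
  have num: "series_eval (u_value g) (factor_num m r) = num r" and den: "series_eval (u_value g) (factor_den m r) = den r"
    if r: "1 \<le> r" for r
  proof -
    have ir: "int (2 * r - 1) = 2 * int r - 1" using r by simp
    have o: "one (int r) = 1" using r by (simp add: one_def)
    have sl: "series_eval (u_value g) (1 - smono (-1) (2 * r - 1) m) = b (int r + - int g)"
      "series_eval (u_value g) (1 - smono 1 (2 * r - 1) m) = b (int r + int g)"
      "series_eval (u_value g) (1 - smono (-2) (2 * (r + 1)) (2 * m)) = a (int r + (1 - 2 * int g))"
      "series_eval (u_value g) (1 - smono 2 (2 * r) (2 * m)) = a (int r + 2 * int g)"
      "series_eval (u_value g) (1 - smono 0 (2 * r) (2 * m)) = a (int r + 0)"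
      "series_eval (u_value g) (1 - smono 0 (2 * (r + 1)) (2 * m)) = a (int r + 1)"
    proof -
      have SE: "series_eval (u_value g) (1 - smono j x m') = lin ((if odd j then -1 else 1) * fls_X powi k) m'"
        if "j = 0 \<or> j = 1 \<or> j = -1 \<or> j = 2 \<or> j = -2" "int x + 2 * int g * j = k" for j x k m'
        using series_eval_lin[OF that(1), of g x m'] unfolding that(2) .
      have ir': "int (2 * r - Suc 0) = 2 * int r - 1" using ir by simp
      show "series_eval (u_value g) (1 - smono (-1) (2 * r - 1) m) = b (int r + - int g)"
        unfolding b_def by (subst SE[where k = "2 * (int r + - int g) - 1"]) (simp_all add: ir ir')
      show "series_eval (u_value g) (1 - smono 1 (2 * r - 1) m) = b (int r + int g)"
        unfolding b_def by (subst SE[where k = "2 * (int r + int g) - 1"]) (simp_all add: ir ir')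
      show "series_eval (u_value g) (1 - smono (-2) (2 * (r + 1)) (2 * m)) = a (int r + (1 - 2 * int g))"
        unfolding a_def by (subst SE[where k = "2 * (int r + (1 - 2 * int g))"]) simp_all
      show "series_eval (u_value g) (1 - smono 2 (2 * r) (2 * m)) = a (int r + 2 * int g)"
        unfolding a_def by (subst SE[where k = "2 * (int r + 2 * int g)"]) simp_all
      show "series_eval (u_value g) (1 - smono 0 (2 * r) (2 * m)) = a (int r + 0)"
        unfolding a_def by (subst SE[where k = "2 * (int r + 0)"]) simp_all
      show "series_eval (u_value g) (1 - smono 0 (2 * (r + 1)) (2 * m)) = a (int r + 1)"
        unfolding a_def by (subst SE[where k = "2 * (int r + 1)"]) simp_all
    qed
    show "series_eval (u_value g) (factor_num m r) = num r"
      unfolding factor_num_def num_def o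
      by (simp only: series_eval_mult[OF _ _ U] series_eval_power[OF U] tame_mult tame_power tame_one_minus_smono sl power_one_right)
    show "series_eval (u_value g) (factor_den m r) = den r"
      unfolding factor_den_def den_def o
      by (simp only: series_eval_mult[OF _ _ U] series_eval_power[OF U] tame_mult tame_power tame_one_minus_smono sl power_one_right)
  qed
  let ?P = "\<Prod>r=1..N. series_eval (u_value g) (product_factor (m, r))"
  have "series_eval (u_value g) (product_factor (m, r)) * den r = num r" if "r \<in> {1..N}" for r
    using series_eval_mult[of "product_factor (m, r)" "factor_den m r" "u_value g"] that
      graded_tame[OF graded_product_factor[OF m]] graded_tame[OF graded_factor(2)[OF m]]
    by (simp add: product_factor_mult[OF m] num den)
  then have "?P * (\<Prod>r=1..N. den r) = (\<Prod>r=1..N. num r)"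
    unfolding prod.distrib[symmetric] by (intro prod.cong) auto
  then have main: "?P * (B (int g) * TB (int g) * (A 0 * TA 0 * (A 1 * TA 1))) =
    B (- int g) * TB (- int g) * (A (1 - 2 * int g) * TA (1 - 2 * int g) * (A (2 * int g) * TA (2 * int g)))"
    unfolding num_def den_def prod.distrib using g by (simp only: PA PB)
  have AA: "A (1 - 2 * int g) * A (2 * int g) = A 0 * A 1 * (\<Prod>s=- (2 * int g)..2 * int g. a s ^ excess g s)"
  proof -
    have "(\<Prod>s=- (2 * int g)..2 * int g. a s ^ excess g s) = (\<Prod>s=?lo..hi. a s ^ excess g s)"
      by (rule prod.mono_neutral_left) (use hi in \<open>auto simp: excess_eq_0\<close>)
    then show ?thesis
      unfolding A_def prod.distrib[symmetric] by (simp flip: power_add prod.distrib add: half_excess)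
  qed
  have BB: "B (- int g) = B (int g) * (\<Prod>s=1 - int g..int g. b s)"
  proof -
    have "(\<Prod>s=1 - int g..int g. b s) = (\<Prod>s=?lo..hi. b s ^ (if s \<in> {1 - int g..int g} then 1 else 0))"
      by (rule prod.mono_neutral_cong_left) (use hi in auto)
    moreover have "one (s - - int g) = one (s - int g) + (if s \<in> {1 - int g..int g} then 1 else 0)" for s
      using g by (auto simp: one_def)
    ultimately show ?thesis unfolding B_def by (simp flip: prod.distrib power_add)
  qed
  define T where "T = TB (int g) * (TA 0 * TA 1)"
  define T' where "T' = TB (- int g) * (TA (1 - 2 * int g) * TA (2 * int g))"
  have "(B (int g) * (A 0 * A 1)) * (?P * T) = (B (int g) * (A 0 * A 1)) * (level_factor g m * T')"
  proof -
    have "(B (int g) * (A 0 * A 1)) * (?P * T) = (B (- int g) * (A (1 - 2 * int g) * A (2 * int g))) * T'"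
      using main unfolding T_def T'_def by (simp only: mult_ac)
    also have "\<dots> = (B (int g) * (A 0 * A 1)) * (level_factor g m * T')"
    proof -
      have "level_factor g m = (\<Prod>s=1 - int g..int g. b s) * (\<Prod>s=- (2 * int g)..2 * int g. a s ^ excess g s)"
        unfolding level_factor_eq a_def b_def ..
      then show ?thesis unfolding AA BB by (simp only: mult_ac)
    qed
    finally show ?thesis .
  qed
  moreover have "B (int g) * (A 0 * A 1) \<noteq> 0"
  proof
    assume "B (int g) * (A 0 * A 1) = 0"
    then have "fps_nth (B (int g) * (A 0 * A 1)) 0 = fps_nth 0 0" by (simp only:)
    then show False by (simp add: T0)
  qed
  ultimately have PT: "?P * T = level_factor g m * T'" by simp
  have Tn: "near ?E T" "near ?E T'" unfolding T_def T'_def by (intro near_mult nearT E)+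
  have Tz: "fps_nth T 0 = 1" unfolding T_def by (simp add: T0)
  have "T * inverse T = 1" using Tz by (intro inverse_mult_eq_1') simp
  moreover have "?P * (T * inverse T) = level_factor g m * (T' * inverse T)"
    unfolding mult.assoc[symmetric] PT ..
  ultimately have "?P = level_factor g m * (T' * inverse T)" by (simp only: mult_1_right)
  moreover have "near ?E (T' * inverse T)" by (intro near_mult near_inverse Tn Tz E)
  ultimately show thesis unfolding hi_def by (rule that)
qed

lemma ords_ge_upto: "\<exists>c\<ge>0. \<forall>n\<le>N. ord_ge (- c) (fps_nth f n)"
proof (induction N)
  case 0
  then show ?case using ord_ge_exists[of "fps_nth f 0"] by auto
next
  case (Suc N)
  then obtain c where c: "c \<ge> 0" "\<forall>n\<le>N. ord_ge (- c) (fps_nth f n)" by blast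
  obtain d where d: "d \<ge> 0" "ord_ge (- d) (fps_nth f (Suc N))" using ord_ge_exists by blast
  have "\<forall>n\<le>Suc N. ord_ge (- (c + d)) (fps_nth f n)"
    using c d by (auto simp: le_Suc_eq intro: ord_ge_mono)
  then show ?case using c(1) d(1) by (intro exI[of _ "c + d"]) auto
qed

text \<open>The product converges in t and q jointly, whereas the substitution lowers orders in q.
  At t^N the loss is at most 2gN because the product is graded, so truncating at r \<le> M changes
  the value only in high order; the tails from \<open>level_product\<close> are estimated
  likewise.\<close>

theorem series_eval_Q:
  assumes g: "0 < g"
  shows "series_eval (u_value g) product_Q = tprod (level_factor g)"
proof (rule fps_ext)
  fix N
  let ?U = "u_value g"
  let ?Z = "\<Prod>m=1..N. level_factor g m"
  have tp: "fps_nth (tprod (level_factor g)) N = fps_nth ?Z N" by (simp add: tprod_def)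
  obtain c where c: "0 \<le> c" "\<And>n. n \<le> N \<Longrightarrow> ord_ge (- c) (fps_nth ?Z n)" using ords_ge_upto by blast
  have "ord_ge E (fps_nth (series_eval ?U product_Q) N - fps_nth ?Z N)" for E
  proof -
    \<comment> \<open>The first summand allows \<open>level_product\<close>, the second reaches
      order E against the poles of the partial product, and the third pays for negative powers of u
      up to N.\<close>
    define M where "M = 4 * g + nat (\<bar>E\<bar> + c) + g * N"
    define S where "S = {1..N} \<times> {1..M}"
    have M: "4 * g \<le> M" by (simp add: M_def)
    let ?P = "\<Prod>i\<in>S. product_factor i"
    have ag: "agree2 N (2 * M) product_Q ?P"
      unfolding product_Q_def
    proof (rule formal_prod_partial)
      fix i assume i: "i \<in> {1..} \<times> {1..} - S"
      show "agree2 N (2 * M) (product_factor i) 1"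
      proof (rule ccontr)
        assume "\<not> ?thesis"
        then have "i \<in> {1..N} \<times> {r. 1 \<le> r \<and> 2 * r - 1 \<le> 2 * M}" using bad_factors[of N "2 * M"] i by blast
        then show False using i by (auto simp: S_def)
      qed
    qed (auto simp: S_def)
    have gP: "graded ?P" by (intro graded_prod) (auto simp: S_def intro: graded_product_factor)
    have "ord_ge E (fps_nth (series_eval ?U product_Q) N - fps_nth (series_eval ?U ?P) N)"
    proof -
      have ub: "u_bounded N (fps_nth product_Q N)" "u_bounded N (fps_nth ?P N)"
        using graded_Q gP by (auto simp: graded_def)
      have "fps_nth (series_eval ?U product_Q) N - fps_nth (series_eval ?U ?P) N =
        (\<Sum>j=-int N..int N. (u_coeff j (fps_nth product_Q N) - u_coeff j (fps_nth ?P N)) * ?U powi j)"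
        by (simp add: series_eval_def u_eval_eq[OF ub(1)] u_eval_eq[OF ub(2)] left_diff_distrib sum_subtractf)
      also have "ord_ge E \<dots>"
      proof (rule ord_ge_sum)
        fix j assume j: "j \<in> {-int N..int N}"
        have "ord_ge (2 * int M + 1) (u_coeff j (fps_nth product_Q N) - u_coeff j (fps_nth ?P N))"
          using ag by (auto simp: ord_ge_def u_coeff_def agree2_def)
        from ord_ge_mult[OF this ord_ge_u_value_powi[of g j]]
        show "ord_ge E ((u_coeff j (fps_nth product_Q N) - u_coeff j (fps_nth ?P N)) * ?U powi j)"
        proof (rule ord_ge_mono)
          have "int g * j \<ge> int g * (- int N)" using j by (intro mult_left_mono) auto
          then show "E \<le> 2 * int M + 1 + 2 * int g * j" using c(1) by (simp add: M_def)
        qed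
      qed
      finally show ?thesis .
    qed
    moreover have "ord_ge E (fps_nth (series_eval ?U ?P) N - fps_nth ?Z N)"
    proof -
      define \<beta> where "\<beta> = (\<lambda>m. SOME \<beta>. (\<Prod>r=1..M. series_eval ?U (product_factor (m, r))) = level_factor g m * \<beta> \<and> near (2 * (int M - 2 * int g)) \<beta>)"
      have \<beta>: "(\<Prod>r=1..M. series_eval ?U (product_factor (m, r))) = level_factor g m * \<beta> m" "near (2 * (int M - 2 * int g)) (\<beta> m)"
        if "m \<in> {1..N}" for m
      proof -
        have "\<exists>\<beta>. (\<Prod>r=1..M. series_eval ?U (product_factor (m, r))) = level_factor g m * \<beta> \<and> near (2 * (int M - 2 * int g)) \<beta>"
          using level_product[OF g _ M, of m] that by (metis atLeastAtMost_iff less_eq_Suc_le One_nat_def)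
        from someI_ex[OF this]
        show "(\<Prod>r=1..M. series_eval ?U (product_factor (m, r))) = level_factor g m * \<beta> m" "near (2 * (int M - 2 * int g)) (\<beta> m)"
          by (auto simp: \<beta>_def)
      qed
      have "series_eval ?U ?P = (\<Prod>i\<in>S. series_eval ?U (product_factor i))"
        by (rule series_eval_prod[THEN conjunct2]) (auto simp: S_def intro!: graded_tame graded_product_factor)
      also have "\<dots> = (\<Prod>m=1..N. \<Prod>r=1..M. series_eval ?U (product_factor (m, r)))"
        unfolding S_def prod.cartesian_product by (simp add: case_prod_beta)
      also have "\<dots> = ?Z * (\<Prod>m=1..N. \<beta> m)"
        unfolding prod.distrib[symmetric] by (rule prod.cong[OF refl]) (rule \<beta>(1))
      finally have "fps_nth (series_eval ?U ?P) N - fps_nth ?Z N = fps_nth (?Z * ((\<Prod>m=1..N. \<beta> m) - 1)) N"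
        by (simp add: algebra_simps)
      also have "ord_ge E \<dots>"
        unfolding fps_mult_nth
      proof (rule ord_ge_sum)
        fix i assume i: "i \<in> {0..N}"
        have "near (2 * (int M - 2 * int g)) (\<Prod>m=1..N. \<beta> m)"
          by (intro near_prod \<beta>(2)) (use M in auto)
        then have "ord_ge (2 * (int M - 2 * int g)) (fps_nth ((\<Prod>m=1..N. \<beta> m) - 1) (N - i))"
          unfolding near_def ords_ge_def by blast
        from ord_ge_mult[OF c(2)[of i] this]
        show "ord_ge E (fps_nth ?Z i * fps_nth ((\<Prod>m=1..N. \<beta> m) - 1) (N - i))"
        proof (rule ord_ge_mono)
          have "int M = 4 * int g + (\<bar>E\<bar> + c) + int g * int N" using c(1) by (simp add: M_def)
          moreover have "0 \<le> int g * int N" by simp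
          ultimately show "E \<le> - c + 2 * (int M - 2 * int g)" using c(1) abs_ge_self[of E] abs_ge_zero[of E] of_nat_0_le_iff[of g, where 'a = int]
            unfolding right_diff_distrib distrib_left by linarith
        qed (use i in simp)
      qed
      finally show ?thesis .
    qed
    ultimately show ?thesis using ord_ge_add by fastforce
  qed
  then have "fps_nth (series_eval ?U product_Q) N - fps_nth ?Z N = 0" by (rule ord_ge_all_imp_0)
  then show "fps_nth (series_eval ?U product_Q) N = fps_nth (tprod (level_factor g)) N"
    unfolding tp by simp
qed

section \<open>The specialised partition side\<close>

definition box_factor :: "int \<Rightarrow> nat \<Rightarrow> laurent fps" where
  "box_factor \<epsilon> h = (1 - u_mono (-2 * \<epsilon>) (2 * h)) * fps_right_inverse (1 - u_mono 0 (2 * h)) 1"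

definition diag_factor :: "nat \<Rightarrow> laurent fps" where
  "diag_factor h = (1 - u_mono 1 h) * fps_right_inverse (1 - u_mono (-1) h) 1"

definition off_factor :: "int \<Rightarrow> laurent fps" where
  "off_factor h = box_factor 1 (nat h) * box_factor (-1) (nat h)"

definition on_factor :: "int \<Rightarrow> laurent fps" where
  "on_factor h = box_factor 1 (nat h) * diag_factor (nat h)"

definition nekrasov :: "nat set \<Rightarrow> laurent fps" where
  "nekrasov A = (- 1) ^ card A * maya_prod off_factor on_factor (maya A)"

definition energy_sets :: "nat \<Rightarrow> nat set set" where
  "energy_sets N = {A. finite A \<and> (\<Sum>a\<in>A. 2 * a + 1) = N}"

definition nekrasov_series :: series where
  "nekrasov_series = Abs_fps (\<lambda>N. \<Sum>A\<in>energy_sets N. nekrasov A)"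

lemma energy_sets_subset: "A \<in> energy_sets N \<Longrightarrow> A \<subseteq> {..<N}"
proof
  fix a assume A: "A \<in> energy_sets N" "a \<in> A"
  then have "2 * a + 1 \<le> (\<Sum>a\<in>A. 2 * a + 1)"
    by (intro member_le_sum) (auto simp: energy_sets_def)
  then show "a \<in> {..<N}" using A by (simp add: energy_sets_def)
qed

lemma finite_energy_sets: "finite (energy_sets N)"
  by (rule finite_subset[of _ "Pow {..<N}"]) (use energy_sets_subset in auto)

lemma series_divide_const:
  assumes "fps_nth b 0 = 1"
  shows "fps_const a \<oslash> fps_const b = fps_const (a * fps_right_inverse b 1)"
proof -
  have b: "b * fps_right_inverse b 1 = 1" using assms by (intro fps_right_inverse) simp
  have "fps_const a \<oslash> fps_const b = (fps_const a \<oslash> fps_const b) * fps_const b * fps_const (fps_right_inverse b 1)"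
    by (simp only: mult.assoc fps_const_mult b fps_const_1_eq_1 mult_1_right)
  also have "(fps_const a \<oslash> fps_const b) * fps_const b = fps_const a"
    using assms by (intro series_divide_mult_cancel) simp
  finally show ?thesis by simp
qed

lemma smono_const: "smono j a 0 = fps_const (u_mono j a)"
  by (simp add: smono_def)

lemma u_pow_q: "u_pow j * q ^ a = fps_const (u_mono j a)" "q ^ a = fps_const (u_mono 0 a)"
  using smono_eq[of j a 0] smono_eq[of 0 a 0] by (simp_all add: smono_const u_pow_0)

lemma u_mono_nth_0: "0 < a \<Longrightarrow> fps_nth (u_mono j a) 0 = 0"
  by (simp add: u_mono_nth)

lemma fps_const_one_minus: "1 - fps_const a = fps_const (1 - a :: 'a::ring_1)"
  by (simp flip: fps_const_sub)

lemma box_divide: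
  assumes "0 < h"
  shows "(1 - u_pow (-2 * \<epsilon>) * q ^ (2 * h)) \<oslash> (1 - q ^ (2 * h)) = fps_const (box_factor \<epsilon> h)"
  unfolding u_pow_q(1) unfolding u_pow_q(2) fps_const_one_minus box_factor_def using assms
  by (intro series_divide_const) (simp add: u_mono_nth_0)

lemma diag_divide:
  assumes "0 < h"
  shows "(1 - u_pow 1 * q ^ h) \<oslash> (1 - u_pow (-1) * q ^ h) = fps_const (diag_factor h)"
  unfolding u_pow_q(1) fps_const_one_minus diag_factor_def using assms
  by (intro series_divide_const) (simp add: u_mono_nth_0)

lemma hook_pos:
  assumes "p \<in> SC" "s \<in> boxes p"
  shows "0 < hook p s"
proof -
  obtain i j where s: "s = (i, j)" by force
  have "(i, j) \<in> {(i', j') \<in> boxes p. i' = i \<and> j \<le> j' \<or> j' = j \<and> i \<le> i'}" using assms(2) s by simp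
  moreover have "finite {(i', j') \<in> boxes p. i' = i \<and> j \<le> j' \<or> j' = j \<and> i \<le> i'}"
    by (rule finite_subset[OF _ finite_boxes[OF assms(1)]]) auto
  ultimately show ?thesis unfolding s hook_def by (auto simp: card_gt_0_iff)
qed

lemma partition_term:
  assumes p: "p \<in> SC"
  shows "(-1) ^ durfee p * t ^ sum_list p *
         (\<Prod>s\<in>boxes p. (1 - u_pow (-2 * eps s) * q ^ (2 * hook p s)) \<oslash> (1 - q ^ (2 * hook p s))) *
         (\<Prod>s\<in>diag p. (1 - u_pow 1 * q ^ hook p s) \<oslash> (1 - u_pow (-1) * q ^ hook p s)) =
       fps_const (nekrasov (frobenius p)) * t ^ sum_list p"
proof -
  have "(\<Prod>s\<in>boxes p. (1 - u_pow (-2 * eps s) * q ^ (2 * hook p s)) \<oslash> (1 - q ^ (2 * hook p s))) =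
      fps_const (\<Prod>s\<in>boxes p. box_factor (eps s) (hook p s))"
    unfolding fps_const_prod by (intro prod.cong refl box_divide hook_pos p)
  moreover have "(\<Prod>s\<in>diag p. (1 - u_pow 1 * q ^ hook p s) \<oslash> (1 - u_pow (-1) * q ^ hook p s)) =
      fps_const (\<Prod>s\<in>diag p. diag_factor (hook p s))"
    unfolding fps_const_prod by (intro prod.cong refl diag_divide hook_pos p) (auto simp: diag_def)
  moreover have "(-1 :: series) ^ durfee p = fps_const ((- 1) ^ card (frobenius p))"
    by (simp add: durfee_eq[OF p] fps_const_power[symmetric] flip: fps_const_neg)
  moreover have "(\<Prod>s\<in>boxes p. box_factor (eps s) (hook p s)) * (\<Prod>s\<in>diag p. diag_factor (hook p s)) =
      maya_prod off_factor on_factor (maya (frobenius p))"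
    unfolding SC_prod[OF p] by (simp add: off_factor_def[abs_def] on_factor_def[abs_def])
  ultimately show ?thesis
    unfolding nekrasov_def fps_const_mult[symmetric] by (simp only: mult_ac fps_const_mult)
qed

text \<open>A partition contributes to the single power of t given by its size, so a coefficient is
  final once the finitely many partitions of that size are included.\<close>

lemma has_formal_sum_nekrasov:
  "has_formal_sum (\<lambda>p. (-1) ^ durfee p * t ^ sum_list p *
         (\<Prod>s\<in>boxes p. (1 - u_pow (-2 * eps s) * q ^ (2 * hook p s)) \<oslash> (1 - q ^ (2 * hook p s))) *
         (\<Prod>s\<in>diag p. (1 - u_pow 1 * q ^ hook p s) \<oslash> (1 - u_pow (-1) * q ^ hook p s)))
      SC nekrasov_series"
  (is "has_formal_sum ?f SC _")
  unfolding has_formal_sum_def eventually_finite_subsets_at_top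
proof (intro allI exI conjI impI)
  fix n k :: nat
  define S0 where "S0 = {p \<in> SC. sum_list p = n}"
  have bij: "bij_betw frobenius S0 (energy_sets n)"
  proof (rule bij_betw_subset[OF bij_betw_frobenius])
    show "frobenius ` S0 = energy_sets n"
    proof safe
      fix p assume "p \<in> S0"
      then show "frobenius p \<in> energy_sets n"
        using finite_frobenius[of p] sum_list_eq[of p] by (simp add: S0_def energy_sets_def)
    next
      fix A assume A: "A \<in> energy_sets n"
      then have "A \<in> frobenius ` SC" using bij_betw_frobenius by (auto simp: bij_betw_def energy_sets_def)
      then obtain p where "p \<in> SC" "A = frobenius p" by blast
      then show "A \<in> frobenius ` S0"
        using A sum_list_eq[of p] by (auto simp: S0_def energy_sets_def)
    qed
  qed (auto simp: S0_def)
  show "finite S0" using bij_betw_finite[OF bij] finite_energy_sets by simp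
  show "S0 \<subseteq> SC" by (auto simp: S0_def)
  fix S assume S: "finite S \<and> S0 \<subseteq> S \<and> S \<subseteq> SC"
  have "fps_nth (?f p) n = (if p \<in> S0 then nekrasov (frobenius p) else 0)" if "p \<in> S" for p
  proof -
    have p: "p \<in> SC" using that S by blast
    show ?thesis unfolding partition_term[OF p] using p by (auto simp: t_def fps_X_power_nth S0_def)
  qed
  then have "fps_nth (\<Sum>p\<in>S. ?f p) n = (\<Sum>p\<in>S. if p \<in> S0 then nekrasov (frobenius p) else 0)"
    unfolding fps_sum_nth by (rule sum.cong[OF refl])
  also have "\<dots> = (\<Sum>p\<in>S0. nekrasov (frobenius p))"
    using S by (simp add: sum.If_cases Int_absorb1)
  also have "\<dots> = fps_nth nekrasov_series n"
    unfolding nekrasov_series_def by (simp add: sum.reindex_bij_betw[OF bij])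
  finally show "fps_nth (fps_nth (\<Sum>p\<in>S. ?f p) n) k = fps_nth (fps_nth nekrasov_series n) k" by simp
qed

lemma right_inverse_q:
  assumes "0 < a"
  shows "(1 - u_mono 0 a) * fps_right_inverse (1 - u_mono 0 a) 1 = 1"
  using assms by (intro fps_right_inverse) (simp add: u_mono_nth_0)

text \<open>A geometric series in q alone; the recursion i = 1 + q^a i is followed through the
  powers of q.\<close>

lemma u_bounded_inverse_q:
  assumes a: "0 < a"
  shows "u_bounded 0 (fps_right_inverse (1 - u_mono 0 a) 1)" (is "u_bounded 0 ?i")
  unfolding u_bounded_def
proof (intro allI impI)
  fix k and j :: int assume j: "int 0 < \<bar>j\<bar>"
  have "(1 - fps_X ^ a) * ?i = 1" using right_inverse_q[OF a] by (simp add: u_mono_def)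
  then have eq: "?i = 1 + fps_X ^ a * ?i" by (simp add: algebra_simps)
  show "lookup (fps_nth ?i k) j = 0"
  proof (induction k rule: less_induct)
    case (less k)
    have "fps_nth ?i k = (if k = 0 then 1 else 0) + (if k < a then 0 else fps_nth ?i (k - a))"
      by (subst eq) (simp add: fps_X_power_mult_nth fps_one_nth)
    then show ?case using less[of "k - a"] a j by (auto simp: lookup_add lookup_one when_def)
  qed
qed

lemma u_eval_inverse_q:
  assumes "0 < a" "U \<noteq> 0"
  shows "u_finite (fps_right_inverse (1 - u_mono 0 a) 1)"
    and "u_eval U (fps_right_inverse (1 - u_mono 0 a) 1) = inverse (1 - fls_X ^ a)"
proof -
  show fin: "u_finite (fps_right_inverse (1 - u_mono 0 a) 1)"
    using u_bounded_inverse_q[OF assms(1)] u_finite_def by blast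
  have "(1 - fls_X ^ a) * u_eval U (fps_right_inverse (1 - u_mono 0 a) 1) = 1"
    using u_eval_mult'[OF _ fin assms(2), of "1 - u_mono 0 a"] right_inverse_q[OF assms(1)]
    by (simp add: u_finite_diff u_eval_diff u_eval_mono u_eval_one)
  then show "u_eval U (fps_right_inverse (1 - u_mono 0 a) 1) = inverse (1 - fls_X ^ a)"
    by (simp add: inverse_unique)
qed

lemma box_factor_eval:
  assumes "0 < h" "U \<noteq> 0"
  shows "u_finite (box_factor \<epsilon> h)"
    and "u_eval U (box_factor \<epsilon> h) = (1 - fls_X ^ (2 * h) * U powi (-2 * \<epsilon>)) / (1 - fls_X ^ (2 * h))"
  using assms u_eval_inverse_q[of "2 * h" U]
  by (simp_all add: box_factor_def u_finite_mult u_finite_diff u_eval_mult' u_eval_diff u_eval_one u_eval_mono divide_inverse)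

text \<open>The inverse of 1 - u^(-1) q^h involves unbounded powers of u. It cancels against 1 -
  u^(-2) q^(2h) from the diagonal box, after which only a Laurent polynomial in u remains over the
  powers of q.\<close>

lemma on_factor_eq:
  assumes "0 < h"
  shows "on_factor (int h) = (1 + u_mono (-1) h) * (1 - u_mono 1 h) * fps_right_inverse (1 - u_mono 0 (2 * h)) 1"
proof -
  let ?i = "fps_right_inverse (1 - u_mono (-1) h) 1" and ?j = "fps_right_inverse (1 - u_mono 0 (2 * h)) 1"
  have i: "(1 - u_mono (-1) h) * ?i = 1" using assms by (intro fps_right_inverse) (simp add: u_mono_nth_0)
  have "u_mono (-1) h * u_mono (-1) h = u_mono (-2) (2 * h)" by (simp add: u_mono_mult mult_2)
  then have sq: "1 - u_mono (-2) (2 * h) = (1 + u_mono (-1) h) * (1 - u_mono (-1) h)" by (simp add: algebra_simps)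
  have "on_factor (int h) = (1 - u_mono (-2) (2 * h)) * ?j * ((1 - u_mono 1 h) * ?i)"
    by (simp add: on_factor_def box_factor_def diag_factor_def)
  then have "on_factor (int h) = (1 + u_mono (-1) h) * (1 - u_mono 1 h) * ?j * ((1 - u_mono (-1) h) * ?i)"
    unfolding sq by (simp only: mult_ac)
  then show ?thesis unfolding i by simp
qed

lemma on_factor_eval:
  assumes "0 < h" "U \<noteq> 0"
  shows "u_finite (on_factor (int h))"
    and "u_eval U (on_factor (int h)) = (1 + fls_X ^ h * U powi (-1)) * (1 - fls_X ^ h * U) / (1 - fls_X ^ (2 * h))"
  using assms u_eval_inverse_q[of "2 * h" U]
  by (simp_all add: on_factor_eq u_finite_mult u_finite_add u_finite_diff u_eval_mult' u_eval_add' u_eval_diff u_eval_one u_eval_mono divide_inverse)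

lemma u_eval_sign: "u_finite ((- 1) ^ k) \<and> u_eval U ((- 1) ^ k) = (- 1) ^ k" if "U \<noteq> 0"
proof (induction k)
  case (Suc k)
  have "u_finite (- 1)" "u_eval U (- 1) = - 1"
    using u_finite_diff[of 0 1] u_eval_diff[of 0 1 U] by (simp_all add: u_eval_one)
  then show ?case using Suc that by (simp only: power_Suc u_finite_mult u_eval_mult' simp_thms)
qed (simp add: u_eval_one)

text \<open>With U^2 = q^(4g) the two box factors at h become R (h - 2g) / R h and R (h + 2g) / R h;
  on the diagonal the sign of U yields 1 - q^(h - 2g) and 1 + q^(h + 2g).\<close>

lemma nekrasov_eval:
  assumes g: "0 < g" and A: "finite A"
  shows "u_finite (nekrasov A)"
    and "u_eval (u_value g) (nekrasov A) = (- 1) ^ card A *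
      maya_prod (principal.off_diag fls_X g) (principal.on_diag fls_X g) (maya A)"
proof -
  interpret principal "fls_X :: rat fls" g by (rule principal_fls_X[OF g])
  let ?U = "u_value g"
  have off: "u_finite (off_factor h)" "u_eval ?U (off_factor h) = off_diag h" if "0 < h" for h :: int
  proof -
    have h: "0 < nat h" "fls_X ^ (2 * nat h) = (fls_X powi (2 * h) :: rat fls)"
      using that power_int_of_nat[of "fls_X :: rat fls" "2 * nat h"] by simp_all
    show "u_finite (off_factor h)" unfolding off_factor_def using box_factor_eval(1)[OF h(1), of ?U] by (simp add: u_finite_mult)
    have U2: "?U powi 2 = fls_X powi (2 * (2 * int g))" "?U powi (-2) = fls_X powi (2 * (- (2 * int g)))"
      using u_value_powi[of g 2] u_value_powi[of g "-2"] by (simp_all add: algebra_simps)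
    have m: "(fls_X powi (2 * h) :: rat fls) * fls_X powi (2 * k) = fls_X powi (2 * (h + k))" for k
      by (simp only: distrib_left w_add)
    have "(-2 :: int) * -1 = 2" by simp
    then have "u_eval ?U (box_factor 1 (nat h)) = R (h - 2 * int g) / R h"
        "u_eval ?U (box_factor (-1) (nat h)) = R (h + 2 * int g) / R h"
      by (simp_all only: box_factor_eval(2)[OF h(1) u_value_nonzero] h(2) mult_1_right U2 m R_def diff_conv_add_uminus)
    then show "u_eval ?U (off_factor h) = off_diag h"
      unfolding off_factor_def off_diag_def using box_factor_eval(1)[OF h(1), of ?U]
      by (simp add: u_eval_mult' power2_eq_square mult_ac)
  qed
  have on: "u_finite (on_factor h)" "u_eval ?U (on_factor h) = on_diag h" if "0 < h" for h :: int
  proof -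
    define n where "n = nat h"
    have n: "0 < n" "h = int n" using that by (auto simp: n_def)
    show "u_finite (on_factor h)" unfolding n(2) by (rule on_factor_eval[OF n(1) u_value_nonzero])
    have U: "?U = - (fls_X powi (2 * int g))" "?U powi (-1) = - (fls_X powi (- (2 * int g)))"
      using u_value_powi[of g "-1"] by (simp_all add: u_value_def)
    have p: "fls_X ^ n = (fls_X powi h :: rat fls)" "fls_X ^ (2 * n) = (fls_X powi (2 * h) :: rat fls)"
      using power_int_of_nat[of "fls_X :: rat fls" n] power_int_of_nat[of "fls_X :: rat fls" "2 * n"] by (simp_all add: n(2))
    show "u_eval ?U (on_factor h) = on_diag h"
      unfolding n(2) on_factor_eval(2)[OF n(1) u_value_nonzero] U(2) unfolding U(1) p on_diag_def n(2)[symmetric]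
      by (simp only: R_def diff_conv_add_uminus w_add mult_minus_right minus_minus)
  qed
  have fin: "u_finite (\<Prod>(b, c)\<in>maya_pairs (maya A). off_factor (b + c + 1))" "u_finite (\<Prod>b\<in>maya A \<inter> {0..}. on_factor (2 * b + 1))"
    by (intro u_finite_prod; auto simp: maya_pairs_def intro!: off on)+
  then show "u_finite (nekrasov A)" using u_eval_sign[of ?U "card A"]
    by (simp add: nekrasov_def maya_prod_def u_finite_mult)
  have "u_eval ?U (\<Prod>(b, c)\<in>maya_pairs (maya A). off_factor (b + c + 1)) = (\<Prod>(b, c)\<in>maya_pairs (maya A). off_diag (b + c + 1))"
    unfolding case_prod_beta by (subst u_eval_prod) (auto simp: maya_pairs_def intro!: off on prod.cong)
  moreover have "u_eval ?U (\<Prod>b\<in>maya A \<inter> {0..}. on_factor (2 * b + 1)) = (\<Prod>b\<in>maya A \<inter> {0..}. on_diag (2 * b + 1))"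
    by (subst u_eval_prod) (auto intro!: off on prod.cong)
  ultimately show "u_eval ?U (nekrasov A) = (- 1) ^ card A * maya_prod off_diag on_diag (maya A)"
    using u_eval_sign[of ?U "card A"] fin
    by (simp add: nekrasov_def maya_prod_def u_finite_mult u_eval_mult')
qed

lemma tame_nekrasov: "tame nekrasov_series"
  unfolding tame_def nekrasov_series_def fps_nth_Abs_fps
  by (intro allI u_finite_sum nekrasov_eval(1)[of 1]) (auto simp: energy_sets_def)

text \<open>Sets whose diagram is not closed under subtracting 2g have weight 0; the others are the
  images of lattice vectors, with energy equal to size.\<close>

theorem series_eval_nekrasov:
  assumes g: "0 < g"
  shows "fps_const (core_value g fls_X 0) * series_eval (u_value g) nekrasov_series = core_series g fls_X"
proof (rule fps_ext)
  fix N
  interpret principal "fls_X :: rat fls" g by (rule principal_fls_X[OF g])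
  let ?C = "{m \<in> restricted g. total_energy g m = int N}"
  let ?s = "\<lambda>A. (- 1) ^ card A * weight (maya A)"
  have beads: "core_beads g m \<in> energy_sets N \<longleftrightarrow> total_energy g m = int N" if "m \<in> restricted g" for m
  proof -
    have "int (\<Sum>a\<in>core_beads g m. 2 * a + 1) = total_energy g m"
      using core_weight_energy[OF that] by (simp add: add.commute)
    then have "(\<Sum>a\<in>core_beads g m. 2 * a + 1) = N \<longleftrightarrow> total_energy g m = int N"
      by (metis of_nat_eq_iff)
    then show ?thesis using finite_core_beads[OF g, of m] by (simp add: energy_sets_def)
  qed
  have "fps_nth (series_eval (u_value g) nekrasov_series) N = (\<Sum>A\<in>energy_sets N. u_eval (u_value g) (nekrasov A))"
    unfolding series_eval_def nekrasov_series_def fps_nth_Abs_fps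
    by (rule u_eval_sum') (auto simp: energy_sets_def intro: nekrasov_eval(1)[OF g])
  also have "\<dots> = (\<Sum>A\<in>energy_sets N. ?s A)"
    by (intro sum.cong refl nekrasov_eval(2)[OF g]) (auto simp: energy_sets_def)
  also have "\<dots> = (\<Sum>A\<in>core_beads g ` ?C. ?s A)"
  proof (rule sum.mono_neutral_right[OF finite_energy_sets])
    show "core_beads g ` ?C \<subseteq> energy_sets N" using beads by auto
    show "\<forall>A\<in>energy_sets N - core_beads g ` ?C. ?s A = 0"
    proof
      fix A assume A: "A \<in> energy_sets N - core_beads g ` ?C"
      then have fin: "finite A" by (simp add: energy_sets_def)
      have "\<exists>b. b \<in> maya A \<and> b - 2 * int g \<notin> maya A"
      proof (rule ccontr)
        assume "\<not> ?thesis"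
        then obtain m where m: "m \<in> restricted g" "core_beads g m = A" using core_beads_surj[OF g fin] by blast
        then show False using A beads[OF m(1)] by blast
      qed
      then show "?s A = 0" using weight_eq_0[OF fin] by auto
    qed
  qed
  also have "\<dots> = (\<Sum>m\<in>?C. ?s (core_beads g m))"
    by (subst sum.reindex) (auto intro: inj_on_subset[OF core_beads_inj[OF g]])
  finally have "fps_nth (fps_const (core_value g fls_X 0) * series_eval (u_value g) nekrasov_series) N =
      (\<Sum>m\<in>?C. core_value g fls_X 0 * ?s (core_beads g m))"
    by (simp add: sum_distrib_left)
  also have "\<dots> = (\<Sum>m\<in>?C. core_value g fls_X m)"
    using core_weight_energy
    by (intro sum.cong refl) (simp add: maya_core_beads[OF g] mult.commute[of "core_value g fls_X 0"])
  finally show "fps_nth (fps_const (core_value g fls_X 0) * series_eval (u_value g) nekrasov_series) N =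
      fps_nth (core_series g fls_X) N"
    by (simp add: core_series_def)
qed

lemma (in principal) weyl_principal_nonzero: "weyl g (\<lambda>i. w powi (2 * int i + 1)) \<noteq> 0"
proof -
  have "1 + w powi (2 * int i + 1) \<noteq> 0" for i by (intro one_plus_odd) simp
  moreover have "weyl_pair (w powi (2 * int i + 1)) (w powi (2 * int j + 1)) \<noteq> 0" if "(i, j) \<in> pairs g" for i j
  proof -
    have "2 * int i + 1 + (2 * int j + 1) \<noteq> 0" "2 * int i + 1 - (2 * int j + 1) \<noteq> 0"
      using that by (auto simp: pairs_def)
    then have "1 - w powi (2 * int i + 1 + (2 * int j + 1)) \<noteq> 0" "1 - w powi (2 * int i + 1 - (2 * int j + 1)) \<noteq> 0"
      by (metis w_generic right_minus_eq)+
    then show ?thesis unfolding weyl_pair_powi by (intro no_zero_divisors w_powi_nonzero)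
  qed
  ultimately show ?thesis by (auto simp: weyl_def weyl_pair_def)
qed

lemma core_value_0: "core_value g w 0 = weyl g (\<lambda>i. w powi (2 * int i + 1))"
  by (simp add: core_value_def charge_def)

section \<open>The quotient of the two sides\<close>

definition product_P :: series where
  "product_P = tprod (\<lambda>m. 1 \<oslash> (1 + t ^ m))"

definition product_P_inverse :: series where
  "product_P_inverse = tprod (\<lambda>m. 1 + t ^ m)"

lemma near_one_plus: "near_one (\<lambda>m. 1 + fps_X ^ m :: 'a::comm_ring_1 fps)"
  using near_one_linear[of 1 1] by simp

lemma P_factor: "0 < m \<Longrightarrow> (1 \<oslash> (1 + t ^ m)) * (1 + t ^ m) = 1"
  by (rule series_divide_mult_cancel) (simp add: t_def)

lemma near_one_P: "near_one (\<lambda>m. 1 \<oslash> (1 + t ^ m))"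
  unfolding near_one_def
proof (intro allI impI)
  fix m :: nat assume m: "1 \<le> m"
  have "agree (m - 1) (1 + t ^ m) 1" using near_one_plus[where 'a = "laurent fps"] m by (simp add: near_one_def t_def)
  then have "agree (m - 1) ((1 \<oslash> (1 + t ^ m)) * (1 + t ^ m)) ((1 \<oslash> (1 + t ^ m)) * 1)"
    by (intro agree_mult) simp_all
  then show "agree (m - 1) (1 \<oslash> (1 + t ^ m)) 1"
    using P_factor[of m] m by (simp add: agree_sym)
qed

lemma tprod_cong: "(\<And>m. 0 < m \<Longrightarrow> f m = h m) \<Longrightarrow> tprod f = tprod h"
  unfolding tprod_def
  by (rule arg_cong[where f = Abs_fps], rule ext, rule arg_cong2[where f = fps_nth], rule prod.cong) auto

lemma product_P_mult_inverse: "product_P * product_P_inverse = 1"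
proof -
  have "product_P * product_P_inverse = tprod (\<lambda>m. (1 \<oslash> (1 + t ^ m)) * (1 + t ^ m))"
    unfolding product_P_def product_P_inverse_def
    by (rule tprod_mult[symmetric, OF near_one_P]) (simp add: t_def near_one_plus)
  also have "\<dots> = tprod (\<lambda>m. 1)" by (rule tprod_cong) (rule P_factor)
  finally show ?thesis by (simp add: tprod_one)
qed

lemma has_formal_prod_P: "has_formal_prod (\<lambda>m. 1 \<oslash> (1 + t ^ m)) {1..} product_P"
  unfolding has_formal_prod_def eventually_finite_subsets_at_top
proof (intro allI exI conjI impI)
  fix n k :: nat and S :: "nat set"
  show "finite {1..n}" "{1..n} \<subseteq> {1..}" by auto
  assume S: "finite S \<and> {1..n} \<subseteq> S \<and> S \<subseteq> {1..}"
  have "agree n (\<Prod>m\<in>S. 1 \<oslash> (1 + t ^ m)) (\<Prod>m=1..n. 1 \<oslash> (1 + t ^ m))"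
  proof (rule agree_prod_subset)
    fix i assume i: "i \<in> S - {1..n}"
    then have "1 \<le> i" "n \<le> i - 1" using S by auto
    then show "agree n (1 \<oslash> (1 + t ^ i)) 1" using near_one_P agree_mono unfolding near_one_def by blast
  qed (use S in auto)
  moreover have "agree n product_P (\<Prod>m=1..n. 1 \<oslash> (1 + t ^ m))"
    unfolding product_P_def by (rule agree_tprod[OF near_one_P order_refl])
  ultimately show "fps_nth (fps_nth (\<Prod>m\<in>S. 1 \<oslash> (1 + t ^ m)) n) k = fps_nth (fps_nth product_P n) k"
    by (simp add: agree_def)
qed

definition constant_coeffs :: "rat fls fps \<Rightarrow> bool" where
  "constant_coeffs f \<longleftrightarrow> (\<forall>n. fps_nth f n \<in> range fls_const)"

lemma range_fls_const:
  fixes x y :: "rat fls"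
  assumes "x \<in> range fls_const" "y \<in> range fls_const"
  shows "x + y \<in> range fls_const" "x - y \<in> range fls_const" "x * y \<in> range fls_const" "x / y \<in> range fls_const"
proof -
  obtain a b where ab: "x = fls_const a" "y = fls_const b" using assms by auto
  show "x + y \<in> range fls_const" "x - y \<in> range fls_const" "x * y \<in> range fls_const" "x / y \<in> range fls_const"
    unfolding ab by (simp_all add: fls_plus_const fls_minus_const fls_const_divide_const)
qed

lemma range_fls_const_of_int: "of_int k \<in> range (fls_const :: rat \<Rightarrow> rat fls)"
  by (simp add: fls_of_int)

lemma range_fls_const_01: "0 \<in> range (fls_const :: rat \<Rightarrow> rat fls)" "1 \<in> range (fls_const :: rat \<Rightarrow> rat fls)"
  using range_fls_const_of_int[of 0] range_fls_const_of_int[of 1] by simp_all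

lemma range_fls_const_sum: "(\<And>i. i \<in> I \<Longrightarrow> f i \<in> range fls_const) \<Longrightarrow> (\<Sum>i\<in>I. f i) \<in> range (fls_const :: rat \<Rightarrow> rat fls)"
  by (induction I rule: infinite_finite_induct) (auto intro: range_fls_const range_fls_const_01)

lemma constant_coeffs_mult: "constant_coeffs f \<Longrightarrow> constant_coeffs h \<Longrightarrow> constant_coeffs (f * h)"
  unfolding constant_coeffs_def fps_mult_nth
  by (intro allI range_fls_const_sum range_fls_const(3)) blast+

lemma constant_coeffs_prod: "(\<And>i. i \<in> I \<Longrightarrow> constant_coeffs (f i)) \<Longrightarrow> constant_coeffs (\<Prod>i\<in>I. f i)"
proof (induction I rule: infinite_finite_induct)
  case (insert x I)
  then show ?case by (simp add: constant_coeffs_mult)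
qed (auto simp: constant_coeffs_def fps_one_nth range_fls_const_01)

lemma constant_coeffs_power: "constant_coeffs f \<Longrightarrow> constant_coeffs (f ^ k)"
  using constant_coeffs_prod[of "{..<k}" "\<lambda>_. f"] by simp

lemma constant_coeffs_tprod: "(\<And>m. constant_coeffs (f m)) \<Longrightarrow> constant_coeffs (tprod f)"
  using constant_coeffs_prod[of _ f] by (simp add: constant_coeffs_def tprod_def)

lemma constant_coeffs_factor: "constant_coeffs (1 - fps_X ^ k)" "constant_coeffs (1 + fps_X ^ k)"
  unfolding constant_coeffs_def fps_sub_nth fps_add_nth fps_one_nth fps_X_power_nth
  by (intro allI range_fls_const; simp add: range_fls_const_01)+

text \<open>Each coefficient of f is solved for recursively; only division by the leading
  coefficient of h occurs, and this is a constant as well.\<close>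

lemma constant_coeffs_cancel:
  assumes fh: "constant_coeffs (h * f)" and h: "constant_coeffs h" and h0: "fps_nth h 0 \<noteq> 0"
  shows "constant_coeffs f"
  unfolding constant_coeffs_def
proof
  fix n
  show "fps_nth f n \<in> range fls_const"
  proof (induction n rule: less_induct)
    case (less n)
    have "fps_nth (h * f) n = fps_nth h 0 * fps_nth f n + (\<Sum>i=1..n. fps_nth h i * fps_nth f (n - i))"
    proof -
      have "{0..n} = insert 0 {1..n}" by auto
      then show ?thesis by (simp add: fps_mult_nth)
    qed
    then have "fps_nth f n = (fps_nth (h * f) n - (\<Sum>i=1..n. fps_nth h i * fps_nth f (n - i))) / fps_nth h 0"
      using h0 by (simp add: field_simps)
    also have "\<dots> \<in> range fls_const"
      using fh h less unfolding constant_coeffs_def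
      by (intro range_fls_const range_fls_const_sum) auto
    finally show ?case .
  qed
qed

lemma plus_t_eval: "tame (1 + t ^ m)" "series_eval U (1 + t ^ m) = 1 + fps_X ^ m"
proof -
  have c: "fps_nth (1 + t ^ m) n = (if n = 0 then 1 else 0) + (if n = m then 1 else 0)" for n
    by (simp add: t_def fps_one_nth fps_X_power_nth)
  show "tame (1 + t ^ m)" unfolding tame_def c by (intro allI u_finite_add) simp_all
  show "series_eval U (1 + t ^ m) = 1 + fps_X ^ m"
    by (rule fps_ext) (simp only: series_eval_def fps_nth_Abs_fps c, auto simp: u_eval_add' u_eval_one fps_one_nth fps_X_power_nth)
qed

lemma P_inverse_eval:
  assumes "U \<noteq> 0"
  shows "tame product_P_inverse" "constant_coeffs (series_eval U product_P_inverse)"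
proof -
  have n: "fps_nth product_P_inverse n = fps_nth (\<Prod>m=1..n. 1 + t ^ m) n" for n
    by (simp add: product_P_inverse_def tprod_def)
  have pr: "tame (\<Prod>m=1..n. 1 + t ^ m) \<and> series_eval U (\<Prod>m=1..n. 1 + t ^ m) = (\<Prod>m=1..n. series_eval U (1 + t ^ m))" for n :: nat
    by (intro series_eval_prod assms plus_t_eval)
  show "tame product_P_inverse" using pr unfolding tame_def n by blast
  have "fps_nth (series_eval U product_P_inverse) n = fps_nth (\<Prod>m=1..n. 1 + fps_X ^ m) n" for n
  proof -
    have "fps_nth (series_eval U product_P_inverse) n = fps_nth (series_eval U (\<Prod>m=1..n. 1 + t ^ m)) n"
      by (simp add: series_eval_def n)
    then show ?thesis using pr by (simp add: plus_t_eval)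
  qed
  then show "constant_coeffs (series_eval U product_P_inverse)"
    using constant_coeffs_prod[OF constant_coeffs_factor(2), of "\<lambda>m. m"] unfolding constant_coeffs_def by simp
qed

lemma agree2_Q:
  assumes "n = 0 \<or> k = 0"
  shows "agree2 n k product_Q 1"
  using formal_prod_partial[of "{}" "{1..} \<times> {1..}" n k product_factor] agree2_product_factor[of _ _ n k] assms
  unfolding product_Q_def by auto

lemma product_Q_0: "fps_nth product_Q 0 = 1"
proof (rule fps_ext)
  fix k show "fps_nth (fps_nth product_Q 0) k = fps_nth 1 k"
    using agree2_Q[of 0 k] by (simp add: agree2_def fps_one_nth)
qed

text \<open>Built from explicit inverses so that its tameness is visible: the first product is
  inverted factor by factor, the second within the graded series.\<close>

definition ratio :: series where
  "ratio = nekrasov_series * product_P_inverse * (1 \<oslash> product_Q)"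

lemma inverse_Q_mult: "(1 \<oslash> product_Q) * product_Q = 1"
  by (rule series_divide_mult_cancel) (simp add: product_Q_0)

lemma ratio_mult_Q: "ratio * product_Q = nekrasov_series * product_P_inverse"
  unfolding ratio_def mult.assoc inverse_Q_mult by simp

lemma ratio_mult: "ratio * (product_P * product_Q) = nekrasov_series"
proof -
  have "ratio * (product_P * product_Q) = (ratio * product_Q) * product_P" by (simp only: mult_ac)
  also have "\<dots> = nekrasov_series * (product_P * product_P_inverse)" unfolding ratio_mult_Q by (simp only: mult_ac)
  finally show ?thesis unfolding product_P_mult_inverse by simp
qed

lemma tame_ratio: "tame ratio"
  unfolding ratio_def
  by (intro tame_mult tame_nekrasov P_inverse_eval(1)[of 1] graded_tame graded_divide graded_Q product_Q_0) simp_all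

lemma constant_theta_const: "constant_coeffs (theta_const e)"
  unfolding theta_const_def by (intro constant_coeffs_tprod constant_coeffs_factor)

lemma tprod_level_factor:
  "tprod (level_factor g) = theta_const 2 ^ g * tprod (affine_term g (\<lambda>i. fls_X powi (2 * int i + 1)))"
proof -
  have "tprod (\<lambda>m. \<Prod>i<g. (1 - fps_X ^ (2 * m) :: rat fls fps)) = (\<Prod>i<g. tprod (\<lambda>m. 1 - fps_X ^ (2 * m)))"
    by (rule tprod_prod) (auto intro: near_one_minus)
  then have "tprod (\<lambda>m. (1 - fps_X ^ (2 * m) :: rat fls fps) ^ g) = theta_const 2 ^ g"
    by (simp add: theta_const_def)
  then show ?thesis unfolding level_factor_def[abs_def]
    by (simp add: tprod_mult near_one_power near_one_minus near_one_affine_term)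
qed

text \<open>Both specialised sides contain the same product T over the real affine roots, and the
  Weyl denominator normalises the partition side. Cancelling both leaves an equation D ratio = C in
  which C and D are free of q.\<close>

lemma series_eval_ratio:
  assumes g: "0 < g"
  shows "constant_coeffs (series_eval (u_value g) ratio)"
proof -
  interpret principal "fls_X :: rat fls" g by (rule principal_fls_X[OF g])
  let ?E = "series_eval (u_value g)" and ?x = "\<lambda>i. (fls_X powi (2 * int i + 1) :: rat fls)"
  define T where "T = tprod (affine_term g ?x)"
  define C where "C = fps_const (of_int (rho_coeff g 0)) * macdonald_const g * ?E product_P_inverse"
  define D where "D = (rho_series g * theta_const 2 ^ g :: rat fls fps)"
  define v where "v = core_value g (fls_X :: rat fls) 0"
  have v: "v = weyl g ?x" unfolding v_def by (rule core_value_0)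
  have v0: "v \<noteq> 0" unfolding v by (rule weyl_principal_nonzero)
  have U: "u_value g \<noteq> 0" by simp
  have "fps_const v * (fps_const (of_int (rho_coeff g 0)) * macdonald_const g * T) =
      fps_const v * (rho_series g * ?E nekrasov_series)"
    using macdonald_principal[OF g, of "fls_X :: rat fls"] series_eval_nekrasov[OF g]
    unfolding v[symmetric] v_def[symmetric] T_def[symmetric] by (simp add: mult_ac)
  then have eq: "fps_const (of_int (rho_coeff g 0)) * macdonald_const g * T = rho_series g * ?E nekrasov_series"
    using v0 by simp
  have EQ: "?E ratio * (theta_const 2 ^ g * T) = ?E nekrasov_series * ?E product_P_inverse"
    unfolding T_def tprod_level_factor[symmetric] series_eval_Q[OF g, symmetric]
    using series_eval_mult[OF tame_ratio graded_tame[OF graded_Q] U]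
      series_eval_mult[OF tame_nekrasov P_inverse_eval(1)[OF U] U] ratio_mult_Q by simp
  have "C * T = (rho_series g * ?E nekrasov_series) * ?E product_P_inverse"
    unfolding C_def eq[symmetric] by (simp only: mult_ac)
  also have "\<dots> = rho_series g * (?E ratio * (theta_const 2 ^ g * T))" unfolding EQ by (simp only: mult_ac)
  also have "\<dots> = (D * ?E ratio) * T" unfolding D_def by (simp only: mult_ac)
  finally have "(C - D * ?E ratio) * T = 0" by (simp add: algebra_simps)
  moreover have "T \<noteq> 0"
  proof
    assume "T = 0"
    then have "fps_nth T 0 = fps_nth 0 0" by (simp only:)
    then show False by (simp add: T_def)
  qed
  ultimately have CD: "D * ?E ratio = C" by simp
  have rho: "constant_coeffs (rho_series g)"
    by (simp add: constant_coeffs_def rho_series_def range_fls_const_of_int del: of_int_eq_iff)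
  have "constant_coeffs C" unfolding C_def macdonald_const_def
    by (intro constant_coeffs_mult constant_coeffs_power constant_coeffs_prod constant_theta_const P_inverse_eval(2)[OF U])
       (auto simp: constant_coeffs_def range_fls_const_of_int range_fls_const_01)
  moreover have "constant_coeffs D" unfolding D_def
    by (intro constant_coeffs_mult constant_coeffs_power constant_theta_const rho)
  moreover have "fps_nth D 0 \<noteq> 0"
  proof -
    \<comment> \<open>The leading coefficient of D is nonzero because it is a factor of the nonzero
      Weyl denominator.\<close>
    have "weyl g ?x = of_int (rho_coeff g 0) * orbit_sum g ?x 0"
      by (intro weyl_orbit_sum g w_powi_nonzero)
    then have "rho_coeff g 0 \<noteq> 0" using weyl_principal_nonzero by auto
    then show ?thesis by (simp add: D_def rho_series_def fps_power_zeroth theta_const_def)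
  qed
  ultimately show ?thesis using constant_coeffs_cancel[of D "?E ratio"] unfolding CD by blast
qed

lemma fls_const_eq: "c \<in> range fls_const \<Longrightarrow> k \<noteq> 0 \<Longrightarrow> fls_nth (c :: rat fls) k = 0"
  by auto

text \<open>For large \<open>g\<close> the powers of \<open>u\<close> land in disjoint ranges of exponents, so that each coefficient can
  be read off, starting with the lowest power of \<open>u\<close>.\<close>

lemma u_value_specialisation:
  assumes F: "u_finite F" and const: "\<And>g. 0 < g \<Longrightarrow> u_eval (u_value g) F \<in> range fls_const"
  shows "\<exists>c. F = fps_const (Poly_Mapping.single 0 c)"
proof -
  obtain B where B: "u_bounded B F" using F by (auto simp: u_finite_def)
  define c where "c = (\<lambda>j e. lookup (fps_nth F e) j)"
  have term_nth: "fls_nth (u_coeff j F * u_value g powi j) k =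
      (-1) powi j * (if 0 \<le> k - 2 * int g * j then of_int (c j (nat (k - 2 * int g * j))) else 0)" for j g k
  proof -
    have "u_coeff j F * u_value g powi j = fls_const ((-1) powi j) * fls_shift (- (2 * int g * j)) (u_coeff j F)"
      unfolding u_value_powi fls_X_powi by (cases "even j") (simp_all add: power_int_minus_left fls_shifted_times_simps)
    then show ?thesis by (simp add: u_coeff_def c_def)
  qed
  have zero: "\<forall>e. (J, e) \<noteq> (0, 0) \<longrightarrow> c J e = 0" for J
  proof (induction "nat (J + int B + 1)" arbitrary: J rule: less_induct)
    case less
    show ?case
    proof (intro allI impI)
      fix e :: nat assume ne: "(J, e) \<noteq> (0, 0)"
      show "c J e = 0"
      proof (cases "\<bar>J\<bar> \<le> int B")
        case False
        then show ?thesis using B by (simp add: c_def u_bounded_def)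
      next
        case True
        \<comment> \<open>With 2g > e the exponent k = e + 2gJ differs from 0, and larger powers of
          u start beyond k; smaller ones could reach k only through coefficients already shown to
          vanish.\<close>
        define g where "g = e + 1"
        define k where "k = int e + 2 * int g * J"
        have k: "k \<noteq> 0"
        proof (cases "J < 0")
          case True
          then have "int g * J \<le> int g * (-1)" by (intro mult_left_mono) auto
          moreover have "k = int e + 2 * (int g * J)" "int g = int e + 1" by (simp_all add: k_def g_def)
          ultimately show ?thesis by linarith
        next
          case False
          then show ?thesis using ne by (cases "J = 0") (auto simp: k_def g_def add_nonneg_eq_0_iff)
        qed
        have other: "fls_nth (u_coeff j F * u_value g powi j) k = 0" if "j \<noteq> J" "j \<in> {- int B..int B}" for j
        proof (cases "j < J")
          case True
          then have "\<forall>e'. (j, e') \<noteq> (0, 0) \<longrightarrow> c j e' = 0" using that by (intro less.hyps) auto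
          moreover have "(j, nat (k - 2 * int g * j)) \<noteq> (0, 0)" if "0 \<le> k - 2 * int g * j" using k that by auto
          ultimately have "c j (nat (k - 2 * int g * j)) = 0" if "0 \<le> k - 2 * int g * j" using that by blast
          then show ?thesis unfolding term_nth by simp
        next
          case False
          then have "int g * 1 \<le> int g * (j - J)" using that by (intro mult_left_mono) auto
          then have "k - 2 * int g * j < 0" by (simp add: k_def g_def algebra_simps)
          then show ?thesis unfolding term_nth by simp
        qed
        have "fls_nth (u_eval (u_value g) F) k = (\<Sum>j=-int B..int B. fls_nth (u_coeff j F * u_value g powi j) k)"
          unfolding u_eval_eq[OF B] by (rule fls_nth_sum)
        also have "\<dots> = fls_nth (u_coeff J F * u_value g powi J) k"
          using other True by (subst sum.remove[of _ J]) (auto intro!: sum.neutral)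
        also have "\<dots> = (-1) powi J * of_int (c J e)" unfolding term_nth by (simp add: k_def)
        finally have "(-1) powi J * rat_of_int (c J e) = 0"
          using fls_const_eq[OF const[of g] k] by (simp add: g_def)
        then show ?thesis by simp
      qed
    qed
  qed
  have "F = fps_const (Poly_Mapping.single 0 (c 0 0))"
  proof (rule fps_ext, rule poly_mapping_eqI)
    fix e j show "lookup (fps_nth F e) j = lookup (fps_nth (fps_const (Poly_Mapping.single 0 (c 0 0))) e) j"
      using zero[of j] by (cases "j = 0"; cases "e = 0") (auto simp: c_def lookup_single when_def)
  qed
  then show ?thesis by blast
qed

lemma ratio_nth: "\<exists>c. fps_nth ratio n = fps_const (Poly_Mapping.single 0 c)"
  using tame_ratio series_eval_ratio
  by (intro u_value_specialisation) (auto simp: tame_def constant_coeffs_def series_eval_def)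

section \<open>Euler's theorem and the value at q = 0\<close>

definition energy_gf :: "'a::comm_ring_1 fps" where
  "energy_gf = Abs_fps (\<lambda>N. \<Sum>A\<in>energy_sets N. (- 1) ^ card A)"

lemma near_one_odd: "near_one (\<lambda>m. 1 - fps_X ^ (2 * m - 1) :: 'a::comm_ring_1 fps)"
  by (auto simp: near_one_def agree_def fps_X_power_nth fps_one_nth)

text \<open>Expanding the product chooses a set A of odd parts 2 a + 1, with one sign for each
  part.\<close>

lemma energy_gf_eq: "energy_gf = tprod (\<lambda>m. 1 - fps_X ^ (2 * m - 1) :: 'a::comm_ring_1 fps)"
proof (rule fps_ext)
  fix n
  have "(\<Prod>m=1..n. 1 - fps_X ^ (2 * m - 1) :: 'a fps) = (\<Prod>m=1..n. - (fps_X ^ (2 * (m - 1) + 1)) + 1)"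
  proof (rule prod.cong[OF refl])
    fix m assume "m \<in> {1..n}"
    then have "2 * m - 1 = 2 * (m - 1) + 1" by auto
    then show "1 - fps_X ^ (2 * m - 1) = - (fps_X ^ (2 * (m - 1) + 1)) + (1 :: 'a fps)"
      by (simp only: uminus_add_conv_diff)
  qed
  also have "\<dots> = (\<Prod>a<n. - (fps_X ^ (2 * a + 1)) + 1)"
    by (rule prod.reindex_bij_witness[of _ Suc "\<lambda>m. m - 1"]) auto
  also have "\<dots> = (\<Sum>A\<in>Pow {..<n}. (\<Prod>a\<in>A. - (fps_X ^ (2 * a + 1))) * (\<Prod>a\<in>{..<n} - A. 1))"
    by (rule prod_add) simp
  also have "\<dots> = (\<Sum>A\<in>Pow {..<n}. fps_const ((- 1) ^ card A) * fps_X ^ (\<Sum>a\<in>A. 2 * a + 1))"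
    by (simp only: prod_uminus prod.neutral_const mult_1_right power_sum) (simp flip: fps_const_power fps_const_neg)
  finally have "fps_nth (\<Prod>m=1..n. 1 - fps_X ^ (2 * m - 1) :: 'a fps) n =
      (\<Sum>A\<in>Pow {..<n}. if (\<Sum>a\<in>A. 2 * a + 1) = n then (- 1) ^ card A else 0)"
    by (simp only: fps_sum_nth fps_mult_left_const_nth fps_X_power_nth) (auto intro!: sum.cong)
  also have "\<dots> = (\<Sum>A\<in>energy_sets n. (- 1) ^ card A)"
    by (rule sum.mono_neutral_cong_right)
       (use energy_sets_subset finite_subset in \<open>auto simp: energy_sets_def\<close>)
  finally show "fps_nth energy_gf n = fps_nth (tprod (\<lambda>m. 1 - fps_X ^ (2 * m - 1) :: 'a fps)) n"
    by (simp add: energy_gf_def tprod_def)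
qed

text \<open>The odd and even factors 1 - t^k together give all of them, and (1 + t^m) (1 - t^m) = 1
  - t^(2m); cancelling the even product leaves the claim.\<close>

lemma euler_odd_distinct: "energy_gf * tprod (\<lambda>m. 1 + fps_X ^ m) = (1 :: 'a::comm_ring_1 fps)"
proof -
  let ?O = "\<lambda>m. 1 - fps_X ^ (2 * m - 1) :: 'a fps" and ?E = "\<lambda>m. 1 - fps_X ^ (2 * m) :: 'a fps"
  let ?D = "\<lambda>m. 1 - fps_X ^ m :: 'a fps" and ?P = "\<lambda>m. 1 + fps_X ^ m :: 'a fps"
  have nD: "near_one ?D" using near_one_minus[of 1] by simp
  have nE: "near_one ?E" by (rule near_one_minus) simp
  \<comment> \<open>The first 2N factors contain N odd and N even ones, so the comparison is made at
    even lengths only.\<close>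
  have split: "(\<Prod>m=1..2 * N. ?D m) = (\<Prod>m=1..N. ?O m * ?E m)" for N
    by (induction N) (simp_all add: mult_ac)
  have "tprod ?D = tprod (\<lambda>m. ?O m * ?E m)"
  proof (rule tprod_unique[OF nD])
    fix N
    have "agree N (tprod (\<lambda>m. ?O m * ?E m)) (\<Prod>m=1..2 * N. ?D m)"
      unfolding split by (intro agree_tprod near_one_mult near_one_odd nE order_refl)
    then show "\<exists>M\<ge>N. agree N (tprod (\<lambda>m. ?O m * ?E m)) (\<Prod>m=1..M. ?D m)" by (intro exI[of _ "2 * N"]) simp
  qed
  then have OE: "tprod ?O * tprod ?E = tprod ?D" using tprod_mult[OF near_one_odd nE] by simp
  have "tprod ?P * tprod ?D = tprod (\<lambda>m. ?P m * ?D m)" by (simp add: tprod_mult near_one_plus nD)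
  also have "(\<lambda>m. ?P m * ?D m) = ?E" by (rule ext) (simp add: algebra_simps power_add[symmetric] mult_2)
  finally have OPE: "tprod ?O * tprod ?P * tprod ?E = tprod ?E" unfolding OE[symmetric] by (simp only: mult_ac)
  have inv: "tprod ?E * fps_right_inverse (tprod ?E) 1 = 1" by (intro fps_right_inverse) simp
  have "tprod ?O * tprod ?P * (tprod ?E * fps_right_inverse (tprod ?E) 1) = tprod ?E * fps_right_inverse (tprod ?E) 1"
    unfolding mult.assoc[symmetric] OPE ..
  then have "tprod ?O * tprod ?P = 1" unfolding inv by simp
  then show ?thesis by (simp add: energy_gf_eq)
qed

definition at_q_0 :: "series \<Rightarrow> laurent fps" where
  "at_q_0 f = Abs_fps (\<lambda>n. fps_nth (fps_nth f n) 0)"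

lemma at_q_0_mult: "at_q_0 (f * h) = at_q_0 f * at_q_0 h"
  by (simp add: fps_eq_iff at_q_0_def fps_mult_nth fps_sum_nth)

lemma at_q_0_one: "at_q_0 1 = 1"
  by (simp add: fps_eq_iff at_q_0_def fps_one_nth)

lemma at_q_0_Q: "at_q_0 product_Q = 1"
proof (rule fps_ext)
  fix n show "fps_nth (at_q_0 product_Q) n = fps_nth 1 n"
    using agree2_Q[of n 0] by (simp add: agree2_def at_q_0_def fps_one_nth)
qed

lemma at_q_0_P_inverse: "at_q_0 product_P_inverse = tprod (\<lambda>m. 1 + fps_X ^ m)"
proof (rule fps_ext)
  fix n
  have pr: "at_q_0 (\<Prod>m\<in>I. f m) = (\<Prod>m\<in>I. at_q_0 (f m))" for I :: "nat set" and f
    by (induction I rule: infinite_finite_induct) (simp_all add: at_q_0_one at_q_0_mult)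
  have f: "at_q_0 (1 + t ^ m) = 1 + fps_X ^ m" for m
    by (rule fps_ext) (simp add: at_q_0_def t_def fps_one_nth fps_X_power_nth)
  have "fps_nth (at_q_0 product_P_inverse) n = fps_nth (at_q_0 (\<Prod>m=1..n. 1 + t ^ m)) n"
    by (simp add: at_q_0_def product_P_inverse_def tprod_def)
  then show "fps_nth (at_q_0 product_P_inverse) n = fps_nth (tprod (\<lambda>m. 1 + fps_X ^ m)) n"
    unfolding pr f by (simp add: tprod_def)
qed

text \<open>Hook lengths are positive, so at q = 0 every box and diagonal factor is 1 and the sign
  alone survives.\<close>

lemma at_q_0_nekrasov: "at_q_0 nekrasov_series = energy_gf"
proof -
  have box: "fps_nth (box_factor \<epsilon> h) 0 = 1" "fps_nth (diag_factor h) 0 = 1" if "0 < h" for \<epsilon> h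
    using that by (simp_all add: box_factor_def diag_factor_def u_mono_nth_0)
  have "fps_nth (nekrasov A) 0 = (- 1) ^ card A" for A
  proof -
    have "fps_nth (maya_prod off_factor on_factor (maya A)) 0 = 1"
      unfolding maya_prod_def fps_mult_nth_0 fps_prod_nth_0
      by (auto simp: off_factor_def on_factor_def maya_pairs_def box fps_mult_nth_0 intro!: prod.neutral)
    then show ?thesis by (simp add: nekrasov_def fps_power_zeroth)
  qed
  then show ?thesis by (simp add: fps_eq_iff at_q_0_def nekrasov_series_def energy_gf_def fps_sum_nth)
qed

text \<open>The coefficients of the quotient are constants, so they can be read off at q = 0, where
  the double product is 1 and Euler's theorem makes the rest cancel.\<close>

lemma ratio_eq_1: "ratio = 1"
proof -
  have "at_q_0 (1 \<oslash> product_Q) = 1"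
    using at_q_0_mult[of "1 \<oslash> product_Q" product_Q] by (simp add: inverse_Q_mult at_q_0_Q at_q_0_one)
  then have "at_q_0 ratio = 1"
    by (simp add: ratio_def at_q_0_mult at_q_0_P_inverse at_q_0_nekrasov euler_odd_distinct)
  then have "fps_nth (fps_nth ratio n) 0 = fps_nth 1 n" for n
    by (simp add: fps_eq_iff at_q_0_def)
  moreover have "fps_nth ratio n = fps_const (fps_nth (fps_nth ratio n) 0)" for n
    using ratio_nth[of n] by auto
  ultimately show ?thesis by (intro fps_ext) (metis fps_const_0_eq_0 fps_const_1_eq_1 fps_one_nth)
qed

theorem theorem6p9:
  shows "\<exists>P Q :: series.
    has_formal_prod (\<lambda>m::nat. 1 \<oslash> (1 + t ^ m)) {1..} P \<and>
    has_formal_prod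
      (\<lambda>(m::nat, r::nat).
         ((1 - u_pow (-1) * q ^ (2 * r - 1) * t ^ m) \<oslash> (1 - u_pow 1 * q ^ (2 * r - 1) * t ^ m)) *
         (((1 - u_pow (-2) * q ^ (2 * (r + 1)) * t ^ (2 * m)) ^ nat \<lceil>real r / 2\<rceil> *
           (1 - u_pow 2 * q ^ (2 * r) * t ^ (2 * m)) ^ nat \<lceil>real r / 2\<rceil>) \<oslash>
          ((1 - q ^ (2 * r) * t ^ (2 * m)) ^ nat \<lceil>real r / 2\<rceil> *
           (1 - q ^ (2 * (r + 1)) * t ^ (2 * m)) ^ nat \<lceil>real r / 2\<rceil>)))
      ({1..} \<times> {1..}) Q \<and>
    has_formal_sum
      (\<lambda>p. (-1) ^ durfee p * t ^ sum_list p *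
         (\<Prod>s\<in>boxes p. (1 - u_pow (-2 * eps s) * q ^ (2 * hook p s)) \<oslash> (1 - q ^ (2 * hook p s))) *
         (\<Prod>s\<in>diag p. (1 - u_pow 1 * q ^ hook p s) \<oslash> (1 - u_pow (-1) * q ^ hook p s)))
      SC (P * Q)"
proof (intro exI conjI)
  show "has_formal_prod (\<lambda>m::nat. 1 \<oslash> (1 + t ^ m)) {1..} product_P" by (rule has_formal_prod_P)
  show "has_formal_prod
      (\<lambda>(m::nat, r::nat).
         ((1 - u_pow (-1) * q ^ (2 * r - 1) * t ^ m) \<oslash> (1 - u_pow 1 * q ^ (2 * r - 1) * t ^ m)) *
         (((1 - u_pow (-2) * q ^ (2 * (r + 1)) * t ^ (2 * m)) ^ nat \<lceil>real r / 2\<rceil> *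
           (1 - u_pow 2 * q ^ (2 * r) * t ^ (2 * m)) ^ nat \<lceil>real r / 2\<rceil>) \<oslash>
          ((1 - q ^ (2 * r) * t ^ (2 * m)) ^ nat \<lceil>real r / 2\<rceil> *
           (1 - q ^ (2 * (r + 1)) * t ^ (2 * m)) ^ nat \<lceil>real r / 2\<rceil>)))
      ({1..} \<times> {1..}) product_Q"
    using has_formal_prod_Q unfolding product_factor_def .
  have "nekrasov_series = product_P * product_Q"
    using ratio_mult by (simp add: ratio_eq_1)
  then show "has_formal_sum
      (\<lambda>p. (-1) ^ durfee p * t ^ sum_list p *
         (\<Prod>s\<in>boxes p. (1 - u_pow (-2 * eps s) * q ^ (2 * hook p s)) \<oslash> (1 - q ^ (2 * hook p s))) *
         (\<Prod>s\<in>diag p. (1 - u_pow 1 * q ^ hook p s) \<oslash> (1 - u_pow (-1) * q ^ hook p s)))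
      SC (product_P * product_Q)"
    using has_formal_sum_nekrasov by simp
qed

end
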